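(* Let $G=G^{(n)}$ be a sequence of edge-independent random graphs on $n$ vertices, let $x^{(0)}=x^{(0,n)}$ be an arbitrary initial distribution on the vertex set, and let $\bar{\lambda}=\max\{|\bar{\lambda}_2|,|\bar{\lambda}_n|\}$. Suppose that $\bar{d}_{\min}=\omega(\log n)$. Then there are constants $C_1,C_2,C_3>0$ that do not depend on $n$ or $k$ such that, with high probability, for all $k\ge 0$, $$\frac{\|x^{(k)}-\bar{x}^{(k)}\|_2}{\|x^{(0)}\|_2}\le C_1\sqrt{\frac{\log n}{n\bar{d}_{\min}}}\,\frac{1}{\|x^{(0)}\|_2}+C_2\,k\left(\bar{\lambda}+C_3\sqrt{\frac{\log n}{\bar{d}_{\min}}}\right)^{k-1}\sqrt{\frac{\bar{d}_{\max}\log n}{\bar{d}_{\min}^2}}.$$ Moreover, for a sequence of nonnegative weights $\gamma=\{\gamma_k\}_{k\ge 0}$ with $\sum_{k\ge 0}\gamma_k<\infty$, let $$g(\gamma,\bar{\lambda},\bar{d}_{\min})=\sum_{k\ge 1}\gamma_k\,k\left(\bar{\lambda}+C_3\sqrt{\frac{\log n}{\bar{d}_{\min}}}\right)^{k-1}.$$ Then, with high probability (the constants $C_1,C_2,C_3$ again not depending on $n$ or $k$), $$\frac{\|pr(\gamma,x^{(0)})-\bar{pr}(\gamma,x^{(0)})\|_2}{\|x^{(0)}\|_2}\le C_1\sqrt{\frac{\log n}{n\bar{d}_{\min}}}\,\frac{1}{\|x^{(0)}\|_2}+C_2\,g(\gamma,\bar{\lambda},\bar{d}_{\min})\sqrt{\frac{\bar{d}_{\max}\log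 n}{\bar{d}_{\min}^2}}.$$
   Context: Edge-independent random graph: a random undirected graph on a vertex set $V$, $|V|=n$, in which each edge $uv$ ($u,v\in V$, self-loops $u=v$ may be allowed) is present with probability $p_{uv}=p_{vu}\in[0,1]$, independently for different unordered pairs; so the symmetric adjacency matrix $A$ has entries $A_{uv}\sim\mathrm{Bernoulli}(p_{uv})$ and $\mathbb{E}[A_{uv}]=p_{uv}$. The $p_{uv}$ may depend on $n$; all asymptotic notation ($\omega$, $O$, $o$) refers to $n\to\infty$ along a sequence of such graphs $G^{(n)}$, and the superscript $n$ is usually omitted. $D$ is the diagonal matrix of degrees $d_v=\sum_u A_{uv}$ and $W=AD^{-1}$ is the random walk matrix. Mean-field counterparts: $\bar{A}=\mathbb{E}[A]$, $\bar{D}=\mathbb{E}[D]$ with diagonal entries $\bar{d}_v=\sum_u p_{uv}$, $\bar{W}=\bar{A}\bar{D}^{-1}$, $\bar{d}_{\min}=\min_v\bar{d}_v$, $\bar{d}_{\max}=\max_v\bar{d}_v$. The eigenvalues of $\bar{W}$ are $1=\bar{\lambda}_1\ge\bar{\lambda}_2\ge\dots\ge\bar{\lambda}_n\ge-1$. An initial distribution is a vector $x^{(0)}\in[0,1]^V$ with $\sum_v x^{(0)}_v=1$ (deterministic, possibly depending on $n$). The $k$-step landing probabilities are $x^{(k)}=W^kx^{(0)}$ and $\bar{x}^{(k)}=\bar{W}^kx^{(0)}$. For nonnegative weights $\gamma=\{\gamma_k\}_{k\ge0}$, the generalized PageRanks are $pr(\gamma,x^{(0)})=\sum_{k\ge0}\gamma_kx^{(k)}$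 and $\bar{pr}(\gamma,x^{(0)})=\sum_{k\ge0}\gamma_k\bar{x}^{(k)}$. An event occurs with high probability (w.h.p.) if it has probability at least $1-n^{-c}$ for some constant $c>0$. For $k=0$ the expression $k(\cdot)^{k-1}$ is read as $0$. *)

theory Defs
  imports
    "HOL-Probability.Probability"
    "Jordan_Normal_Form.Char_Poly"
begin

(* Matrices and vectors are those of Jordan_Normal_Form (carriers carrier_mat n n, carrier_vec n),
   because the dimension n varies along the sequence of graphs.  The vertex set is {..<n}. *)

(* E w u v: the edge uv is present in the outcome w.  Unordered pairs are represented by (u, v)
   with u <= v; the pair (u, u) is a self-loop, which is excluded by taking p u u = 0. *)
locale edge_independent_graph = prob_space M
  for M :: "'a measure" +
  fixes n :: nat
    and p :: "nat \<Rightarrow> nat \<Rightarrow> real"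
    and E :: "'a \<Rightarrow> nat \<Rightarrow> nat \<Rightarrow> bool"
  assumes p_range: "\<And>u v. u < n \<Longrightarrow> v < n \<Longrightarrow> p u v \<in> {0..1}"
    and p_sym: "\<And>u v. u < n \<Longrightarrow> v < n \<Longrightarrow> p u v = p v u"
    and E_sym: "\<And>w u v. w \<in> space M \<Longrightarrow> u < n \<Longrightarrow> v < n \<Longrightarrow> E w u v \<longleftrightarrow> E w v u"
    and E_indep: "indep_vars (\<lambda>_. count_space UNIV) (\<lambda>(u, v) w. E w u v)
                    {(u, v). u \<le> v \<and> v < n}"
    and E_prob: "\<And>u v. u < n \<Longrightarrow> v < n \<Longrightarrow> prob {w \<in> space M. E w u v} = p u v"

definition adjacency_mat :: "nat \<Rightarrow> (nat \<Rightarrow> nat \<Rightarrow> bool) \<Rightarrow> real mat" where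
  "adjacency_mat n e = Matrix.mat n n (\<lambda>(u, v). of_bool (e u v))"

(* The mean-field matrix: its entries p u v are the expectations of the adjacency entries,
   see expectation_adjacency_mat. *)
definition mean_adjacency_mat :: "nat \<Rightarrow> (nat \<Rightarrow> nat \<Rightarrow> real) \<Rightarrow> real mat" where
  "mean_adjacency_mat n p = Matrix.mat n n (\<lambda>(u, v). p u v)"

lemma (in edge_independent_graph) E_measurable:
  assumes "u < n" "v < n"
  shows "{w \<in> space M. E w u v} \<in> events"
proof -
  have *: "{w \<in> space M. E w a b} \<in> events" if "a \<le> b" "b < n" for a b
  proof -
    have "(\<lambda>w. E w a b) \<in> measurable M (count_space UNIV)"
      using E_indep that unfolding indep_vars_def by auto
    then show ?thesis
      by (simp add: pred_def)
  qed
  show ?thesis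
  proof (cases "u \<le> v")
    case True
    then show ?thesis using * assms by blast
  next
    case False
    then have "{w \<in> space M. E w u v} = {w \<in> space M. E w v u}"
      using E_sym assms by blast
    then show ?thesis using *[of v u] False assms by simp
  qed
qed

lemma (in edge_independent_graph) expectation_adjacency_mat:
  assumes "u < n" "v < n"
  shows "expectation (\<lambda>w. adjacency_mat n (E w) $$ (u, v)) = mean_adjacency_mat n p $$ (u, v)"
proof -
  have "expectation (\<lambda>w. adjacency_mat n (E w) $$ (u, v))
      = expectation (indicator {w \<in> space M. E w u v})"
    by (rule Bochner_Integration.integral_cong)
       (use assms in \<open>auto simp: adjacency_mat_def indicator_def\<close>)
  also have "\<dots> = prob {w \<in> space M. E w u v}"
    using E_measurable[OF assms] by simp
  finally show ?thesis
    using E_prob[OF assms] assms by (simp add: mean_adjacency_mat_def)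
qed

(* The following four definitions are applied both to the random adjacency matrix and to the
   mean-field matrix; by linearity the degrees of the latter are the expected degrees. *)

definition degree_of :: "real mat \<Rightarrow> nat \<Rightarrow> real" where
  "degree_of B v = (\<Sum>u<dim_row B. B $$ (u, v))"

definition min_degree :: "real mat \<Rightarrow> real" where
  "min_degree B = Min (degree_of B ` {..<dim_col B})"

definition max_degree :: "real mat \<Rightarrow> real" where
  "max_degree B = Max (degree_of B ` {..<dim_col B})"

(* B D^{-1}.  Since inverse 0 = 0, the column of an isolated vertex is set to zero, so that the
   matrix is defined (and substochastic) for every outcome. *)
definition walk_mat :: "real mat \<Rightarrow> real mat" where
  "walk_mat B = B * mat_diag (dim_col B) (\<lambda>v. inverse (degree_of B v))"

(* Eigenvalues with algebraic multiplicity in decreasing order; index i (from 0) holds the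
   (i+1)-st one.  Only real roots of the characteristic polynomial are listed; for the mean-field
   walk matrix with positive degrees, which is similar to a symmetric matrix, these are all n. *)
definition eigenvalues_desc :: "real mat \<Rightarrow> real list" where
  "eigenvalues_desc B = rev (sorted_list_of_multiset (proots (char_poly B)))"

(* max {|lambda_2|, |lambda_n|} for an n x n matrix *)
definition second_eigenvalue :: "real mat \<Rightarrow> real" where
  "second_eigenvalue B =
     max \<bar>eigenvalues_desc B ! 1\<bar> \<bar>eigenvalues_desc B ! (dim_row B - 1)\<bar>"

definition initial_distribution :: "nat \<Rightarrow> real Matrix.vec \<Rightarrow> bool" where
  "initial_distribution n x \<longleftrightarrow> x \<in> carrier_vec n
     \<and> (\<forall>v<n. vec_index x v \<in> {0..1}) \<and> (\<Sum>v<n. vec_index x v) = 1"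

definition l2_norm :: "real Matrix.vec \<Rightarrow> real" where
  "l2_norm x = L2_set (vec_index x) {..<dim_vec x}"

definition landing_prob :: "real mat \<Rightarrow> real Matrix.vec \<Rightarrow> nat \<Rightarrow> real Matrix.vec" where
  "landing_prob W x k = (W ^\<^sub>m k) *\<^sub>v x"

(* The series of vectors is taken entrywise; for (sub)stochastic W and summable weights it
   converges absolutely. *)
definition pagerank :: "(nat \<Rightarrow> real) \<Rightarrow> real mat \<Rightarrow> real Matrix.vec \<Rightarrow> real Matrix.vec" where
  "pagerank \<gamma> W x =
     Matrix.vec (dim_vec x) (\<lambda>v. \<Sum>k. \<gamma> k * vec_index (landing_prob W x k) v)"

(* sum_{k >= 1} gamma_k k r^(k-1), with the summation index shifted by one.  The series may
   diverge when r >= 1, hence the values in [0, infinity]. *)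
definition g_series :: "(nat \<Rightarrow> real) \<Rightarrow> real \<Rightarrow> ennreal" where
  "g_series \<gamma> r = (\<Sum>k. ennreal (\<gamma> (Suc k) * real (Suc k) * r ^ k))"

(* With high probability, as an asymptotic statement: the bound is required for large n. *)
definition whp :: "(nat \<Rightarrow> 'a measure) \<Rightarrow> (nat \<Rightarrow> 'a \<Rightarrow> bool) \<Rightarrow> bool" where
  "whp M P \<longleftrightarrow> (\<exists>c>0. \<forall>\<^sub>F n in sequentially.
     measure (M n) {w \<in> space (M n). P n w} \<ge> 1 - real n powr (- c))"

end

(*
  On the good event all degrees and the volume are concentrated (Chernoff), and the
  normalized noise D'^(-1/2) (A - A') D'^(-1/2), with A' and D' the means of A and D, has operator
  norm O(delta) for delta = sqrt (ln n / d_min).  The latter follows from the moment method: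
  ||X||^(2m) <= tr X^(2m) with m about ln n, and the expected trace is bounded by revealing closed
  walks one step at a time.  Projecting out the stationary direction turns A D^(-1) into a matrix B
  with W^k x = pi + D^(1/2) B^k D^(-1/2) x for k >= 1, and likewise B' in the mean, with
  ||B'|| <= lambda.  Writing T = (D / D')^(1/2), the defect B T^(-1) - T^(-1) B' is O(delta); it
  gives both ||B|| <= lambda + O(delta) and, by telescoping, the bound k (lambda + O(delta))^(k-1)
  on the powers.
*)
theory Submission
  imports Defs "Jordan_Normal_Form.Schur_Decomposition"
begin

section \<open>Matrices acting on functions with the Euclidean norm\<close>

text \<open>The walk matrix is not symmetric, so its eigenvalues do not control the Euclidean norms
  of its powers. Conjugation by square roots of degrees makes norms available, and it costs the
  factor sqrt (d_max / d_min) of the second error term. Each matrix is conjugated by its own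
  degrees, so that each conjugate loses exactly its own stationary direction. The two stationary
  distributions differ, but this difference enters once rather than once per step: it is the first
  error term, which has no factor k.

  The trace inequality tolerates a factor n because n^(1/m) is bounded for the chosen m, and it
  tolerates a crude count of walks because the target delta already contains sqrt (ln n). The same
  inequality, with m tending to infinity, gives the mean spectral gap.

  One exceptional event serves all k and all weights, so the PageRank bound is a deterministic
  consequence of the landing bounds. Summed over k, the first error term picks up the total weight;
  hence its constant depends on gamma, while the other two constants do not.\<close>

definition mat_apply :: "nat \<Rightarrow> (nat \<Rightarrow> nat \<Rightarrow> real) \<Rightarrow> (nat \<Rightarrow> real) \<Rightarrow> nat \<Rightarrow> real" where
  "mat_apply n B y = (\<lambda>u. \<Sum>v<n. B u v * y v)"

definition nrm :: "nat \<Rightarrow> (nat \<Rightarrow> real) \<Rightarrow> real" where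
  "nrm n y = L2_set y {..<n}"

definition op_bound :: "nat \<Rightarrow> (nat \<Rightarrow> nat \<Rightarrow> real) \<Rightarrow> real \<Rightarrow> bool" where
  "op_bound n B c \<longleftrightarrow> (\<forall>y. nrm n (mat_apply n B y) \<le> c * nrm n y)"

fun mpow :: "nat \<Rightarrow> (nat \<Rightarrow> nat \<Rightarrow> real) \<Rightarrow> nat \<Rightarrow> nat \<Rightarrow> nat \<Rightarrow> real" where
  "mpow n B 0 = (\<lambda>u v. of_bool (u = v))"
| "mpow n B (Suc k) = (\<lambda>u v. \<Sum>z<n. B u z * mpow n B k z v)"

lemma nrm_nonneg [simp]: "nrm n y \<ge> 0"
  by (simp add: nrm_def)

lemma nrm_sq: "(nrm n y)\<^sup>2 = (\<Sum>v<n. (y v)\<^sup>2)"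
  by (simp add: nrm_def L2_set_def sum_nonneg)

lemma nrm_cong: "(\<And>v. v < n \<Longrightarrow> x v = y v) \<Longrightarrow> nrm n x = nrm n y"
  by (simp add: nrm_def cong: L2_set_cong_simp)

lemma nrm_mono: "(\<And>v. v < n \<Longrightarrow> \<bar>x v\<bar> \<le> \<bar>y v\<bar>) \<Longrightarrow> nrm n x \<le> nrm n y"
  unfolding nrm_def L2_set_def by (intro real_sqrt_le_mono sum_mono) (simp add: abs_le_square_iff)

lemma nrm_add: "nrm n (\<lambda>v. x v + y v) \<le> nrm n x + nrm n y"
  unfolding nrm_def by (rule L2_set_triangle_ineq)

lemma nrm_scale: "nrm n (\<lambda>v. c * x v) = \<bar>c\<bar> * nrm n x"
  by (rule power2_eq_imp_eq)
     (simp_all add: nrm_sq power_mult_distrib sum_distrib_left)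

lemma nrm_diff: "nrm n (\<lambda>v. x v - y v) \<le> nrm n x + nrm n y"
  using nrm_add[of n x "\<lambda>v. - y v"] nrm_scale[of n "-1" y] by simp

lemma nrm_mult_le:
  assumes "\<And>v. v < n \<Longrightarrow> \<bar>c v\<bar> \<le> a"
  shows "nrm n (\<lambda>v. c v * x v) \<le> \<bar>a\<bar> * nrm n x"
  unfolding nrm_scale[symmetric]
  by (rule nrm_mono) (use assms in \<open>force simp: abs_mult intro!: mult_right_mono\<close>)

lemma nrm_sum: "nrm n (\<lambda>v. \<Sum>i\<in>I. f i v) \<le> (\<Sum>i\<in>I. nrm n (f i))"
proof (induction I rule: infinite_finite_induct)
  case (insert i I)
  then show ?case using nrm_add[of n "f i" "\<lambda>v. \<Sum>i\<in>I. f i v"] by simp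
qed (simp_all add: nrm_def L2_set_def)

lemma inner_le_nrm: "(\<Sum>v<n. x v * y v) \<le> nrm n x * nrm n y"
proof -
  have "(\<Sum>v<n. x v * y v) \<le> (\<Sum>v<n. \<bar>x v\<bar> * \<bar>y v\<bar>)"
    by (intro sum_mono) (metis abs_ge_self abs_mult)
  then show ?thesis using L2_set_mult_ineq[of x y "{..<n}"] by (simp add: nrm_def)
qed

lemma mat_apply_cong: "(\<And>v. v < n \<Longrightarrow> x v = y v) \<Longrightarrow> mat_apply n B x = mat_apply n B y"
  by (simp add: mat_apply_def)

lemma mat_apply_sum_swap: "(\<Sum>u<n. x u * mat_apply n B y u) = (\<Sum>v<n. mat_apply n (\<lambda>u v. B v u) x v * y v)"
proof -
  have "(\<Sum>u<n. x u * mat_apply n B y u) = (\<Sum>u<n. \<Sum>v<n. B u v * x u * y v)"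
    by (simp add: mat_apply_def sum_distrib_left mult_ac)
  also have "\<dots> = (\<Sum>v<n. \<Sum>u<n. B u v * x u * y v)"
    by (rule sum.swap)
  also have "\<dots> = (\<Sum>v<n. mat_apply n (\<lambda>u v. B v u) x v * y v)"
    by (simp add: mat_apply_def sum_distrib_right)
  finally show ?thesis .
qed

section \<open>Iterates and trace powers of a symmetric operator\<close>

lemma mat_apply_symmetric:
  assumes "\<And>u v. u < n \<Longrightarrow> v < n \<Longrightarrow> B u v = B v u"
  shows "(\<Sum>u<n. x u * mat_apply n B y u) = (\<Sum>u<n. mat_apply n B x u * y u)"
  unfolding mat_apply_sum_swap by (rule sum.cong) (auto simp: mat_apply_def assms intro!: sum.cong)

text \<open>Symmetry moves one \<open>B\<close> across the inner product, so
  \<open>||B y||^2 = <y, B (B y)>\<close>, and Cauchy-Schwarz applies. Along an orbit this says that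
  the norms of the iterates are log-convex.\<close>

lemma nrm_mat_apply_log_convex:
  assumes "\<And>u v. u < n \<Longrightarrow> v < n \<Longrightarrow> B u v = B v u"
  shows "(nrm n (mat_apply n B y))\<^sup>2 \<le> nrm n y * nrm n (mat_apply n B (mat_apply n B y))"
proof -
  have "(nrm n (mat_apply n B y))\<^sup>2 = (\<Sum>v<n. mat_apply n B y v * mat_apply n B y v)"
    unfolding nrm_sq by (simp add: power2_eq_square)
  also have "\<dots> = (\<Sum>v<n. y v * mat_apply n B (mat_apply n B y) v)"
    by (rule mat_apply_symmetric[OF assms, symmetric])
  also have "\<dots> \<le> nrm n y * nrm n (mat_apply n B (mat_apply n B y))"
    by (rule inner_le_nrm)
  finally show ?thesis .
qed

text \<open>Log-convexity makes the ratios of consecutive iterates nondecreasing, so the first ratio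
  to the power \<open>m\<close> is at most the product of the first \<open>m\<close>. A bound on a
  high power thus controls a single application without diagonalization. Denominators are cleared so
  that no norm has to be nonzero.\<close>

lemma nrm_mat_apply_power:
  assumes sym: "\<And>u v. u < n \<Longrightarrow> v < n \<Longrightarrow> B u v = B v u"
  shows "nrm n (mat_apply n B y) ^ m * nrm n y \<le> nrm n y ^ m * nrm n ((mat_apply n B ^^ m) y)"
proof -
  define b where "b j = nrm n ((mat_apply n B ^^ j) y)" for j
  have b0: "b j \<ge> 0" for j by (simp add: b_def)
  have lc: "(b (Suc j))\<^sup>2 \<le> b j * b (Suc (Suc j))" for j
    using nrm_mat_apply_log_convex[OF sym, where y = "(mat_apply n B ^^ j) y"] by (simp add: b_def)
  have ratio: "b j * b 1 \<le> b (Suc j) * b 0" for j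
  proof (induction j)
    case (Suc j)
    show ?case
    \<comment> \<open>\<open>b j\<close> has to be cancelled; if it vanishes, so does
      \<open>b (Suc j)\<close> and the left side is 0.\<close>
    proof (cases "b j = 0")
      case True
      then have "b (Suc j) = 0" using lc[of j] by simp
      then show ?thesis using b0 by simp
    next
      case False
      then have pos: "b j > 0" using b0[of j] by simp
      have "b j * (b (Suc j) * b 1) \<le> b (Suc j) * (b (Suc j) * b 0)"
        using mult_left_mono[OF Suc b0[of "Suc j"]] by (simp add: algebra_simps)
      also have "\<dots> = (b (Suc j))\<^sup>2 * b 0" by (simp add: power2_eq_square)
      also have "\<dots> \<le> b j * b (Suc (Suc j)) * b 0"
        by (intro mult_right_mono lc b0)
      finally show ?thesis using pos by (simp add: mult.assoc)
    qed
  qed simp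
  have "b 1 ^ m * b 0 \<le> b 0 ^ m * b m" for m
  proof (induction m)
    case (Suc m)
    have "b 1 ^ Suc m * b 0 = b 1 * (b 1 ^ m * b 0)" by simp
    also have "\<dots> \<le> b 1 * (b 0 ^ m * b m)"
      by (intro mult_left_mono Suc b0)
    also have "\<dots> = b 0 ^ m * (b m * b 1)" by simp
    also have "\<dots> \<le> b 0 ^ m * (b (Suc m) * b 0)"
      by (intro mult_left_mono ratio zero_le_power b0)
    finally show ?case by (simp add: mult_ac)
  qed simp
  from this[of m] show ?thesis by (simp add: b_def)
qed

lemma mat_apply_funpow: "u < n \<Longrightarrow> (mat_apply n B ^^ k) y u = mat_apply n (mpow n B k) y u"
proof (induction k arbitrary: u)
  case 0
  then show ?case by (simp add: mat_apply_def of_bool_def if_distrib[of "\<lambda>z. z * _"] cong: if_cong)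
next
  case (Suc k)
  have "(mat_apply n B ^^ Suc k) y u = (\<Sum>z<n. B u z * mat_apply n (mpow n B k) y z)"
    unfolding funpow.simps comp_def mat_apply_def[of n B "(mat_apply n B ^^ k) y"] by (simp add: Suc.IH)
  also have "\<dots> = (\<Sum>z<n. \<Sum>v<n. B u z * mpow n B k z v * y v)"
    by (simp add: mat_apply_def sum_distrib_left mult.assoc)
  also have "\<dots> = (\<Sum>v<n. \<Sum>z<n. B u z * mpow n B k z v * y v)"
    by (rule sum.swap)
  also have "\<dots> = mat_apply n (mpow n B (Suc k)) y u"
    by (simp add: mat_apply_def sum_distrib_right)
  finally show ?case .
qed

lemma mpow_add:
  assumes "u < n"
  shows "mpow n B (j + k) u v = (\<Sum>z<n. mpow n B j u z * mpow n B k z v)"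
  using assms
proof (induction j arbitrary: u)
  case 0
  then show ?case by (simp add: of_bool_def if_distrib[of "\<lambda>z. z * _"] cong: if_cong)
next
  case (Suc j)
  have "mpow n B (Suc j + k) u v = (\<Sum>y<n. \<Sum>z<n. B u y * mpow n B j y z * mpow n B k z v)"
    using Suc.IH by (simp add: sum_distrib_left mult.assoc)
  also have "\<dots> = (\<Sum>z<n. \<Sum>y<n. B u y * mpow n B j y z * mpow n B k z v)"
    by (rule sum.swap)
  finally show ?case by (simp add: sum_distrib_right)
qed

lemma mpow_1: "v < n \<Longrightarrow> mpow n B (Suc 0) u v = B u v"
  by (simp add: of_bool_def if_distrib[of "\<lambda>z. _ * z"] cong: if_cong)

text \<open>The recursion peels factors off on the left, and symmetry turns them to the right; so
  the step first splits off the last factor by \<open>mpow_add\<close>.\<close>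

lemma mpow_symmetric:
  assumes sym: "\<And>u v. u < n \<Longrightarrow> v < n \<Longrightarrow> B u v = B v u"
  shows "u < n \<Longrightarrow> v < n \<Longrightarrow> mpow n B k u v = mpow n B k v u"
proof (induction k arbitrary: u v)
  case (Suc k)
  have "mpow n B (Suc k) v u = mpow n B (k + Suc 0) v u" by simp
  also have "\<dots> = (\<Sum>z<n. mpow n B k v z * mpow n B (Suc 0) z u)"
    by (rule mpow_add) fact
  also have "\<dots> = (\<Sum>z<n. B u z * mpow n B k z v)"
    using Suc by (intro sum.cong refl) (auto simp: mpow_1 sym simp del: mpow.simps)
  finally show ?case by simp
qed auto

lemma nrm_mat_apply_le_frobenius: "(nrm n (mat_apply n B y))\<^sup>2 \<le> (\<Sum>u<n. \<Sum>v<n. (B u v)\<^sup>2) * (nrm n y)\<^sup>2"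
proof -
  have "(mat_apply n B y u)\<^sup>2 \<le> (\<Sum>v<n. (B u v)\<^sup>2) * (nrm n y)\<^sup>2" for u
    unfolding mat_apply_def nrm_sq by (rule Cauchy_Schwarz_ineq_sum)
  then show ?thesis
    by (simp add: nrm_sq[of n "mat_apply n B y"] sum_distrib_right sum_mono)
qed

lemma mpow_frobenius:
  assumes sym: "\<And>u v. u < n \<Longrightarrow> v < n \<Longrightarrow> B u v = B v u"
  shows "(\<Sum>u<n. \<Sum>v<n. (mpow n B m u v)\<^sup>2) = (\<Sum>u<n. mpow n B (2 * m) u u)"
proof (intro sum.cong refl)
  fix u assume  "u \<in> {..<n}"
  then show "(\<Sum>v<n. (mpow n B m u v)\<^sup>2) = mpow n B (2 * m) u u"
    using mpow_symmetric[OF sym]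
    by (auto simp: mult_2 mpow_add power2_eq_square intro!: sum.cong)
qed

text \<open>The \<open>m\<close>-th power expands by at most its Frobenius norm, whose square is the
  trace on the right by \<open>mpow_frobenius\<close>; \<open>nrm_mat_apply_power\<close> brings
  this back to one step. It serves for the noise and for the spectral gap.\<close>

lemma nrm_mat_apply_power_le_trace:
  assumes sym: "\<And>u v. u < n \<Longrightarrow> v < n \<Longrightarrow> B u v = B v u"
    and "m \<ge> 1"
  shows "nrm n (mat_apply n B y) ^ (2 * m) \<le> (\<Sum>u<n. mpow n B (2 * m) u u) * nrm n y ^ (2 * m)"
proof (cases "nrm n y = 0")
  case True
  then have "nrm n (mat_apply n B y) = 0"
    using nrm_mat_apply_le_frobenius[of n B y] by simp
  then show ?thesis using True \<open>m \<ge> 1\<close> by (simp add: power_0_left)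
next
  case False
  let ?a = "nrm n y" and ?c = "nrm n ((mat_apply n B ^^ m) y)" and ?t = "\<Sum>u<n. mpow n B (2 * m) u u"
  have pos: "?a > 0" using False nrm_nonneg[of n y] by linarith
  have "?c = nrm n (mat_apply n (mpow n B m) y)"
    by (intro nrm_cong mat_apply_funpow)
  then have c: "?c\<^sup>2 \<le> ?t * ?a\<^sup>2"
    using nrm_mat_apply_le_frobenius[of n "mpow n B m" y] mpow_frobenius[OF sym] by simp
  have "(nrm n (mat_apply n B y) ^ m * ?a)\<^sup>2 \<le> (?a ^ m * ?c)\<^sup>2"
    by (intro power_mono nrm_mat_apply_power[OF sym]) auto
  also have "\<dots> \<le> (?a ^ m)\<^sup>2 * (?t * ?a\<^sup>2)"
    unfolding power_mult_distrib by (intro mult_left_mono c) auto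
  finally have "nrm n (mat_apply n B y) ^ (2 * m) * ?a\<^sup>2 \<le> (?t * ?a ^ (2 * m)) * ?a\<^sup>2"
    by (simp add: power_mult_distrib power_mult[symmetric] mult_ac)
  then show ?thesis using pos by simp
qed

section \<open>Spectral gap of a weighted graph\<close>

text \<open>The factorization exists over the complex numbers. Real eigenvalues make the list of
  roots the image of a real list, and comparing coefficients descends to the reals. The real Schur
  decomposition asks for this form.\<close>

lemma char_poly_of_real_splits:
  fixes A :: "real mat"
  assumes A: "A \<in> carrier_mat n n"
    and real: "\<And>a. eigenvalue (map_mat complex_of_real A) a \<Longrightarrow> a \<in> \<real>"
  shows "\<exists>es. char_poly A = (\<Prod>a\<leftarrow>es. [:- a, 1:]) \<and> length es = n"
proof -
  have Ac: "map_mat complex_of_real A \<in> carrier_mat n n" using A by simp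
  from char_poly_factorized[OF Ac] obtain as where
    as: "char_poly (map_mat complex_of_real A) = (\<Prod>a\<leftarrow>as. [:- a, 1:])" and len: "length as = n"
    by blast
  have "a \<in> \<real>" if "a \<in> set as" for a
  proof (rule real)
    have "poly (char_poly (map_mat complex_of_real A)) a = 0"
      unfolding as using that by (induction as) auto
    then show "eigenvalue (map_mat complex_of_real A) a"
      using eigenvalue_root_char_poly[OF Ac] by simp
  qed
  then have "as = map complex_of_real (map Re as)"
    by (induction as) (auto simp: of_real_Re)
  then have "map_poly complex_of_real (char_poly A) = (\<Prod>a\<leftarrow>map Re as. [:- complex_of_real a, 1:])"
    unfolding of_real_hom.char_poly_hom[OF A, symmetric] as by (metis (no_types, lifting) map_map o_def map_cong)
  also have "\<dots> = map_poly complex_of_real (\<Prod>a\<leftarrow>map Re as. [:- a, 1:])"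
    by (induction as) (auto simp: poly_eq_iff coeff_map_poly coeff_pCons split: nat.split)
  finally have "char_poly A = (\<Prod>a\<leftarrow>map Re as. [:- a, 1:])"
    by (simp add: poly_eq_iff coeff_map_poly)
  then show ?thesis using len by (intro exI[of _ "map Re as"]) simp
qed

lemma trace_mult_commute:
  fixes A B :: "real mat"
  assumes A: "A \<in> carrier_mat n n" and B: "B \<in> carrier_mat n n"
  shows "(\<Sum>i<n. (A * B) $$ (i, i)) = (\<Sum>i<n. (B * A) $$ (i, i))"
proof -
  have "(\<Sum>i<n. (A * B) $$ (i, i)) = (\<Sum>i<n. \<Sum>j<n. A $$ (i, j) * B $$ (j, i))"
    using A B by (auto simp: scalar_prod_def lessThan_atLeast0 intro!: sum.cong)
  also have "\<dots> = (\<Sum>j<n. \<Sum>i<n. B $$ (j, i) * A $$ (i, j))"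
    by (subst sum.swap) (simp add: mult.commute)
  also have "\<dots> = (\<Sum>i<n. (B * A) $$ (i, i))"
    using A B by (auto simp: scalar_prod_def lessThan_atLeast0 intro!: sum.cong)
  finally show ?thesis .
qed

text \<open>Entries below the diagonal are included because the induction step meets them.\<close>

lemma upper_triangular_pow:
  fixes B :: "real mat"
  assumes B: "B \<in> carrier_mat n n" and ut: "upper_triangular B"
  shows "i < n \<Longrightarrow> j \<le> i \<Longrightarrow> (B ^\<^sub>m k) $$ (i, j) = (if i = j then B $$ (i, i) ^ k else 0)"
proof (induction k arbitrary: i j)
  case 0
  then show ?case using B by auto
next
  case (Suc k)
  have Bk: "B ^\<^sub>m k \<in> carrier_mat n n" using B by simp
  have "(B ^\<^sub>m Suc k) $$ (i, j) = (\<Sum>z<n. (B ^\<^sub>m k) $$ (i, z) * B $$ (z, j))"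
    using B Bk Suc.prems by (auto simp: scalar_prod_def lessThan_atLeast0 intro!: sum.cong)
  \<comment> \<open>Terms with \<open>z < i\<close> vanish through the power, those with
    \<open>z > i\<close> through \<open>B\<close>, since then \<open>j < z\<close>.\<close>
  also have "\<dots> = (\<Sum>z<n. if z = i then (B ^\<^sub>m k) $$ (i, i) * B $$ (i, j) else 0)"
  proof (rule sum.cong)
    fix z assume z: "z \<in> {..<n}"
    show "(B ^\<^sub>m k) $$ (i, z) * B $$ (z, j) = (if z = i then (B ^\<^sub>m k) $$ (i, i) * B $$ (i, j) else 0)"
    proof (cases z i rule: linorder_cases)
      case less
      then show ?thesis using Suc.IH[of i z] Suc.prems by simp
    next
      case greater
      then have "B $$ (z, j) = 0" using ut B z Suc.prems by (intro upper_triangularD) auto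
      then show ?thesis using greater by simp
    qed simp
  qed simp
  also have "\<dots> = (B ^\<^sub>m k) $$ (i, i) * B $$ (i, j)" using Suc.prems by simp
  also have "\<dots> = (if i = j then B $$ (i, i) ^ Suc k else 0)"
  proof (cases "i = j")
    case False
    then have "B $$ (i, j) = 0" using ut B Suc.prems by (intro upper_triangularD) auto
    then show ?thesis using False by simp
  qed (use Suc in simp)
  finally show ?case .
qed

text \<open>Triangularization reduces to a matrix with diagonal \<open>es\<close>, and cyclicity of
  the trace removes the change of basis.\<close>

lemma trace_pow_eigenvalues:
  fixes A :: "real mat"
  assumes A: "A \<in> carrier_mat n n" and cp: "char_poly A = (\<Prod>a\<leftarrow>es. [:- a, 1:])"
  shows "(\<Sum>i<n. (A ^\<^sub>m k) $$ (i, i)) = (\<Sum>i<n. (es ! i) ^ k)"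
proof -
  obtain B P Q where "schur_decomposition A es = (B, P, Q)"
    by (cases "schur_decomposition A es") auto
  from schur_decomposition[OF A cp this]
  have sim: "similar_mat_wit A B P Q" and ut: "upper_triangular B" and diag: "diag_mat B = es" by auto
  note D = similar_mat_witD2[OF A sim]
  have Bk: "B ^\<^sub>m k \<in> carrier_mat n n" using D by simp
  have "(\<Sum>i<n. (A ^\<^sub>m k) $$ (i, i)) = (\<Sum>i<n. ((P * B ^\<^sub>m k) * Q) $$ (i, i))"
    by (simp add: similar_mat_wit_pow_id[OF sim])
  also have "\<dots> = (\<Sum>i<n. (Q * (P * B ^\<^sub>m k)) $$ (i, i))"
    by (rule trace_mult_commute) (use D Bk in auto)
  also have "Q * (P * B ^\<^sub>m k) = (Q * P) * B ^\<^sub>m k"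
    using D Bk by (intro assoc_mult_mat[symmetric]) auto
  also have "\<dots> = B ^\<^sub>m k" using D Bk by simp
  also have "(\<Sum>i<n. (B ^\<^sub>m k) $$ (i, i)) = (\<Sum>i<n. (es ! i) ^ k)"
  proof (rule sum.cong)
    fix i assume "i \<in> {..<n}"
    then show "(B ^\<^sub>m k) $$ (i, i) = (es ! i) ^ k"
      using upper_triangular_pow[OF D(5) ut, of i i k] D(5) diag[symmetric] by (simp add: diag_mat_def)
  qed simp
  finally show ?thesis .
qed

lemma mat_pow_mpow:
  assumes A: "A \<in> carrier_mat n n"
  shows "u < n \<Longrightarrow> v < n \<Longrightarrow> (A ^\<^sub>m k) $$ (u, v) = mpow n (\<lambda>u v. A $$ (u, v)) k u v"
proof (induction k arbitrary: u v)
  case 0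
  then show ?case using A by auto
next
  case (Suc k)
  have Ak: "A ^\<^sub>m k \<in> carrier_mat n n" using A by simp
  have "(A ^\<^sub>m Suc k) $$ (u, v) = (\<Sum>z<n. (A ^\<^sub>m k) $$ (u, z) * A $$ (z, v))"
    using A Ak Suc.prems by (auto simp: scalar_prod_def lessThan_atLeast0 intro!: sum.cong)
  also have "\<dots> = (\<Sum>z<n. mpow n (\<lambda>u v. A $$ (u, v)) k u z * mpow n (\<lambda>u v. A $$ (u, v)) (Suc 0) z v)"
    by (intro sum.cong refl) (auto simp: Suc mpow_1 simp del: mpow.simps)
  also have "\<dots> = mpow n (\<lambda>u v. A $$ (u, v)) (k + Suc 0) u v"
    by (rule mpow_add[symmetric]) fact
  finally show ?case by simp
qed

text \<open>If \<open>a > b > 0\<close>, the powers of \<open>(a / b)^2\<close> outgrow any constant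
  \<open>c\<close>. This removes a dimension factor from a trace bound.\<close>

lemma le_of_power_le_const_mult:
  fixes a b c :: real
  assumes "a \<ge> 0" "b \<ge> 0" and le: "\<And>m. m \<ge> 1 \<Longrightarrow> a ^ (2 * m) \<le> c * b ^ (2 * m)"
  shows "a \<le> b"
proof (rule ccontr)
  assume "\<not> a \<le> b"
  then have ab: "a > b" by simp
  show False
  proof (cases "b = 0")
    case True
    then show False using le[of 1] ab by simp
  next
    case False
    then have b: "b > 0" using assms by simp
    have r: "1 < (a / b)\<^sup>2" using ab b by (simp add: one_less_power)
    obtain m where m: "c < ((a / b)\<^sup>2) ^ m" using real_arch_pow[OF r] by blast
    \<comment> \<open>The index is raised because the hypothesis covers only
      \<open>m \<ge> 1\<close>.\<close>
    also have "\<dots> \<le> ((a / b)\<^sup>2) ^ Suc m" using r by (intro power_increasing) auto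
    also have "\<dots> = a ^ (2 * Suc m) / b ^ (2 * Suc m)"
      unfolding power_mult[symmetric] by (rule power_divide)
    also have "\<dots> \<le> c" using le[of "Suc m"] b by (simp add: pos_divide_le_eq del: power_Suc mult_Suc_right)
    finally show False by simp
  qed
qed

section \<open>Degrees, the walk operator and its symmetric conjugates\<close>

definition col_sum :: "nat \<Rightarrow> (nat \<Rightarrow> nat \<Rightarrow> real) \<Rightarrow> nat \<Rightarrow> real" where
  "col_sum n a v = (\<Sum>u<n. a u v)"

definition volume :: "nat \<Rightarrow> (nat \<Rightarrow> nat \<Rightarrow> real) \<Rightarrow> real" where
  "volume n a = (\<Sum>v<n. col_sum n a v)"

lemma col_sum_cong:
  "(\<And>u v. u < n \<Longrightarrow> v < n \<Longrightarrow> a u v = b u v) \<Longrightarrow> v < n \<Longrightarrow> col_sum n a v = col_sum n b v"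
  by (simp add: col_sum_def)

lemma volume_cong:
  "(\<And>u v. u < n \<Longrightarrow> v < n \<Longrightarrow> a u v = b u v) \<Longrightarrow> volume n a = volume n b"
  by (simp add: volume_def col_sum_def)

text \<open>Division by zero gives 0, so this agrees with \<open>walk_mat\<close> entrywise even if
  a degree vanishes.\<close>

definition walk_op :: "nat \<Rightarrow> (nat \<Rightarrow> nat \<Rightarrow> real) \<Rightarrow> nat \<Rightarrow> nat \<Rightarrow> real" where
  "walk_op n a u v = a u v / col_sum n a v"

definition normalized_op :: "nat \<Rightarrow> (nat \<Rightarrow> nat \<Rightarrow> real) \<Rightarrow> nat \<Rightarrow> nat \<Rightarrow> real" where
  "normalized_op n a u v = a u v / (sqrt (col_sum n a u) * sqrt (col_sum n a v))"

text \<open>The subtracted term is the orthogonal projection onto the vector of square roots of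
  degrees, which \<open>normalized_op\<close> fixes when the graph is symmetric with positive
  degrees.\<close>

definition centered_op :: "nat \<Rightarrow> (nat \<Rightarrow> nat \<Rightarrow> real) \<Rightarrow> nat \<Rightarrow> nat \<Rightarrow> real" where
  "centered_op n a u v = normalized_op n a u v
     - sqrt (col_sum n a u) * sqrt (col_sum n a v) / volume n a"

lemma walk_mat_carrier: "walk_mat (Matrix.mat n n (\<lambda>(u, v). a u v)) \<in> carrier_mat n n"
  by (rule carrier_matI) (simp_all add: walk_mat_def mat_diag_def)

lemma walk_mat_index:
  assumes "u < n" "v < n"
  shows "walk_mat (Matrix.mat n n (\<lambda>(u, v). a u v)) $$ (u, v) = walk_op n a u v"
proof -
  have "degree_of (Matrix.mat n n (\<lambda>(u, v). a u v)) v = col_sum n a v"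
    using assms by (simp add: degree_of_def col_sum_def)
  then show ?thesis
    using assms by (simp add: walk_mat_def mat_diag_mult_right[of _ n n] walk_op_def divide_inverse)
qed

lemma mpow_cong:
  assumes "\<And>u v. u < n \<Longrightarrow> v < n \<Longrightarrow> A u v = B u v"
  shows "u < n \<Longrightarrow> mpow n A k u v = mpow n B k u v"
  by (induction k arbitrary: u) (auto simp: assms intro!: sum.cong)

lemma second_eigenvalue_nonneg: "second_eigenvalue B \<ge> 0"
  by (simp add: second_eigenvalue_def)

text \<open>Covers the mean matrix and, off the exceptional event, the realized adjacency matrix,
  for which \<open>deg_pos\<close> is a consequence of concentration.\<close>

locale weighted_graph =
  fixes n :: nat and a :: "nat \<Rightarrow> nat \<Rightarrow> real"
  assumes nonneg: "\<And>u v. u < n \<Longrightarrow> v < n \<Longrightarrow> a u v \<ge> 0"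
    and sym: "\<And>u v. u < n \<Longrightarrow> v < n \<Longrightarrow> a u v = a v u"
    and deg_pos: "\<And>v. v < n \<Longrightarrow> col_sum n a v > 0"
    and n_pos: "n > 0"
begin

abbreviation "d \<equiv> col_sum n a"
abbreviation "vol \<equiv> volume n a"

lemma vol_pos: "vol > 0"
  unfolding volume_def using deg_pos n_pos by (intro sum_pos) auto

lemma row_sum: "u < n \<Longrightarrow> (\<Sum>v<n. a u v) = d u"
  unfolding col_sum_def by (rule sum.cong) (auto simp: sym)

lemma walk_op_nonneg: "u < n \<Longrightarrow> v < n \<Longrightarrow> walk_op n a u v \<ge> 0"
  using nonneg deg_pos[of v] by (simp add: walk_op_def)

lemma walk_op_col_sum: "v < n \<Longrightarrow> (\<Sum>u<n. walk_op n a u v) = 1"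
  using deg_pos[of v] by (simp add: walk_op_def sum_divide_distrib[symmetric] flip: col_sum_def)

lemma walk_op_stationary: "u < n \<Longrightarrow> (\<Sum>v<n. walk_op n a u v * d v) = d u"
  unfolding row_sum[symmetric] walk_op_def
  by (rule sum.cong) (use deg_pos in \<open>force simp: row_sum\<close>)+

lemma mpow_walk_op_col_sum: "v < n \<Longrightarrow> (\<Sum>u<n. mpow n (walk_op n a) k u v) = 1"
proof (induction k)
  case (Suc k)
  have "(\<Sum>u<n. mpow n (walk_op n a) (Suc k) u v)
      = (\<Sum>z<n. (\<Sum>u<n. walk_op n a u z) * mpow n (walk_op n a) k z v)"
    unfolding mpow.simps sum_distrib_right by (rule sum.swap)
  also have "\<dots> = (\<Sum>z<n. mpow n (walk_op n a) k z v)"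
    by (rule sum.cong) (simp_all add: walk_op_col_sum)
  finally show ?case using Suc by simp
qed (simp add: of_bool_def)

lemma walk_op_mat_apply_col_sum: "(\<Sum>u<n. mat_apply n (walk_op n a) y u) = (\<Sum>u<n. y u)"
proof -
  have "(\<Sum>u<n. mat_apply n (walk_op n a) y u) = (\<Sum>v<n. (\<Sum>u<n. walk_op n a u v) * y v)"
    unfolding mat_apply_def sum_distrib_right by (rule sum.swap)
  also have "\<dots> = (\<Sum>v<n. y v)"
    by (rule sum.cong) (simp_all add: walk_op_col_sum)
  finally show ?thesis .
qed

lemma centered_op_eq:
  "u < n \<Longrightarrow> v < n \<Longrightarrow>
    centered_op n a u v = walk_op n a u v * sqrt (d v) / sqrt (d u) - sqrt (d u) * sqrt (d v) / vol"
  using deg_pos[of v] deg_pos[of u]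
  by (simp add: centered_op_def normalized_op_def walk_op_def field_simps)

text \<open>The stationary projection \<open>P\<close> satisfies \<open>W P = P W = P P = P\<close>,
  hence \<open>(W - P)^k = W^k - P\<close> for \<open>k \<ge> 1\<close>; this is the entrywise form
  after conjugation by the square roots of the degrees. It fails for exponent 0, hence
  \<open>Suc k\<close>.\<close>

lemma mpow_centered_op:
  "u < n \<Longrightarrow> v < n \<Longrightarrow> mpow n (centered_op n a) (Suc k) u v
    = mpow n (walk_op n a) (Suc k) u v * sqrt (d v) / sqrt (d u) - sqrt (d u) * sqrt (d v) / vol"
proof (induction k arbitrary: u)
  case 0
  then show ?case by (simp add: mpow_1 centered_op_eq del: mpow.simps)
next
  case (Suc k)
  let ?s = "\<lambda>v. sqrt (d v)" and ?m = "\<lambda>z. mpow n (walk_op n a) (Suc k) z v" and ?W = "walk_op n a"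
  have s: "?s z > 0" "?s z * ?s z = d z" if "z < n" for z using deg_pos[OF that] by auto
  have "mpow n (centered_op n a) (Suc (Suc k)) u v
      = (\<Sum>z<n. centered_op n a u z * mpow n (centered_op n a) (Suc k) z v)"
    by simp
  also have "\<dots> = (\<Sum>z<n. (?s v / ?s u) * (?W u z * ?m z) - ?s v / (?s u * vol) * (?W u z * d z)
      - ?s u * ?s v / vol * ?m z + ?s u * ?s v / vol\<^sup>2 * d z)"
  proof (rule sum.cong)
    fix z assume "z \<in> {..<n}"
    then have z: "z < n" by simp
    \<comment> \<open>\<open>D = sz * sz\<close> cancels the intermediate square roots and leaves
      four sums over \<open>z\<close>: \<open>W\<close> times its power, \<open>W P\<close>,
      \<open>P\<close> times the power, and \<open>P P\<close>.\<close>
    have alg: "(w * sz / su - su * sz / c) * (m * sv / sz - sz * sv / c)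
        = (sv / su) * (w * m) - sv / (su * c) * (w * D) - su * sv / c * m + su * sv / c\<^sup>2 * D"
      if "D = sz * sz" "sz \<noteq> 0" "su \<noteq> 0" "c \<noteq> 0" for w m sz su sv c D :: real
      using that by (simp add: field_simps power2_eq_square)
    show "centered_op n a u z * mpow n (centered_op n a) (Suc k) z v
      = (?s v / ?s u) * (?W u z * ?m z) - ?s v / (?s u * vol) * (?W u z * d z)
      - ?s u * ?s v / vol * ?m z + ?s u * ?s v / vol\<^sup>2 * d z"
      unfolding Suc.IH[OF z Suc.prems(2)] centered_op_eq[OF Suc.prems(1) z]
      using s[OF z] s(1)[OF Suc.prems(1)] vol_pos by (intro alg) auto
  qed simp
  also have "\<dots> = (?s v / ?s u) * (\<Sum>z<n. ?W u z * ?m z) - ?s v / (?s u * vol) * (\<Sum>z<n. ?W u z * d z)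
      - ?s u * ?s v / vol * (\<Sum>z<n. ?m z) + ?s u * ?s v / vol\<^sup>2 * (\<Sum>z<n. d z)"
    by (simp only: sum.distrib sum_subtractf sum_distrib_left)
  also have "(\<Sum>z<n. ?W u z * ?m z) = mpow n ?W (Suc (Suc k)) u v"
    by simp
  also have "(\<Sum>z<n. ?W u z * d z) = ?s u * ?s u"
    using walk_op_stationary s Suc.prems by simp
  also have "(\<Sum>z<n. ?m z) = 1"
    by (rule mpow_walk_op_col_sum) fact
  also have "(\<Sum>z<n. d z) = vol"
    by (simp add: volume_def)
  finally have eq: "mpow n (centered_op n a) (Suc (Suc k)) u v
      = ?s v / ?s u * mpow n ?W (Suc (Suc k)) u v - ?s v / (?s u * vol) * (?s u * ?s u)
        - ?s u * ?s v / vol * 1 + ?s u * ?s v / vol\<^sup>2 * vol" .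
  have alg: "sv / su * x - sv / (su * c) * (su * su) - su * sv / c * 1 + su * sv / c\<^sup>2 * c
      = x * sv / su - su * sv / c" if "su \<noteq> 0" "c \<noteq> 0" for su sv c x :: real
    using that by (simp add: field_simps power2_eq_square)
  show ?case
    unfolding eq using s(1)[OF Suc.prems(1)] vol_pos by (intro alg) auto
qed

text \<open>The projection has trace 1, because the degrees sum to \<open>vol\<close>.\<close>

lemma trace_centered_op:
  assumes "k \<ge> 1"
  shows "(\<Sum>u<n. mpow n (centered_op n a) k u u) = (\<Sum>u<n. mpow n (walk_op n a) k u u) - 1"
proof -
  obtain j where k: "k = Suc j" using assms by (cases k) auto
  have "(\<Sum>u<n. mpow n (centered_op n a) k u u) = (\<Sum>u<n. mpow n (walk_op n a) k u u - d u / vol)"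
    unfolding k
  proof (rule sum.cong)
    fix u assume "u \<in> {..<n}"
    then have u: "u < n" by simp
    show "mpow n (centered_op n a) (Suc j) u u = mpow n (walk_op n a) (Suc j) u u - d u / vol"
      using mpow_centered_op[OF u u] deg_pos[OF u] by (simp del: mpow.simps)
  qed simp
  also have "\<dots> = (\<Sum>u<n. mpow n (walk_op n a) k u u) - (\<Sum>u<n. d u) / vol"
    by (simp add: sum_subtractf sum_divide_distrib)
  finally show ?thesis using vol_pos by (simp add: volume_def)
qed

lemma centered_op_sym: "u < n \<Longrightarrow> v < n \<Longrightarrow> centered_op n a u v = centered_op n a v u"
  by (simp add: centered_op_def normalized_op_def sym mult.commute)

text \<open>Cauchy-Schwarz with the weight \<open>a u v\<close> split evenly: the row sum cancels
  \<open>d u\<close>, and the column sums of the walk operator handle the outer sum.\<close>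

lemma normalized_op_bound: "op_bound n (normalized_op n a) 1"
  unfolding op_bound_def mult_1
proof
  fix y
  have "(mat_apply n (normalized_op n a) y u)\<^sup>2 \<le> (\<Sum>v<n. a u v / d v * (y v)\<^sup>2)" if u: "u < n" for u
  proof -
    have eq: "mat_apply n (normalized_op n a) y u
        = (\<Sum>v<n. (sqrt (a u v) / sqrt (d u)) * (sqrt (a u v) * y v / sqrt (d v)))"
      unfolding mat_apply_def
    proof (rule sum.cong)
      fix v assume "v \<in> {..<n}"
      then have "sqrt (a u v) * sqrt (a u v) = a u v" using nonneg u by simp
      then show "normalized_op n a u v * y v = (sqrt (a u v) / sqrt (d u)) * (sqrt (a u v) * y v / sqrt (d v))"
        unfolding normalized_op_def times_divide_times_eq by (simp flip: mult.assoc)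
    qed simp
    have "(mat_apply n (normalized_op n a) y u)\<^sup>2
        \<le> (\<Sum>v<n. (sqrt (a u v) / sqrt (d u))\<^sup>2) * (\<Sum>v<n. (sqrt (a u v) * y v / sqrt (d v))\<^sup>2)"
      unfolding eq by (rule Cauchy_Schwarz_ineq_sum)
    also have "(\<Sum>v<n. (sqrt (a u v) / sqrt (d u))\<^sup>2) = (\<Sum>v<n. a u v) / d u"
      unfolding sum_divide_distrib
    proof (rule sum.cong)
      fix v assume "v \<in> {..<n}"
      then show "(sqrt (a u v) / sqrt (d u))\<^sup>2 = a u v / d u"
        using nonneg[OF u, of v] deg_pos[OF u] by (simp add: power_divide)
    qed simp
    also have "\<dots> = 1" using row_sum[OF u] deg_pos[OF u] by simp
    also have "(\<Sum>v<n. (sqrt (a u v) * y v / sqrt (d v))\<^sup>2) = (\<Sum>v<n. a u v / d v * (y v)\<^sup>2)"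
    proof (rule sum.cong)
      fix v assume "v \<in> {..<n}"
      then show "(sqrt (a u v) * y v / sqrt (d v))\<^sup>2 = a u v / d v * (y v)\<^sup>2"
        using nonneg[OF u, of v] deg_pos[of v] by (simp add: power_divide power_mult_distrib)
    qed simp
    finally show ?thesis by simp
  qed
  then have "(nrm n (mat_apply n (normalized_op n a) y))\<^sup>2 \<le> (\<Sum>u<n. \<Sum>v<n. walk_op n a u v * (y v)\<^sup>2)"
    unfolding nrm_sq walk_op_def by (intro sum_mono) auto
  also have "\<dots> = (\<Sum>v<n. (\<Sum>u<n. walk_op n a u v) * (y v)\<^sup>2)"
    unfolding sum_distrib_right by (rule sum.swap)
  also have "\<dots> = (nrm n y)\<^sup>2"
    unfolding nrm_sq by (intro sum.cong) (auto simp: walk_op_col_sum)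
  finally show "nrm n (mat_apply n (normalized_op n a) y) \<le> nrm n y"
    by (rule power2_le_imp_le) simp
qed

section \<open>Spectrum of the walk matrix\<close>

abbreviation "W \<equiv> walk_mat (Matrix.mat n n (\<lambda>(u, v). a u v))"

text \<open>The walk matrix is self-adjoint for the inner product weighted by inverse degrees. Thus
  \<open>S\<close>, the Hermitian form of \<open>D^(-1) A D^(-1)\<close> at an eigenvector, is real
  and equals \<open>c\<close> times the squared weighted norm \<open>N\<close>.\<close>

lemma eigenvalue_walk_mat_real:
  assumes "eigenvalue (map_mat complex_of_real W) c"
  shows "c \<in> \<real>"
proof -
  let ?Wc = "map_mat complex_of_real W"
  obtain x where "eigenvector ?Wc x c" using assms unfolding eigenvalue_def by blast
  then have x: "x \<in> carrier_vec n" "x \<noteq> 0\<^sub>v n" and ev: "?Wc *\<^sub>v x = c \<cdot>\<^sub>v x"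
    unfolding eigenvector_def using walk_mat_carrier[of n a] by auto
  define y where "y v = vec_index x v" for v
  obtain v0 where v0: "v0 < n" "y v0 \<noteq> 0"
    using x unfolding y_def by (metis carrier_vecD eq_vecI index_zero_vec)
  have eq: "c * y u = (\<Sum>v<n. of_real (walk_op n a u v) * y v)" if u: "u < n" for u
  proof -
    have "c * y u = vec_index (?Wc *\<^sub>v x) u"
      unfolding ev using u x by (simp add: y_def)
    also have "\<dots> = (\<Sum>v<n. of_real (walk_op n a u v) * y v)"
      using u x walk_mat_carrier[of n a]
      by (auto simp: scalar_prod_def y_def lessThan_atLeast0 walk_mat_index intro!: sum.cong)
    finally show ?thesis .
  qed
  define S where "S = (\<Sum>u<n. \<Sum>v<n. of_real (a u v / (d u * d v)) * (cnj (y u) * y v))"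
  define N where "N = (\<Sum>u<n. (cmod (y u))\<^sup>2 / d u)"
  have "cnj S = (\<Sum>u<n. \<Sum>v<n. of_real (a u v / (d u * d v)) * (cnj (y v) * y u))"
    by (simp add: S_def mult_ac)
  also have "\<dots> = (\<Sum>v<n. \<Sum>u<n. of_real (a u v / (d u * d v)) * (cnj (y v) * y u))"
    by (rule sum.swap)
  also have "\<dots> = S"
    unfolding S_def by (intro sum.cong refl) (simp add: sym mult.commute)
  finally have S_real: "S \<in> \<real>" by (simp add: Reals_cnj_iff)
  have "S = (\<Sum>u<n. cnj (y u) / of_real (d u) * (\<Sum>v<n. of_real (walk_op n a u v) * y v))"
    unfolding S_def sum_distrib_left
    by (intro sum.cong refl) (simp add: walk_op_def)
  also have "\<dots> = (\<Sum>u<n. c * of_real ((cmod (y u))\<^sup>2 / d u))"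
  proof (rule sum.cong)
    fix u assume "u \<in> {..<n}"
    then have "(\<Sum>v<n. of_real (walk_op n a u v) * y v) = c * y u" using eq by simp
    moreover have "complex_of_real ((cmod (y u))\<^sup>2 / d u) = y u * cnj (y u) / of_real (d u)"
      unfolding of_real_divide complex_norm_square ..
    ultimately show "cnj (y u) / of_real (d u) * (\<Sum>v<n. of_real (walk_op n a u v) * y v)
        = c * of_real ((cmod (y u))\<^sup>2 / d u)"
      by (simp only: times_divide_eq_left times_divide_eq_right mult.commute mult.left_commute)
  qed simp
  also have "\<dots> = c * of_real N"
    by (simp add: N_def sum_distrib_left)
  finally have S: "S = c * of_real N" .
  have "0 < (cmod (y v0))\<^sup>2 / d v0" using v0 deg_pos[of v0] by simp
  also have "\<dots> \<le> N"
    unfolding N_def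
    by (rule member_le_sum[where f = "\<lambda>u. (cmod (y u))\<^sup>2 / d u"])
       (use v0 deg_pos in \<open>simp_all add: less_imp_le\<close>)
  finally have "N > 0" .
  then have "c = S / of_real N" using S by simp
  then show ?thesis using S_real by (simp add: Reals_divide)
qed

text \<open>Nonnegative entries with column sums 1 do not increase the sum of absolute values, which
  an eigenvector scales by the modulus of \<open>c\<close>.\<close>

lemma eigenvalue_walk_mat_abs_le_1:
  assumes "eigenvalue W c"
  shows "\<bar>c\<bar> \<le> 1"
proof -
  obtain x where "eigenvector W x c" using assms unfolding eigenvalue_def by blast
  then have x: "x \<in> carrier_vec n" "x \<noteq> 0\<^sub>v n" and ev: "W *\<^sub>v x = c \<cdot>\<^sub>v x"
    unfolding eigenvector_def using walk_mat_carrier[of n a] by auto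
  define y where "y v = vec_index x v" for v
  obtain v0 where v0: "v0 < n" "y v0 \<noteq> 0"
    using x unfolding y_def by (metis carrier_vecD eq_vecI index_zero_vec)
  have eq: "c * y u = (\<Sum>v<n. walk_op n a u v * y v)" if u: "u < n" for u
  proof -
    have "c * y u = vec_index (W *\<^sub>v x) u"
      unfolding ev using u x by (simp add: y_def)
    also have "\<dots> = (\<Sum>v<n. walk_op n a u v * y v)"
      using u x walk_mat_carrier[of n a]
      by (auto simp: scalar_prod_def y_def lessThan_atLeast0 walk_mat_index intro!: sum.cong)
    finally show ?thesis .
  qed
  have "\<bar>c\<bar> * (\<Sum>u<n. \<bar>y u\<bar>) = (\<Sum>u<n. \<bar>\<Sum>v<n. walk_op n a u v * y v\<bar>)"
    unfolding sum_distrib_left by (intro sum.cong) (simp_all add: eq[symmetric] abs_mult)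
  also have "\<dots> \<le> (\<Sum>u<n. mat_apply n (walk_op n a) (\<lambda>v. \<bar>y v\<bar>) u)"
    unfolding mat_apply_def
  proof (rule sum_mono)
    fix u assume "u \<in> {..<n}"
    then have "\<bar>walk_op n a u v * y v\<bar> = walk_op n a u v * \<bar>y v\<bar>" if "v < n" for v
      using walk_op_nonneg that by (simp add: abs_mult)
    then show "\<bar>\<Sum>v<n. walk_op n a u v * y v\<bar> \<le> (\<Sum>v<n. walk_op n a u v * \<bar>y v\<bar>)"
      by (intro order.trans[OF sum_abs] sum_mono) simp
  qed
  also have "\<dots> = (\<Sum>u<n. \<bar>y u\<bar>)" by (rule walk_op_mat_apply_col_sum)
  finally have le: "\<bar>c\<bar> * (\<Sum>u<n. \<bar>y u\<bar>) \<le> 1 * (\<Sum>u<n. \<bar>y u\<bar>)" by simp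
  have "0 < \<bar>y v0\<bar>" using v0 by simp
  also have "\<dots> \<le> (\<Sum>u<n. \<bar>y u\<bar>)" using v0 by (intro member_le_sum) auto
  finally show ?thesis using le by simp
qed

lemma eigenvalue_walk_mat_1: "eigenvalue W 1"
proof -
  let ?x = "Matrix.vec n d"
  have "W *\<^sub>v ?x = 1 \<cdot>\<^sub>v ?x"
  proof (rule eq_vecI)
    fix u assume "u < dim_vec (1 \<cdot>\<^sub>v ?x)"
    then have u: "u < n" by simp
    have "vec_index (W *\<^sub>v ?x) u = (\<Sum>v<n. walk_op n a u v * d v)"
      using u walk_mat_carrier[of n a]
      by (auto simp: scalar_prod_def lessThan_atLeast0 walk_mat_index intro!: sum.cong)
    then show "vec_index (W *\<^sub>v ?x) u = vec_index (1 \<cdot>\<^sub>v ?x) u"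
      using u walk_op_stationary by simp
  qed (use walk_mat_carrier[of n a] in auto)
  moreover have "?x \<noteq> 0\<^sub>v n"
    using deg_pos[OF n_pos] n_pos by (metis index_vec index_zero_vec(1) less_irrefl)
  ultimately show ?thesis
    unfolding eigenvalue_def eigenvector_def using walk_mat_carrier[of n a]
    by (intro exI[of _ ?x]) auto
qed

text \<open>\<open>eigenvalues_desc\<close> collects real roots only; the splitting of the
  characteristic polynomial shows that there are \<open>n\<close> of them, so the indices in
  \<open>second_eigenvalue\<close> pick the intended eigenvalues.\<close>

lemma eigenvalues_desc_walk_mat:
  defines "es \<equiv> eigenvalues_desc W"
  shows "char_poly W = (\<Prod>e\<leftarrow>es. [:- e, 1:])" "length es = n" "sorted (rev es)" "es ! 0 = 1"
    "\<And>e. e \<in> set es \<Longrightarrow> \<bar>e\<bar> \<le> 1"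
proof -
  obtain es' where es': "char_poly W = (\<Prod>e\<leftarrow>es'. [:- e, 1:])" "length es' = n"
    using char_poly_of_real_splits[OF walk_mat_carrier eigenvalue_walk_mat_real] by blast
  have nz: "(\<Prod>e\<leftarrow>xs. [:- e, 1:]) \<noteq> 0" for xs :: "real list"
    by (induction xs) (simp_all del: mult_pCons_left)
  have "proots (\<Prod>e\<leftarrow>xs. [:- e, 1:]) = mset xs" for xs :: "real list"
  proof (induction xs)
    case (Cons a xs)
    then show ?case
      using proots_mult[of "[:- a, 1:]" "\<Prod>e\<leftarrow>xs. [:- e, 1:]"] nz[of xs] by (simp del: mult_pCons_left)
  qed simp
  then have "proots (char_poly W) = mset es'" unfolding es'(1) .
  then have m: "mset es = mset es'" by (simp add: es_def eigenvalues_desc_def)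
  have "(\<Prod>e\<leftarrow>es'. [:- e, 1:]) = (\<Prod>e\<leftarrow>es. [:- e, 1:])"
    unfolding prod_mset_prod_list[symmetric] mset_map m ..
  with es'(1) show cp: "char_poly W = (\<Prod>e\<leftarrow>es. [:- e, 1:])" by (rule trans)
  show len: "length es = n" using mset_eq_length[OF m] es'(2) by simp
  show sorted: "sorted (rev es)" by (simp add: es_def eigenvalues_desc_def)
  have root: "eigenvalue W e \<longleftrightarrow> e \<in> set es" for e
    unfolding eigenvalue_root_char_poly[OF walk_mat_carrier] cp
    by (induction es) auto
  show abs_le: "\<bar>e\<bar> \<le> 1" if "e \<in> set es" for e
    using that root eigenvalue_walk_mat_abs_le_1 by blast
  have "es ! 0 \<in> set es" using len n_pos by simp
  from abs_le[OF this] have "es ! 0 \<le> 1" by simp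
  \<comment> \<open>The degree vector puts 1 somewhere into the list, and the head is the largest
    entry.\<close>
  moreover have "1 \<le> es ! 0"
  proof -
    have "1 \<in> set es" using root eigenvalue_walk_mat_1 by blast
    then obtain i where "i < length es" "es ! i = 1" by (auto simp: in_set_conv_nth)
    then show ?thesis using sorted_rev_nth_mono[OF sorted, of 0 i] by simp
  qed
  ultimately show "es ! 0 = 1" by simp
qed

text \<open>With \<open>n \<ge> 2\<close> the indices 1 and \<open>n - 1\<close> stay inside the
  list. The bound later absorbs \<open>\<eta> * lam\<close> into \<open>\<eta>\<close>.\<close>

lemma second_eigenvalue_le_1:
  assumes "n \<ge> 2"
  shows "second_eigenvalue W \<le> 1"
proof -
  have "eigenvalues_desc W ! i \<in> set (eigenvalues_desc W)" if "i < n" for i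
    using that eigenvalues_desc_walk_mat(2) by simp
  moreover have "dim_row W = n" using walk_mat_carrier[of n a] by simp
  ultimately show ?thesis
    unfolding second_eigenvalue_def using assms eigenvalues_desc_walk_mat(5) by simp
qed

text \<open>Comparing traces of even powers avoids an orthonormal eigenbasis: the trace of the \<open>2m\<close>-th power is
  at most \<open>n * lam ^ (2 * m)\<close>, and the factor \<open>n\<close> disappears as \<open>m\<close> tends to infinity.\<close>

lemma centered_op_bound:
  assumes n: "n \<ge> 2"
  shows "op_bound n (centered_op n a) (second_eigenvalue W)"
  unfolding op_bound_def
proof
  fix y
  define es where "es = eigenvalues_desc W"
  define lam where "lam = second_eigenvalue W"
  note es = eigenvalues_desc_walk_mat[folded es_def]
  have lam_def': "lam = max \<bar>es ! 1\<bar> \<bar>es ! (n - 1)\<bar>"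
    using walk_mat_carrier[of n a] by (simp add: lam_def second_eigenvalue_def es_def)
  have lam0: "lam \<ge> 0" by (simp add: lam_def')
  \<comment> \<open>The list is decreasing, so these entries lie between the second and the last
    one, and the larger modulus of the two dominates.\<close>
  have es_le: "\<bar>es ! i\<bar> \<le> lam" if "1 \<le> i" "i < n" for i
  proof -
    have "es ! i \<le> es ! 1" "es ! (n - 1) \<le> es ! i"
      using sorted_rev_nth_mono[OF es(3), of 1 i] sorted_rev_nth_mono[OF es(3), of i "n - 1"] that es(2) by auto
    then show ?thesis unfolding lam_def' by linarith
  qed
  have pow: "nrm n (mat_apply n (centered_op n a) y) ^ (2 * m) \<le> real n * (lam * nrm n y) ^ (2 * m)" if m: "m \<ge> 1" for m
  proof -
    have "(\<Sum>u<n. mpow n (centered_op n a) (2 * m) u u) = (\<Sum>u<n. mpow n (walk_op n a) (2 * m) u u) - 1"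
      using m by (intro trace_centered_op) simp
    also have "(\<Sum>u<n. mpow n (walk_op n a) (2 * m) u u) = (\<Sum>u<n. (W ^\<^sub>m (2 * m)) $$ (u, u))"
    proof (rule sum.cong)
      fix u assume "u \<in> {..<n}"
      then show "mpow n (walk_op n a) (2 * m) u u = (W ^\<^sub>m (2 * m)) $$ (u, u)"
        using mpow_cong[of n "\<lambda>u v. W $$ (u, v)" "walk_op n a"] by (simp add: mat_pow_mpow[OF walk_mat_carrier] walk_mat_index)
    qed simp
    also have "\<dots> = (\<Sum>i<n. (es ! i) ^ (2 * m))"
      by (rule trace_pow_eigenvalues[OF walk_mat_carrier es(1)])
    \<comment> \<open>The head is the eigenvalue 1; its term cancels the 1 subtracted by
      \<open>trace_centered_op\<close>.\<close>
    also have "\<dots> = (es ! 0) ^ (2 * m) + (\<Sum>i\<in>{..<n} - {0}. (es ! i) ^ (2 * m))"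
      using n_pos by (intro sum.remove) auto
    also have "(\<Sum>i\<in>{..<n} - {0}. (es ! i) ^ (2 * m)) \<le> (\<Sum>i\<in>{..<n} - {0}. lam ^ (2 * m))"
    proof (rule sum_mono)
      fix i assume "i \<in> {..<n} - {0}"
      then have "\<bar>es ! i\<bar> ^ (2 * m) \<le> lam ^ (2 * m)" by (intro power_mono es_le) auto
      then show "(es ! i) ^ (2 * m) \<le> lam ^ (2 * m)" by (simp add: power_mult)
    qed
    also have "\<dots> \<le> real n * lam ^ (2 * m)"
      unfolding sum_constant
    proof (rule mult_right_mono)
      have "card ({..<n} - {0}) \<le> card {..<n}" by (rule card_Diff1_le)
      then show "real (card ({..<n} - {0})) \<le> real n" by simp
    qed (use lam0 in simp)
    finally have tr: "(\<Sum>u<n. mpow n (centered_op n a) (2 * m) u u) \<le> real n * lam ^ (2 * m)"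
      by (simp add: es(4))
    have "nrm n (mat_apply n (centered_op n a) y) ^ (2 * m)
        \<le> (\<Sum>u<n. mpow n (centered_op n a) (2 * m) u u) * nrm n y ^ (2 * m)"
      by (rule nrm_mat_apply_power_le_trace[OF centered_op_sym m])
    also have "\<dots> \<le> real n * lam ^ (2 * m) * nrm n y ^ (2 * m)"
      by (intro mult_right_mono tr) simp
    finally show ?thesis by (simp add: power_mult_distrib mult.assoc)
  qed
  have "nrm n (mat_apply n (centered_op n a) y) \<le> lam * nrm n y"
    by (rule le_of_power_le_const_mult[OF _ _ pow]) (use lam0 in simp_all)
  then show "nrm n (mat_apply n (centered_op n a) y) \<le> second_eigenvalue W * nrm n y"
    by (simp add: lam_def)
qed

end

section \<open>Concentration of weighted degree sums\<close>

lemma exp_le_quadratic: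
  fixes s :: real
  assumes "\<bar>s\<bar> \<le> 1"
  shows "exp s \<le> 1 + s + s\<^sup>2"
proof (cases "s \<ge> 0")
  case True
  then show ?thesis using exp_bound[of s] assms by simp
next
  case False
  have pos: "1 - s > 0" using False by simp
  have "exp s \<le> 1 / (1 - s)"
    using exp_ge_add_one_self[of "- s"] pos by (simp add: exp_minus field_simps)
  \<comment> \<open>For negative \<open>s\<close> this product exceeds 1, so the quadratic dominates
    \<open>1 / (1 - s)\<close>.\<close>
  also have "(1 + s + s\<^sup>2) * (1 - s) = 1 - s ^ 3"
    by (simp add: algebra_simps power2_eq_square power3_eq_cube)
  then have "1 / (1 - s) \<le> 1 + s + s\<^sup>2"
    using pos False by (simp add: pos_divide_le_eq)
  finally show ?thesis .
qed

text \<open>Centering cancels the linear term: after \<open>1 + x \<le> exp x\<close> only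
  \<open>exp s - 1 - s \<le> s^2\<close> remains. The exponents are the two values of
  \<open>of_bool b - q\<close>, scaled by \<open>s\<close>.\<close>

lemma bernoulli_mgf_le:
  fixes q s :: real
  assumes "q \<in> {0..1}" "\<bar>s\<bar> \<le> 1"
  shows "q * exp (s * (1 - q)) + (1 - q) * exp (s * (0 - q)) \<le> exp (q * s\<^sup>2)"
proof -
  have "q * exp (s * (1 - q)) + (1 - q) * exp (s * (0 - q)) = exp (- (s * q)) * (1 + q * (exp s - 1))"
    by (simp add: algebra_simps exp_diff exp_minus exp_add field_simps)
  also have "\<dots> \<le> exp (- (s * q)) * exp (q * (exp s - 1))"
    by (intro mult_left_mono exp_ge_add_one_self) simp
  also have "\<dots> = exp (q * (exp s - 1 - s))"
    by (simp add: exp_add[symmetric] algebra_simps)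
  also have "\<dots> \<le> exp (q * s\<^sup>2)"
    using exp_le_quadratic[OF assms(2)] assms(1) by (auto intro!: mult_left_mono)
  finally show ?thesis .
qed

definition upper_pairs :: "nat \<Rightarrow> (nat \<times> nat) set" where
  "upper_pairs n = {(u, v). u \<le> v \<and> v < n}"

lemma finite_upper_pairs [simp]: "finite (upper_pairs n)"
  by (rule finite_subset[of _ "{..<n} \<times> {..<n}"]) (auto simp: upper_pairs_def)

text \<open>Independence is indexed by \<open>u \<le> v\<close>, whereas degrees and volume sum over
  ordered pairs; every edge other than a loop collects two terms.\<close>

lemma sum_upper_pairs:
  fixes f :: "nat \<Rightarrow> nat \<Rightarrow> real"
  shows "(\<Sum>u<n. \<Sum>v<n. f u v)
    = (\<Sum>(u, v)\<in>upper_pairs n. if u = v then f u u else f u v + f v u)"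
proof -
  let ?S = "{(u, v). u < v \<and> v < n}" and ?D = "{(u, v). u = v \<and> v < n}"
  have fin: "finite ?S" "finite ?D"
    by (rule finite_subset[of _ "{..<n} \<times> {..<n}"]; auto)+
  have "(\<Sum>u<n. \<Sum>v<n. f u v) = (\<Sum>(u, v)\<in>(?D \<union> ?S) \<union> prod.swap ` ?S. f u v)"
    unfolding sum.cartesian_product by (intro sum.cong refl) (force simp: image_iff)
  also have "\<dots> = (\<Sum>(u, v)\<in>?D \<union> ?S. f u v) + (\<Sum>(u, v)\<in>prod.swap ` ?S. f u v)"
    using fin by (intro sum.union_disjoint) auto
  also have "(\<Sum>(u, v)\<in>prod.swap ` ?S. f u v) = (\<Sum>(u, v)\<in>?S. f v u)"
    by (subst sum.reindex) (auto intro!: sum.cong)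
  also have "(\<Sum>(u, v)\<in>?D \<union> ?S. f u v) = (\<Sum>(u, v)\<in>?D. f u v) + (\<Sum>(u, v)\<in>?S. f u v)"
    using fin by (intro sum.union_disjoint) auto
  finally have "(\<Sum>u<n. \<Sum>v<n. f u v)
      = (\<Sum>(u, v)\<in>?D. f u v) + (\<Sum>(u, v)\<in>?S. f u v + f v u)"
    by (simp add: sum.distrib case_prod_unfold)
  also have "\<dots> = (\<Sum>(u, v)\<in>?D. if u = v then f u u else f u v + f v u)
      + (\<Sum>(u, v)\<in>?S. if u = v then f u u else f u v + f v u)"
    by (intro arg_cong2[of _ _ _ _ "(+)"] sum.cong) auto
  also have "\<dots> = (\<Sum>(u, v)\<in>?D \<union> ?S. if u = v then f u u else f u v + f v u)"
    using fin by (intro sum.union_disjoint[symmetric]) auto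
  also have "?D \<union> ?S = upper_pairs n"
    by (auto simp: upper_pairs_def)
  finally show ?thesis .
qed

section \<open>Random quantities as functions of a finite edge set\<close>

context edge_independent_graph
begin

text \<open>A random variable with finitely many values that carries the whole graph: any predicate
  of it is an event and any real function of it is integrable, whatever the predicate or function
  is.\<close>

definition edge_set :: "'a \<Rightarrow> (nat \<times> nat) set" where
  "edge_set w = {(u, v). u < n \<and> v < n \<and> E w u v}"

lemma edge_set_subset: "edge_set w \<subseteq> {..<n} \<times> {..<n}"
  by (auto simp: edge_set_def)

lemma measurable_edge_set:
  "edge_set \<in> measurable M (count_space (Pow ({..<n} \<times> {..<n})))"
proof (subst measurable_count_space_eq2)
  show "finite (Pow ({..<n} \<times> {..<n}))" by simp
  have "edge_set -` {S} \<inter> space M \<in> events" if S: "S \<subseteq> {..<n} \<times> {..<n}" for S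
  proof -
    have "edge_set -` {S} \<inter> space M
        = {w \<in> space M. \<forall>e\<in>{..<n} \<times> {..<n}. E w (fst e) (snd e) \<longleftrightarrow> e \<in> S}"
    proof -
      have "edge_set w = S \<longleftrightarrow> (\<forall>e\<in>{..<n} \<times> {..<n}. E w (fst e) (snd e) \<longleftrightarrow> e \<in> S)" for w
        using S unfolding edge_set_def by fastforce
      then show ?thesis by blast
    qed
    also have "\<dots> \<in> events"
    proof (intro sets.sets_Collect_finite_All)
      fix e assume "e \<in> {..<n} \<times> {..<n}"
      then have "{w \<in> space M. E w (fst e) (snd e)} \<in> events"
        by (intro E_measurable) auto
      then show "{w \<in> space M. E w (fst e) (snd e) \<longleftrightarrow> e \<in> S} \<in> events"
        by (cases "e \<in> S") (auto intro: sets.sets_Collect_neg)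
    qed simp
    finally show ?thesis .
  qed
  then show "edge_set \<in> space M \<rightarrow> Pow ({..<n} \<times> {..<n})
      \<and> (\<forall>S\<in>Pow ({..<n} \<times> {..<n}). edge_set -` {S} \<inter> space M \<in> events)"
    by (simp add: Pi_def edge_set_subset)
qed

lemma events_edge_set:
  assumes "\<And>w. P w \<longleftrightarrow> Q (edge_set w)"
  shows "{w \<in> space M. P w} \<in> events"
proof -
  have "{w \<in> space M. P w} = edge_set -` ({S. Q S} \<inter> Pow ({..<n} \<times> {..<n})) \<inter> space M"
    using edge_set_subset by (simp add: assms vimage_def Int_def conj_commute)
  also have "\<dots> \<in> events"
    by (rule measurable_sets[OF measurable_edge_set]) auto
  finally show ?thesis .
qed

lemma integrable_edge_set:
  fixes f :: "'a \<Rightarrow> real"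
  assumes "\<And>w. f w = g (edge_set w)"
  shows "integrable M f"
proof (rule integrable_const_bound)
  have "\<bar>f w\<bar> \<le> Max ((\<lambda>S. \<bar>g S\<bar>) ` Pow ({..<n} \<times> {..<n}))" for w
    using edge_set_subset by (intro Max_ge) (auto simp: assms)
  then show "AE w in M. norm (f w) \<le> Max ((\<lambda>S. \<bar>g S\<bar>) ` Pow ({..<n} \<times> {..<n}))" by simp
  have "g \<in> borel_measurable (count_space (Pow ({..<n} \<times> {..<n})))" by simp
  from measurable_compose[OF measurable_edge_set this]
  show "f \<in> borel_measurable M" by (simp add: assms[abs_def])
qed

lemma E_iff_edge_set: "u < n \<Longrightarrow> v < n \<Longrightarrow> E w u v \<longleftrightarrow> (u, v) \<in> edge_set w"
  by (simp add: edge_set_def)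

lemma integrable_edge:
  fixes F :: "bool \<Rightarrow> real"
  assumes "u < n" "v < n"
  shows "integrable M (\<lambda>w. F (E w u v))"
  by (rule integrable_edge_set[where g = "\<lambda>S. F ((u, v) \<in> S)"]) (simp add: E_iff_edge_set assms)

lemma expectation_edge:
  fixes F :: "bool \<Rightarrow> real"
  assumes "u < n" "v < n"
  shows "expectation (\<lambda>w. F (E w u v)) = p u v * F True + (1 - p u v) * F False"
proof -
  let ?A = "{w \<in> space M. E w u v}"
  have A: "?A \<in> events" by (rule E_measurable) fact+
  have "expectation (\<lambda>w. F (E w u v)) = expectation (\<lambda>w. F False + (F True - F False) * indicator ?A w)"
    by (rule Bochner_Integration.integral_cong) (auto simp: indicator_def)
  also have "\<dots> = F False + (F True - F False) * prob ?A"
    using A by (subst Bochner_Integration.integral_add) (simp_all add: prob_space emeasure_eq_measure)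
  finally show ?thesis using E_prob[OF assms] by (simp add: algebra_simps)
qed

text \<open>\<open>upper_pairs\<close> contains each unordered pair once, so the factors are
  independent. Arbitrary \<open>F e\<close> let this serve both exponential moments and products
  along walks.\<close>

lemma expectation_prod_edges:
  fixes F :: "nat \<times> nat \<Rightarrow> bool \<Rightarrow> real"
  assumes J: "J \<subseteq> upper_pairs n"
  shows "expectation (\<lambda>w. \<Prod>e\<in>J. F e (E w (fst e) (snd e)))
    = (\<Prod>e\<in>J. p (fst e) (snd e) * F e True + (1 - p (fst e) (snd e)) * F e False)"
proof -
  have fin: "finite J" using finite_subset[OF J finite_upper_pairs] .
  have "indep_vars (\<lambda>_. count_space UNIV) (\<lambda>(u, v) w. E w u v) J"
    by (rule indep_vars_subset[OF E_indep]) (use J in \<open>simp add: upper_pairs_def\<close>)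
  from indep_vars_compose2[OF this, of F "\<lambda>_. borel"]
  have "indep_vars (\<lambda>_. borel) (\<lambda>e w. F e (E w (fst e) (snd e))) J"
    by (simp add: case_prod_beta)
  moreover have bound: "fst e < n" "snd e < n" if "e \<in> J" for e
    using J that by (auto simp: upper_pairs_def)
  ultimately have "expectation (\<lambda>w. \<Prod>e\<in>J. F e (E w (fst e) (snd e)))
      = (\<Prod>e\<in>J. expectation (\<lambda>w. F e (E w (fst e) (snd e))))"
    using fin by (intro indep_vars_lebesgue_integral integrable_edge) auto
  also have "\<dots> = (\<Prod>e\<in>J. p (fst e) (snd e) * F e True + (1 - p (fst e) (snd e)) * F e False)"
    using bound by (intro prod.cong refl expectation_edge) auto
  finally show ?thesis .
qed

text \<open>Markov for \<open>exp (t * Z)\<close> with \<open>t = sqrt (L / V)\<close>, which makes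
  \<open>t^2 * V = L\<close> and \<open>t\<close> times the threshold equal to \<open>K * L\<close>.
  The condition \<open>4 * L \<le> V\<close> gives \<open>t \<le> 1 / 2\<close>, so each
  \<open>t * c e\<close> stays where the quadratic bound of exp is valid.\<close>

lemma chernoff_edges:
  fixes c :: "nat \<times> nat \<Rightarrow> real"
  assumes c: "\<And>e. e \<in> upper_pairs n \<Longrightarrow> \<bar>c e\<bar> \<le> 2"
    and V: "(\<Sum>e\<in>upper_pairs n. (c e)\<^sup>2 * p (fst e) (snd e)) \<le> V" "V > 0"
    and L: "0 \<le> L" "4 * L \<le> V"
  defines "Z \<equiv> \<lambda>w. \<Sum>e\<in>upper_pairs n. c e * (of_bool (E w (fst e) (snd e)) - p (fst e) (snd e))"
  shows "prob {w \<in> space M. Z w \<ge> K * sqrt (V * L)} \<le> exp (- ((K - 1) * L))"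
proof -
  define t where "t = sqrt (L / V)"
  have t: "t \<ge> 0" "t\<^sup>2 * V = L" using V L by (simp_all add: t_def)
  have "t * sqrt (V * L) = sqrt ((L / V) * (V * L))"
    unfolding t_def by (rule real_sqrt_mult[symmetric])
  also have "(L / V) * (V * L) = L\<^sup>2" using V by (simp add: power2_eq_square)
  finally have tV: "t * sqrt (V * L) = L" using L by simp
  have "t \<le> sqrt ((1 / 2)\<^sup>2)"
    unfolding t_def using V L by (intro real_sqrt_le_mono) (simp add: field_simps power2_eq_square)
  then have t_half: "t \<le> 1 / 2" by simp
  let ?G = "\<lambda>e b. exp (t * c e * (of_bool b - p (fst e) (snd e)))"
  have exp_Z: "exp (t * Z w) = (\<Prod>e\<in>upper_pairs n. ?G e (E w (fst e) (snd e)))" for w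
    by (simp add: Z_def sum_distrib_left exp_sum[symmetric] mult.assoc)
  have Zf: "Z w = (\<Sum>e\<in>upper_pairs n. c e * (of_bool (e \<in> edge_set w) - p (fst e) (snd e)))" for w
    unfolding Z_def by (intro sum.cong) (auto simp: upper_pairs_def E_iff_edge_set)
  have int: "integrable M (\<lambda>w. exp (t * Z w))"
    by (rule integrable_edge_set[where g = "\<lambda>S. exp (t * (\<Sum>e\<in>upper_pairs n. c e * (of_bool (e \<in> S) - p (fst e) (snd e))))"])
       (simp add: Zf)
  have factor: "p (fst e) (snd e) * ?G e True + (1 - p (fst e) (snd e)) * ?G e False
      \<le> exp (p (fst e) (snd e) * (t * c e)\<^sup>2)"
    and factor0: "0 \<le> p (fst e) (snd e) * ?G e True + (1 - p (fst e) (snd e)) * ?G e False"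
    if "e \<in> upper_pairs n" for e
  proof -
    have pr: "p (fst e) (snd e) \<in> {0..1}"
      using that by (intro p_range) (auto simp: upper_pairs_def)
    have "\<bar>t * c e\<bar> \<le> 1 / 2 * 2"
      unfolding abs_mult using t t_half c[OF that] by (intro mult_mono) auto
    then show "p (fst e) (snd e) * ?G e True + (1 - p (fst e) (snd e)) * ?G e False
      \<le> exp (p (fst e) (snd e) * (t * c e)\<^sup>2)"
      using bernoulli_mgf_le[OF pr, of "t * c e"] by simp
    show "0 \<le> p (fst e) (snd e) * ?G e True + (1 - p (fst e) (snd e)) * ?G e False"
      using pr by simp
  qed
  have "expectation (\<lambda>w. exp (t * Z w))
      = (\<Prod>e\<in>upper_pairs n. p (fst e) (snd e) * ?G e True + (1 - p (fst e) (snd e)) * ?G e False)"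
    unfolding exp_Z by (rule expectation_prod_edges) simp
  also have "\<dots> \<le> (\<Prod>e\<in>upper_pairs n. exp (p (fst e) (snd e) * (t * c e)\<^sup>2))"
    by (intro prod_mono conjI factor factor0)
  also have "\<dots> = exp (t\<^sup>2 * (\<Sum>e\<in>upper_pairs n. (c e)\<^sup>2 * p (fst e) (snd e)))"
    by (simp add: exp_sum[symmetric] sum_distrib_left power_mult_distrib mult_ac)
  also have "\<dots> \<le> exp L"
    using mult_left_mono[OF V(1), of "t\<^sup>2"] t by simp
  finally have mgf: "expectation (\<lambda>w. exp (t * Z w)) \<le> exp L" .
  have "{w \<in> space M. Z w \<ge> K * sqrt (V * L)} \<subseteq> {w \<in> space M. exp (t * Z w) \<ge> exp (K * L)}"
  proof
    fix w assume w: "w \<in> {w \<in> space M. Z w \<ge> K * sqrt (V * L)}"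
    then have "t * (K * sqrt (V * L)) \<le> t * Z w" using t by (intro mult_left_mono) simp_all
    moreover have "t * (K * sqrt (V * L)) = K * L" using tV by (simp add: mult_ac)
    ultimately show "w \<in> {w \<in> space M. exp (t * Z w) \<ge> exp (K * L)}" using w by simp
  qed
  then have "prob {w \<in> space M. Z w \<ge> K * sqrt (V * L)} \<le> prob {w \<in> space M. exp (t * Z w) \<ge> exp (K * L)}"
    by (rule finite_measure_mono) (rule borel_measurable_le, auto intro: borel_measurable_integrable int)
  also have "\<dots> \<le> expectation (\<lambda>w. exp (t * Z w)) / exp (K * L)"
    by (rule integral_Markov_inequality_measure[where A = "{}"]) (use int in auto)
  also have "\<dots> \<le> exp L / exp (K * L)"
    using mgf by (intro divide_right_mono) auto
  also have "\<dots> = exp (- ((K - 1) * L))"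
    by (simp add: exp_diff[symmetric] algebra_simps)
  finally show ?thesis .
qed

text \<open>With \<open>h\<close> the indicator of a column this concerns a degree, with
  \<open>h = 1\<close> the volume. Joining both orientations of an edge gives coefficients in
  [0, 2], hence \<open>c^2 \<le> 2 * c\<close> and the variance bound \<open>2 * S\<close>.\<close>

lemma chernoff_weighted_degree_sum:
  fixes h :: "nat \<Rightarrow> nat \<Rightarrow> real"
  assumes h: "\<And>u v. h u v \<in> {0..1}"
  defines "S \<equiv> \<Sum>u<n. \<Sum>v<n. h u v * p u v"
  assumes S: "S > 0" and L: "0 \<le> L" "2 * L \<le> S"
  shows "prob {w \<in> space M. \<bar>(\<Sum>u<n. \<Sum>v<n. h u v * of_bool (E w u v)) - S\<bar> \<ge> 6 * sqrt (S * L)}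
    \<le> 2 * exp (- 3 * L)"
proof -
  define c where "c e = (if fst e = snd e then h (fst e) (fst e) else h (fst e) (snd e) + h (snd e) (fst e))" for e
  have c0: "0 \<le> c e" "c e \<le> 2" for e
    using h[of "fst e" "fst e"] h[of "fst e" "snd e"] h[of "snd e" "fst e"] by (auto simp: c_def)
  have rew: "(\<Sum>u<n. \<Sum>v<n. h u v * f u v) = (\<Sum>e\<in>upper_pairs n. c e * f (fst e) (snd e))"
    if "\<And>u v. u < n \<Longrightarrow> v < n \<Longrightarrow> f u v = f v u" for f :: "nat \<Rightarrow> nat \<Rightarrow> real"
    unfolding sum_upper_pairs
    by (rule sum.cong) (auto simp: c_def upper_pairs_def algebra_simps that split: prod.splits)
  have Sc: "S = (\<Sum>e\<in>upper_pairs n. c e * p (fst e) (snd e))"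
    unfolding S_def by (rule rew) (rule p_sym)
  have var: "(\<Sum>e\<in>upper_pairs n. (c e)\<^sup>2 * p (fst e) (snd e)) \<le> 2 * S"
    unfolding Sc sum_distrib_left
  proof (rule sum_mono)
    fix e assume "e \<in> upper_pairs n"
    then have "p (fst e) (snd e) \<ge> 0" using p_range[of "fst e" "snd e"] by (auto simp: upper_pairs_def)
    then show "(c e)\<^sup>2 * p (fst e) (snd e) \<le> 2 * (c e * p (fst e) (snd e))"
      using c0[of e] by (simp add: power2_eq_square mult_right_mono flip: mult.assoc)
  qed
  \<comment> \<open>The sign \<open>s\<close> provides both tails from the one-sided bound.\<close>
  let ?Z = "\<lambda>s w. \<Sum>e\<in>upper_pairs n. s * c e * (of_bool (E w (fst e) (snd e)) - p (fst e) (snd e))"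
  have one: "prob {w \<in> space M. ?Z s w \<ge> 4 * sqrt (2 * S * L)} \<le> exp (- 3 * L)" if "\<bar>s\<bar> = 1" for s
  proof -
    have "s\<^sup>2 = 1" using that by (metis power2_abs one_power2)
    then have "prob {w \<in> space M. ?Z s w \<ge> 4 * sqrt (2 * S * L)} \<le> exp (- ((4 - 1) * L))"
      using c0 that S L var by (intro chernoff_edges) (auto simp: abs_mult power_mult_distrib)
    then show ?thesis by simp
  qed
  have ev: "{w \<in> space M. ?Z s w \<ge> 4 * sqrt (2 * S * L)} \<in> events" for s
  proof (rule events_edge_set)
    show "?Z s w \<ge> 4 * sqrt (2 * S * L) \<longleftrightarrow>
      (\<Sum>e\<in>upper_pairs n. s * c e * (of_bool (e \<in> edge_set w) - p (fst e) (snd e))) \<ge> 4 * sqrt (2 * S * L)" for w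
      by (intro arg_cong2[of _ _ _ _ "(\<le>)"] sum.cong refl) (auto simp: upper_pairs_def E_iff_edge_set)
  qed
  \<comment> \<open>\<open>K = 4\<close> with \<open>V = 2 * S\<close> gives exponent
    \<open>K - 1 = 3\<close>; the constant 6 comes from \<open>4 * sqrt 2 \<le> 6\<close>.\<close>
  have "4 * sqrt (2 * S * L) = sqrt (32 * (S * L))"
    by (rule real_sqrt_unique[symmetric]) (use S L in \<open>auto simp: power_mult_distrib\<close>)
  also have "\<dots> \<le> sqrt (36 * (S * L))" using S L by (intro real_sqrt_le_mono) simp
  also have "\<dots> = 6 * sqrt (S * L)" by (rule real_sqrt_unique) (use S L in \<open>auto simp: power_mult_distrib\<close>)
  finally have six: "4 * sqrt (2 * S * L) \<le> 6 * sqrt (S * L)" .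
  have "{w \<in> space M. \<bar>(\<Sum>u<n. \<Sum>v<n. h u v * of_bool (E w u v)) - S\<bar> \<ge> 6 * sqrt (S * L)}
     \<subseteq> {w \<in> space M. ?Z 1 w \<ge> 4 * sqrt (2 * S * L)} \<union> {w \<in> space M. ?Z (-1) w \<ge> 4 * sqrt (2 * S * L)}"
  proof safe
    fix w assume w: "w \<in> space M" "6 * sqrt (S * L) \<le> \<bar>(\<Sum>u<n. \<Sum>v<n. h u v * of_bool (E w u v)) - S\<bar>"
      "\<not> 4 * sqrt (2 * S * L) \<le> ?Z (-1) w"
    have eq: "(\<Sum>u<n. \<Sum>v<n. h u v * of_bool (E w u v)) - S = ?Z 1 w"
      using w(1) by (subst rew) (auto simp: E_sym Sc algebra_simps sum_subtractf)
    have neg: "?Z (-1) w = - ?Z 1 w" by (simp add: sum_negf)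
    have "4 * sqrt (2 * S * L) \<le> z"
      if "6 * sqrt (S * L) \<le> \<bar>z\<bar>" "\<not> 4 * sqrt (2 * S * L) \<le> - z" for z
      using that six by linarith
    from this[OF w(2)[unfolded eq] w(3)[unfolded neg]]
    show "4 * sqrt (2 * S * L) \<le> ?Z 1 w" .
  qed
  then have "prob {w \<in> space M. \<bar>(\<Sum>u<n. \<Sum>v<n. h u v * of_bool (E w u v)) - S\<bar> \<ge> 6 * sqrt (S * L)}
     \<le> prob ({w \<in> space M. ?Z 1 w \<ge> 4 * sqrt (2 * S * L)} \<union> {w \<in> space M. ?Z (-1) w \<ge> 4 * sqrt (2 * S * L)})"
    by (rule finite_measure_mono) (intro sets.Un ev)
  also have "\<dots> \<le> prob {w \<in> space M. ?Z 1 w \<ge> 4 * sqrt (2 * S * L)} + prob {w \<in> space M. ?Z (-1) w \<ge> 4 * sqrt (2 * S * L)}"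
    by (rule measure_Un_le) (rule ev)+
  also have "\<dots> \<le> exp (- 3 * L) + exp (- 3 * L)"
    by (intro add_mono one) simp_all
  finally show ?thesis by simp
qed

end

section \<open>Moment bound for the normalized noise\<close>

text \<open>Normal form of an unordered pair, matching the representatives in
  \<open>upper_pairs\<close>.\<close>

definition edge :: "nat \<Rightarrow> nat \<Rightarrow> nat \<times> nat" where
  "edge u v = (min u v, max u v)"

fun walk_edges :: "nat list \<Rightarrow> (nat \<times> nat) list" where
  "walk_edges (u # v # ws) = edge u v # walk_edges (v # ws)"
| "walk_edges _ = []"

fun walk_prod :: "(nat \<Rightarrow> nat \<Rightarrow> real) \<Rightarrow> nat list \<Rightarrow> real" where
  "walk_prod X (u # v # ws) = X u v * walk_prod X (v # ws)"
| "walk_prod X _ = 1"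

definition walks :: "nat \<Rightarrow> nat \<Rightarrow> nat list set" where
  "walks n L = {ws. set ws \<subseteq> {..<n} \<and> length ws = Suc L}"

text \<open>The list is read from its end: an edge not visited before contributes \<open>a e\<close>, a repeated one
  \<open>b\<close>.  With \<open>b\<close> times the number of visited edges at most \<open>\<theta>\<close>, each step of a walk has total
  weight at most \<open>2 * \<theta>\<close>, whatever the history.\<close>

fun first_visit_weight :: "(nat \<times> nat \<Rightarrow> real) \<Rightarrow> real \<Rightarrow> (nat \<times> nat) list \<Rightarrow> real" where
  "first_visit_weight a b [] = 1"
| "first_visit_weight a b (e # es) = (if e \<in> set es then b else a e) * first_visit_weight a b es"

lemma sum_walks_0: "(\<Sum>ws\<in>walks n 0. f ws) = (\<Sum>u<n. f [u])"
proof -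
  have "walks n 0 = (\<lambda>u. [u]) ` {..<n}"
    by (auto simp: walks_def length_Suc_conv)
  then show ?thesis by (simp add: sum.reindex inj_on_def)
qed

lemma sum_walks_Suc: "(\<Sum>ws\<in>walks n (Suc L). f ws) = (\<Sum>ws\<in>walks n L. \<Sum>u<n. f (u # ws))"
proof -
  have "walks n (Suc L) = (\<lambda>(ws, u). u # ws) ` (walks n L \<times> {..<n})"
    unfolding walks_def by (rule lists_length_Suc_eq)
  moreover have "inj_on (\<lambda>(ws, u). u # ws) (walks n L \<times> {..<n})"
    by (auto simp: inj_on_def)
  ultimately have "(\<Sum>ws\<in>walks n (Suc L). f ws) = (\<Sum>x\<in>walks n L \<times> {..<n}. f (snd x # fst x))"
    by (simp add: sum.reindex case_prod_unfold)
  then show ?thesis by (simp add: sum.cartesian_product case_prod_unfold)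
qed

lemma length_walk_edges: "length (walk_edges ws) = length ws - 1"
  by (induction ws rule: walk_edges.induct) auto

lemma set_walk_edges: "set ws \<subseteq> {..<n} \<Longrightarrow> set (walk_edges ws) \<subseteq> upper_pairs n"
  by (induction ws rule: walk_edges.induct) (auto simp: edge_def upper_pairs_def)

text \<open>Steps along the same edge carry the same random variable, so factors are collected by
  edge with multiplicity; only then can independence split the expectation.\<close>

lemma walk_prod_edges:
  assumes "\<And>u v. u < n \<Longrightarrow> v < n \<Longrightarrow> X u v = Y (edge u v)"
  shows "set ws \<subseteq> {..<n} \<Longrightarrow> walk_prod X ws = (\<Prod>e\<in>set (walk_edges ws). Y e ^ count_list (walk_edges ws) e)"
proof (induction ws rule: walk_edges.induct)
  case (1 u v ws)
  let ?es = "walk_edges (v # ws)" and ?e = "edge u v"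
  have "walk_prod X (u # v # ws) = Y ?e * (\<Prod>e\<in>set ?es. Y e ^ count_list ?es e)"
    using 1 assms by simp
  \<comment> \<open>The new edge may be missing from the tail; inserting it with exponent 0 treats
    both cases at once.\<close>
  also have "(\<Prod>e\<in>set ?es. Y e ^ count_list ?es e) = (\<Prod>e\<in>insert ?e (set ?es). Y e ^ count_list ?es e)"
    by (rule prod.mono_neutral_left) (auto simp: count_list_0_iff)
  also have "\<dots> = Y ?e ^ count_list ?es ?e * (\<Prod>e\<in>insert ?e (set ?es) - {?e}. Y e ^ count_list ?es e)"
    by (rule prod.remove) auto
  also have "(\<Prod>e\<in>insert ?e (set ?es) - {?e}. Y e ^ count_list ?es e)
      = (\<Prod>e\<in>insert ?e (set ?es) - {?e}. Y e ^ count_list (?e # ?es) e)"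
    by (rule prod.cong) auto
  also have "Y ?e * (Y ?e ^ count_list ?es ?e * \<dots>)
      = Y ?e ^ count_list (?e # ?es) ?e * (\<Prod>e\<in>insert ?e (set ?es) - {?e}. Y e ^ count_list (?e # ?es) e)"
    by simp
  also have "\<dots> = (\<Prod>e\<in>insert ?e (set ?es). Y e ^ count_list (?e # ?es) e)"
    by (rule prod.remove[symmetric]) auto
  finally show ?case by simp
qed auto

lemma walk_prod_cong:
  "(\<And>u v. u < n \<Longrightarrow> v < n \<Longrightarrow> X u v = Y u v) \<Longrightarrow> set ws \<subseteq> {..<n} \<Longrightarrow> walk_prod X ws = walk_prod Y ws"
  by (induction ws rule: walk_edges.induct) auto

text \<open>The recursion suits summation over walks step by step, the product over distinct edges
  suits comparison with moments.\<close>

lemma first_visit_weight_eq: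
  "first_visit_weight a b es = (\<Prod>e\<in>set es. a e * b ^ (count_list es e - 1))"
proof (induction es)
  case (Cons e es)
  let ?P = "\<lambda>S es. \<Prod>e\<in>S. a e * b ^ (count_list es e - 1)"
  have eq: "?P (set es - {e}) es = ?P (set es - {e}) (e # es)"
    by (rule prod.cong) auto
  show ?case
  proof (cases "e \<in> set es")
    case True
    then obtain j where c: "count_list es e = Suc j"
      using count_list_0_iff[of es e] not0_implies_Suc by auto
    have "first_visit_weight a b (e # es) = b * ?P (set es) es"
      using True Cons by simp
    also have "?P (set es) es = (a e * b ^ (count_list es e - 1)) * ?P (set es - {e}) es"
      using True by (intro prod.remove) auto
    also have "b * \<dots> = (a e * b ^ (count_list (e # es) e - 1)) * ?P (set es - {e}) (e # es)"
      unfolding eq by (simp add: c)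
    also have "\<dots> = ?P (set es) (e # es)"
      using True by (intro prod.remove[symmetric]) auto
    finally show ?thesis using True by (simp add: insert_absorb)
  next
    case False
    then have "count_list es e = 0" by (simp add: count_list_0_iff)
    moreover have "?P (set es) es = ?P (set es) (e # es)"
      using False by (intro prod.cong) auto
    ultimately show ?thesis using False Cons by simp
  qed
qed simp

lemma first_visit_weight_nonneg:
  "(\<And>e. e \<in> set es \<Longrightarrow> a e \<ge> 0) \<Longrightarrow> b \<ge> 0 \<Longrightarrow> first_visit_weight a b es \<ge> 0"
  by (induction es) auto

lemma sum_first_visit_weight_le:
  assumes a: "\<And>e. e \<in> upper_pairs n \<Longrightarrow> a e \<ge> 0" and b: "b \<ge> 0"
    and new: "\<And>v. v < n \<Longrightarrow> (\<Sum>u<n. a (edge u v)) \<le> \<theta>"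
    and old: "real N * b \<le> \<theta>"
  shows "L \<le> N \<Longrightarrow> (\<Sum>ws\<in>walks n L. first_visit_weight a b (walk_edges ws)) \<le> real n * (2 * \<theta>) ^ L"
proof (induction L)
  case 0
  then show ?case by (simp add: sum_walks_0)
next
  case (Suc L)
  have \<theta>: "\<theta> \<ge> 0" using old b by (smt (verit) of_nat_0_le_iff mult_nonneg_nonneg)
  let ?W = "\<lambda>ws. first_visit_weight a b (walk_edges ws)"
  have "(\<Sum>u<n. ?W (u # ws)) \<le> 2 * \<theta> * ?W ws" if ws: "ws \<in> walks n L" for ws
  proof -
    obtain v ws' where [simp]: "ws = v # ws'" and v: "v < n"
      using ws by (cases ws) (auto simp: walks_def)
    let ?es = "walk_edges ws"
    have es: "set ?es \<subseteq> upper_pairs n"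
      using ws by (intro set_walk_edges) (simp add: walks_def)
    have len: "length ?es = L" using ws by (simp add: length_walk_edges walks_def del: \<open>ws = v # ws'\<close>)
    \<comment> \<open>For fixed \<open>v\<close> the edge determines \<open>u\<close>, so each
      visited edge allows at most one next vertex.\<close>
    have "card {u \<in> {..<n}. edge u v \<in> set ?es} \<le> card (set ?es)"
      by (rule card_inj_on_le[where f = "\<lambda>u. edge u v"])
         (auto simp: inj_on_def edge_def min_def max_def split: if_splits)
    also have "\<dots> \<le> N" using card_length[of ?es] len Suc.prems by linarith
    finally have card: "card {u \<in> {..<n}. edge u v \<in> set ?es} \<le> N" .
    \<comment> \<open>Charging the first-visit weight to revisited edges as well only enlarges the
      sum, and frees it from the history.\<close>
    have "(\<Sum>u<n. if edge u v \<in> set ?es then b else a (edge u v))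
        \<le> (\<Sum>u<n. a (edge u v) + (if edge u v \<in> set ?es then b else 0))"
      using a v by (intro sum_mono) (auto simp: edge_def upper_pairs_def)
    also have "\<dots> = (\<Sum>u<n. a (edge u v)) + card {u \<in> {..<n}. edge u v \<in> set ?es} * b"
      by (simp add: sum.distrib sum.If_cases Int_def)
    also have "\<dots> \<le> \<theta> + N * b"
      using card b by (intro add_mono new v mult_right_mono) auto
    also have "\<dots> \<le> 2 * \<theta>" using old by simp
    finally have step: "(\<Sum>u<n. if edge u v \<in> set ?es then b else a (edge u v)) \<le> 2 * \<theta>" .
    have "?W ws \<ge> 0" using es a b by (intro first_visit_weight_nonneg) auto
    from mult_right_mono[OF step this]
    show ?thesis by (simp add: sum_distrib_right)
  qed
  then have "(\<Sum>ws\<in>walks n (Suc L). ?W ws) \<le> (\<Sum>ws\<in>walks n L. 2 * \<theta> * ?W ws)"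
    unfolding sum_walks_Suc by (intro sum_mono)
  also have "\<dots> \<le> 2 * \<theta> * (real n * (2 * \<theta>) ^ L)"
    unfolding sum_distrib_left[symmetric] using Suc \<theta> by (intro mult_left_mono) auto
  finally show ?case by (simp add: mult_ac)
qed

text \<open>The weight \<open>h\<close> on the two ends is general because the induction step
  absorbs the first factor of the walk into it; the trace is the case of equal ends.\<close>

lemma sum_walk_prod:
  "(\<Sum>ws\<in>walks n L. h (hd ws) (last ws) * walk_prod X ws) = (\<Sum>u<n. \<Sum>v<n. h u v * mpow n X L u v)"
proof (induction L arbitrary: h)
  case 0
  have "(\<Sum>v<n. h u v * of_bool (u = v)) = h u u" if "u < n" for u
    using that by (simp add: of_bool_def if_distrib[of "\<lambda>z. _ * z"] cong: if_cong)
  then show ?case by (simp add: sum_walks_0)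
next
  case (Suc L)
  have "(\<Sum>ws\<in>walks n (Suc L). h (hd ws) (last ws) * walk_prod X ws)
      = (\<Sum>ws\<in>walks n L. (\<Sum>u<n. h u (last ws) * X u (hd ws)) * walk_prod X ws)"
    unfolding sum_walks_Suc
  proof (rule sum.cong)
    fix ws assume "ws \<in> walks n L"
    then obtain v ws' where "ws = v # ws'" by (cases ws) (auto simp: walks_def)
    then show "(\<Sum>u<n. h (hd (u # ws)) (last (u # ws)) * walk_prod X (u # ws))
        = (\<Sum>u<n. h u (last ws) * X u (hd ws)) * walk_prod X ws"
      by (simp add: sum_distrib_left sum_distrib_right mult_ac)
  qed simp
  also have "\<dots> = (\<Sum>z<n. \<Sum>v<n. (\<Sum>u<n. h u v * X u z) * mpow n X L z v)"
    by (rule Suc)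
  also have "\<dots> = (\<Sum>z<n. \<Sum>v<n. \<Sum>u<n. h u v * X u z * mpow n X L z v)"
    by (simp add: sum_distrib_right)
  also have "\<dots> = (\<Sum>z<n. \<Sum>u<n. \<Sum>v<n. h u v * X u z * mpow n X L z v)"
    by (rule sum.cong[OF refl sum.swap])
  also have "\<dots> = (\<Sum>u<n. \<Sum>z<n. \<Sum>v<n. h u v * X u z * mpow n X L z v)"
    by (rule sum.swap)
  also have "\<dots> = (\<Sum>u<n. \<Sum>v<n. \<Sum>z<n. h u v * X u z * mpow n X L z v)"
    by (rule sum.cong[OF refl sum.swap])
  also have "\<dots> = (\<Sum>u<n. \<Sum>v<n. h u v * mpow n X (Suc L) u v)"
    by (simp add: sum_distrib_left mult.assoc)
  finally show ?case .
qed

lemma trace_mpow_walks: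
  "(\<Sum>u<n. mpow n X L u u) = (\<Sum>ws\<in>walks n L. of_bool (hd ws = last ws) * walk_prod X ws)"
proof -
  have eq: "(\<Sum>v<n. of_bool (u = v) * mpow n X L u v) = mpow n X L u u" if "u < n" for u
    using that by (simp add: of_bool_def if_distrib[of "\<lambda>z. z * _"] cong: if_cong)
  have "(\<Sum>ws\<in>walks n L. of_bool (hd ws = last ws) * walk_prod X ws)
      = (\<Sum>u<n. \<Sum>v<n. of_bool (u = v) * mpow n X L u v)"
    by (rule sum_walk_prod[where h = "\<lambda>u v. of_bool (u = v)"])
  also have "\<dots> = (\<Sum>u<n. mpow n X L u u)"
    by (intro sum.cong refl eq) simp
  finally show ?thesis ..
qed

text \<open>The first moment vanishes, so only \<open>c \<ge> 2\<close> matters; there the factor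
  \<open>\<theta> * (1 / \<theta>) ^ (c - 1) \<ge> 1\<close> is free.  It rewards repeated edges, of which a walk with nonzero
  expectation has at least as many as new ones.\<close>

lemma bernoulli_moment_le:
  fixes q \<kappa> K \<theta> :: real
  assumes q: "q \<in> {0..1}" and \<kappa>: "0 < \<kappa>" "\<kappa> \<le> K" and \<theta>: "0 < \<theta>" "\<theta> \<le> 1" and c: "c \<ge> 1"
  shows "\<bar>q * ((1 - q) * \<kappa>) ^ c + (1 - q) * ((0 - q) * \<kappa>) ^ c\<bar>
    \<le> (\<theta> * (q * \<kappa>\<^sup>2) / K) * (K / \<theta>) ^ (c - 1)"
proof (cases "c = 1")
  case True
  then show ?thesis using assms by (simp add: algebra_simps)
next
  case False
  with c obtain j where j: "c = Suc (Suc j)" by (metis One_nat_def Suc_le_D not_less_eq_eq le_antisym)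
  have le1: "x ^ Suc j \<le> 1" if "0 \<le> x" "x \<le> 1" for x :: real
    using power_le_one[OF that] .
  have "\<bar>q * ((1 - q) * \<kappa>) ^ c + (1 - q) * ((0 - q) * \<kappa>) ^ c\<bar>
      \<le> q * ((1 - q) * \<kappa>) ^ c + (1 - q) * (q * \<kappa>) ^ c"
    using q \<kappa> by (intro order.trans[OF abs_triangle_ineq]) (auto simp: abs_mult power_abs)
  also have "\<dots> = q * \<kappa> ^ c * ((1 - q) * (1 - q) ^ Suc j + (1 - q) * q ^ Suc j)"
  proof -
    have "q * (r * \<kappa>) ^ c + r * (q * \<kappa>) ^ c = q * \<kappa> ^ c * (r * r ^ Suc j + r * q ^ Suc j)" for r
      by (simp add: j power_mult_distrib algebra_simps)
    then show ?thesis .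
  qed
  also have "\<dots> \<le> q * \<kappa> ^ c * ((1 - q) * 1 + q * 1)"
  proof (intro mult_left_mono add_mono)
    show "(1 - q) * q ^ Suc j \<le> q * 1"
      using q by (simp add: mult.left_commute mult_left_le power_le_one mult_le_one)
    show "(1 - q) ^ Suc j \<le> 1"
      using q by (intro le1) auto
  qed (use q \<kappa> in auto)
  also have "\<dots> = q * \<kappa>\<^sup>2 * \<kappa> ^ j" by (simp add: j power2_eq_square)
  also have "\<dots> \<le> q * \<kappa>\<^sup>2 * (K / \<theta>) ^ j"
  proof (intro mult_left_mono power_mono)
    have "\<kappa> * \<theta> \<le> K * 1" using \<kappa> \<theta> by (intro mult_mono) auto
    then show "\<kappa> \<le> K / \<theta>" using \<theta> by (simp add: pos_le_divide_eq)
  qed (use q \<kappa> in auto)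
  also have "\<dots> = (\<theta> * (q * \<kappa>\<^sup>2) / K) * (K / \<theta>) ^ (c - 1)"
    using \<kappa> \<theta> by (simp add: j)
  finally show ?thesis .
qed

section \<open>Expected trace powers of the normalized noise\<close>

context edge_independent_graph
begin

definition normalized_noise :: "(nat \<Rightarrow> real) \<Rightarrow> 'a \<Rightarrow> nat \<Rightarrow> nat \<Rightarrow> real" where
  "normalized_noise d w u v = (of_bool (E w u v) - p u v) / (sqrt (d u) * sqrt (d v))"

text \<open>The expectation factors over distinct edges, and \<open>bernoulli_moment_le\<close>
  bounds each factor, with \<open>\<kappa>\<close> the normalization of the edge and
  \<open>K = 1 / dm\<close>. Both weights originate there: \<open>K / \<theta>\<close> is the weight
  of a repetition.\<close>

lemma expectation_walk_prod_le:
  assumes dm: "dm > 0" "\<And>v. v < n \<Longrightarrow> d v \<ge> dm" and \<theta>: "0 < \<theta>" "\<theta> \<le> 1"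
    and ws: "ws \<in> walks n L"
  shows "\<bar>expectation (\<lambda>w. walk_prod (normalized_noise d w) ws)\<bar>
    \<le> first_visit_weight (\<lambda>e. \<theta> * (p (fst e) (snd e) / (d (fst e) * d (snd e))) * dm) (1 / (dm * \<theta>)) (walk_edges ws)"
    (is "_ \<le> first_visit_weight ?a ?b ?es")
proof -
  define \<kappa> where "\<kappa> e = 1 / (sqrt (d (fst e)) * sqrt (d (snd e)))" for e
  define F where "F e x = ((of_bool x - p (fst e) (snd e)) * \<kappa> e) ^ count_list ?es e" for e x
  have set_ws: "set ws \<subseteq> {..<n}" using ws by (simp add: walks_def)
  note sub = set_walk_edges[OF set_ws]
  \<comment> \<open>Sorting \<open>u\<close> and \<open>v\<close> is harmless only for outcomes in
    the space, where \<open>E\<close> is symmetric.\<close>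
  have edge_eq: "normalized_noise d w u v
      = (of_bool (E w (fst (edge u v)) (snd (edge u v))) - p (fst (edge u v)) (snd (edge u v))) * \<kappa> (edge u v)"
    if "w \<in> space M" "u < n" "v < n" for w u v
    using that E_sym[of w u v] p_sym[of u v]
    by (auto simp: normalized_noise_def edge_def \<kappa>_def min_def max_def)
  have "expectation (\<lambda>w. walk_prod (normalized_noise d w) ws)
      = expectation (\<lambda>w. \<Prod>e\<in>set ?es. F e (E w (fst e) (snd e)))"
  proof (rule Bochner_Integration.integral_cong[OF refl])
    fix w assume "w \<in> space M"
    from walk_prod_edges[where Y = "\<lambda>e. (of_bool (E w (fst e) (snd e)) - p (fst e) (snd e)) * \<kappa> e", OF edge_eq[OF this] set_ws]
    show "walk_prod (normalized_noise d w) ws = (\<Prod>e\<in>set ?es. F e (E w (fst e) (snd e)))"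
      by (simp add: F_def)
  qed
  also have "\<dots> = (\<Prod>e\<in>set ?es. p (fst e) (snd e) * F e True + (1 - p (fst e) (snd e)) * F e False)"
    by (rule expectation_prod_edges[OF sub])
  finally have "\<bar>expectation (\<lambda>w. walk_prod (normalized_noise d w) ws)\<bar>
      = (\<Prod>e\<in>set ?es. \<bar>p (fst e) (snd e) * F e True + (1 - p (fst e) (snd e)) * F e False\<bar>)"
    by (simp add: abs_prod)
  also have "\<dots> \<le> (\<Prod>e\<in>set ?es. ?a e * ?b ^ (count_list ?es e - 1))"
  proof (intro prod_mono conjI)
    fix e assume e: "e \<in> set ?es"
    then have bounds: "fst e < n" "snd e < n" using sub by (auto simp: upper_pairs_def)
    note d = dm(2)[OF bounds(1)] dm(2)[OF bounds(2)]
    have pos: "d (fst e) > 0" "d (snd e) > 0" using d dm(1) by linarith+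
    have "dm = sqrt dm * sqrt dm" using dm by simp
    also have "\<dots> \<le> sqrt (d (fst e)) * sqrt (d (snd e))"
      using d dm(1) by (intro mult_mono) auto
    finally have \<kappa>_le: "\<kappa> e \<le> 1 / dm"
      unfolding \<kappa>_def using dm(1) by (intro divide_left_mono) (auto intro: mult_pos_pos pos)
    have \<kappa>_sq: "(\<kappa> e)\<^sup>2 = 1 / (d (fst e) * d (snd e))"
      using pos by (simp add: \<kappa>_def power_divide power_mult_distrib)
    have "count_list ?es e \<ge> 1" using e count_list_0_iff[of ?es e] by (simp add: Suc_le_eq)
    from bernoulli_moment_le[OF p_range[OF bounds] _ \<kappa>_le \<theta> this]
    have "\<bar>p (fst e) (snd e) * F e True + (1 - p (fst e) (snd e)) * F e False\<bar>
      \<le> \<theta> * (p (fst e) (snd e) * (\<kappa> e)\<^sup>2) / (1 / dm) * (1 / dm / \<theta>) ^ (count_list ?es e - 1)"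
      using pos unfolding F_def by (simp add: \<kappa>_def)
    then show "\<bar>p (fst e) (snd e) * F e True + (1 - p (fst e) (snd e)) * F e False\<bar>
        \<le> ?a e * ?b ^ (count_list ?es e - 1)"
      unfolding \<kappa>_sq by simp
  qed simp
  also have "\<dots> = first_visit_weight ?a ?b ?es"
    by (rule first_visit_weight_eq[symmetric])
  finally show ?thesis .
qed

lemma normalized_noise_edge_set:
  "u < n \<Longrightarrow> v < n \<Longrightarrow> normalized_noise d w u v = (of_bool ((u, v) \<in> edge_set w) - p u v) / (sqrt (d u) * sqrt (d v))"
  by (simp add: normalized_noise_def edge_set_def)

lemma normalized_noise_sym:
  "w \<in> space M \<Longrightarrow> u < n \<Longrightarrow> v < n \<Longrightarrow> normalized_noise d w u v = normalized_noise d w v u"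
  using E_sym[of w u v] p_sym[of u v] by (simp add: normalized_noise_def mult.commute)

lemma integrable_walk_prod:
  assumes "ws \<in> walks n L"
  shows "integrable M (\<lambda>w. walk_prod (normalized_noise d w) ws)"
  by (rule integrable_edge_set[where g = "\<lambda>S. walk_prod (\<lambda>u v. (of_bool ((u, v) \<in> S) - p u v) / (sqrt (d u) * sqrt (d v))) ws"])
     (rule walk_prod_cong[where n = n], use assms in \<open>auto simp: normalized_noise_edge_set walks_def\<close>)

lemma integrable_trace_noise:
  "integrable M (\<lambda>w. \<Sum>u<n. mpow n (normalized_noise d w) L u u)"
  unfolding trace_mpow_walks
  by (intro Bochner_Integration.integrable_sum integrable_mult_right integrable_walk_prod)

lemma expectation_trace_noise_le:
  fixes d :: "nat \<Rightarrow> real"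
  assumes d: "\<And>v. v < n \<Longrightarrow> d v = (\<Sum>u<n. p u v)"
    and dm: "dm > 0" "\<And>v. v < n \<Longrightarrow> d v \<ge> dm"
    and m: "m \<ge> 1" "2 * real m \<le> dm"
  shows "expectation (\<lambda>w. \<Sum>u<n. mpow n (normalized_noise d w) (2 * m) u u) \<le> real n * (8 * real m / dm) ^ m"
proof -
  \<comment> \<open>This value balances the two kinds of step: new edges at a vertex weigh at most
    \<open>\<theta>\<close>, and \<open>2 * m\<close> visited edges of weight
    \<open>1 / (dm * \<theta>)\<close> weigh exactly \<open>\<theta>\<close>. The hypothesis
    \<open>2 * m \<le> dm\<close> is \<open>\<theta> \<le> 1\<close>.\<close>
  define \<theta> where "\<theta> = sqrt (2 * real m / dm)"
  have \<theta>: "0 < \<theta>" "\<theta> \<le> 1" using m dm by (auto simp: \<theta>_def)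
  have \<theta>_sq: "\<theta> * \<theta> = 2 * real m / dm" using m dm by (simp add: \<theta>_def)
  define a where "a e = \<theta> * (p (fst e) (snd e) / (d (fst e) * d (snd e))) * dm" for e
  have pos: "d v > 0" if "v < n" for v using dm(1) dm(2)[OF that] by linarith
  have a_nonneg: "a e \<ge> 0" if "e \<in> upper_pairs n" for e
  proof -
    have "fst e < n" "snd e < n" using that by (auto simp: upper_pairs_def)
    then show ?thesis
      using \<theta> dm(1) pos[of "fst e"] pos[of "snd e"] p_range[of "fst e" "snd e"] by (simp add: a_def)
  qed
  have new: "(\<Sum>u<n. a (edge u v)) \<le> \<theta>" if v: "v < n" for v
  proof -
    have "(\<Sum>u<n. a (edge u v)) \<le> (\<Sum>u<n. \<theta> * (p u v / d v))"
    proof (rule sum_mono)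
      fix u assume "u \<in> {..<n}"
      then have u: "u < n" by simp
      have "a (edge u v) = \<theta> * (p u v / (d u * d v)) * dm"
        using p_sym[OF u v] by (auto simp: a_def edge_def min_def max_def mult.commute)
      also have "\<dots> = \<theta> * (p u v / d v) * (dm / d u)" by simp
      also have "\<dots> \<le> \<theta> * (p u v / d v) * 1"
        using \<theta> p_range[OF u v] pos[OF v] pos[OF u] dm(2)[OF u] by (intro mult_left_mono) auto
      finally show "a (edge u v) \<le> \<theta> * (p u v / d v)" by simp
    qed
    also have "\<dots> = \<theta> * ((\<Sum>u<n. p u v) / d v)"
      by (simp add: sum_distrib_left sum_divide_distrib)
    also have "\<dots> = \<theta>" using pos[OF v] d[OF v] by simp
    finally show ?thesis .
  qed
  have old: "real (2 * m) * (1 / (dm * \<theta>)) \<le> \<theta>"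
    using \<theta> dm(1) \<theta>_sq by (simp add: field_simps)
  have "expectation (\<lambda>w. \<Sum>u<n. mpow n (normalized_noise d w) (2 * m) u u)
      = (\<Sum>ws\<in>walks n (2 * m). of_bool (hd ws = last ws) * expectation (\<lambda>w. walk_prod (normalized_noise d w) ws))"
    unfolding trace_mpow_walks
    by (subst Bochner_Integration.integral_sum) (auto intro: integrable_walk_prod)
  \<comment> \<open>Open walks are added: their weights are nonnegative, and the stepwise bound
    treats all walks alike.\<close>
  also have "\<dots> \<le> (\<Sum>ws\<in>walks n (2 * m). first_visit_weight a (1 / (dm * \<theta>)) (walk_edges ws))"
  proof (rule sum_mono)
    fix ws assume "ws \<in> walks n (2 * m)"
    from expectation_walk_prod_le[OF dm \<theta> this]
    have le: "\<bar>expectation (\<lambda>w. walk_prod (normalized_noise d w) ws)\<bar>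
        \<le> first_visit_weight a (1 / (dm * \<theta>)) (walk_edges ws)"
      by (simp add: a_def[abs_def])
    then show "of_bool (hd ws = last ws) * expectation (\<lambda>w. walk_prod (normalized_noise d w) ws)
        \<le> first_visit_weight a (1 / (dm * \<theta>)) (walk_edges ws)"
      by (cases "hd ws = last ws") auto
  qed
  also have "\<dots> \<le> real n * (2 * \<theta>) ^ (2 * m)"
    using \<theta> dm(1) by (intro sum_first_visit_weight_le[OF a_nonneg _ new old]) auto
  also have "(2 * \<theta>) ^ (2 * m) = (4 * (\<theta> * \<theta>)) ^ m"
    by (simp add: power_mult power2_eq_square)
  finally show ?thesis by (simp add: \<theta>_sq)
qed

text \<open>Markov applies since the trace of an even power is a squared Frobenius norm. Stating the
  event through the trace instead of the operator norm keeps its measurability elementary.\<close>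

lemma noise_norm_tail:
  fixes d :: "nat \<Rightarrow> real"
  assumes d: "\<And>v. v < n \<Longrightarrow> d v = (\<Sum>u<n. p u v)"
    and dm: "dm > 0" "\<And>v. v < n \<Longrightarrow> d v \<ge> dm"
    and m: "m \<ge> 1" "2 * real m \<le> dm" and c: "c > 0"
  shows "prob {w \<in> space M. c ^ (2 * m) \<le> (\<Sum>u<n. mpow n (normalized_noise d w) (2 * m) u u)}
    \<le> real n * (8 * real m / (dm * c\<^sup>2)) ^ m"
proof -
  let ?Z = "\<lambda>w. \<Sum>u<n. mpow n (normalized_noise d w) (2 * m) u u"
  have "?Z w \<ge> 0" if "w \<in> space M" for w
  proof -
    have "0 \<le> (\<Sum>u<n. \<Sum>v<n. (mpow n (normalized_noise d w) m u v)\<^sup>2)"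
      by (intro sum_nonneg) simp
    also have "\<dots> = ?Z w"
      by (rule mpow_frobenius) (rule normalized_noise_sym[OF that])
    finally show ?thesis .
  qed
  then have "prob {w \<in> space M. ?Z w \<ge> c ^ (2 * m)} \<le> expectation ?Z / c ^ (2 * m)"
    using integrable_trace_noise c
    by (intro integral_Markov_inequality_measure[where A = "{}"]) auto
  also have "\<dots> \<le> real n * (8 * real m / dm) ^ m / c ^ (2 * m)"
    using c by (intro divide_right_mono expectation_trace_noise_le[OF d dm m]) auto
  also have "\<dots> = real n * (8 * real m / (dm * c\<^sup>2)) ^ m"
    by (simp add: power_divide power_mult_distrib power_mult)
  finally show ?thesis .
qed

end

section \<open>Perturbation of a weighted graph\<close>

lemma mat_apply_add: "mat_apply n B (\<lambda>v. x v + y v) u = mat_apply n B x u + mat_apply n B y u"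
  by (simp add: mat_apply_def algebra_simps sum.distrib)

lemma mat_apply_diff: "mat_apply n B (\<lambda>v. x v - y v) u = mat_apply n B x u - mat_apply n B y u"
  by (simp add: mat_apply_def algebra_simps sum_subtractf)

lemma mat_apply_scale: "mat_apply n B (\<lambda>v. c * x v) u = c * mat_apply n B x u"
  by (simp add: mat_apply_def sum_distrib_left mult_ac)

lemma op_boundD: "op_bound n B c \<Longrightarrow> nrm n (mat_apply n B y) \<le> c * nrm n y"
  by (simp add: op_bound_def)

lemma op_bound_mono: "op_bound n B c \<Longrightarrow> c \<le> c' \<Longrightarrow> op_bound n B c'"
  unfolding op_bound_def by (meson mult_right_mono nrm_nonneg order_trans)

lemma op_bound_funpow:
  assumes "op_bound n B c" "c \<ge> 0"
  shows "nrm n ((mat_apply n B ^^ k) y) \<le> c ^ k * nrm n y"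
proof (induction k)
  case (Suc k)
  have "nrm n ((mat_apply n B ^^ Suc k) y) \<le> c * nrm n ((mat_apply n B ^^ k) y)"
    using op_boundD[OF assms(1)] by simp
  also have "\<dots> \<le> c * (c ^ k * nrm n y)" by (intro mult_left_mono Suc assms(2))
  finally show ?case by simp
qed simp

text \<open>Telescoping: \<open>A^k t - t B^k\<close> is a sum of \<open>k\<close> terms
  \<open>A^i (A t - t B) B^j\<close> with \<open>i + j = k - 1\<close>, each of norm at most
  \<open>r^(k-1) * g\<close>.\<close>

lemma nrm_funpow_intertwine_le:
  assumes A: "op_bound n A r" and B: "op_bound n B r" and r: "r \<ge> 0"
    and G: "\<And>y. nrm n (\<lambda>u. mat_apply n A (\<lambda>v. t v * y v) u - t u * mat_apply n B y u) \<le> g * nrm n y" and g: "g \<ge> 0"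
  shows "nrm n (\<lambda>u. (mat_apply n A ^^ k) (\<lambda>v. t v * y v) u - t u * (mat_apply n B ^^ k) y u)
    \<le> real k * r ^ (k - 1) * g * nrm n y"
proof (induction k)
  case 0
  then show ?case by (simp add: nrm_def L2_set_def)
next
  case (Suc k)
  let ?a = "(mat_apply n A ^^ k) (\<lambda>v. t v * y v)" and ?b = "(mat_apply n B ^^ k) y"
  have "nrm n (\<lambda>u. (mat_apply n A ^^ Suc k) (\<lambda>v. t v * y v) u - t u * (mat_apply n B ^^ Suc k) y u)
      = nrm n (\<lambda>u. mat_apply n A (\<lambda>v. ?a v - t v * ?b v) u + (mat_apply n A (\<lambda>v. t v * ?b v) u - t u * mat_apply n B ?b u))"
    by (simp add: mat_apply_diff)
  also have "\<dots> \<le> nrm n (mat_apply n A (\<lambda>v. ?a v - t v * ?b v))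
      + nrm n (\<lambda>u. mat_apply n A (\<lambda>v. t v * ?b v) u - t u * mat_apply n B ?b u)"
    by (rule nrm_add)
  also have "\<dots> \<le> r * (real k * r ^ (k - 1) * g * nrm n y) + g * (r ^ k * nrm n y)"
  proof (rule add_mono)
    show "nrm n (mat_apply n A (\<lambda>v. ?a v - t v * ?b v)) \<le> r * (real k * r ^ (k - 1) * g * nrm n y)"
      using op_boundD[OF A] mult_left_mono[OF Suc r] by (rule order_trans)
    show "nrm n (\<lambda>u. mat_apply n A (\<lambda>v. t v * ?b v) u - t u * mat_apply n B ?b u) \<le> g * (r ^ k * nrm n y)"
      using G mult_left_mono[OF op_bound_funpow[OF B r] g] by (rule order_trans)
  qed
  \<comment> \<open>At \<open>k = 0\<close> natural subtraction turns \<open>k - 1\<close> into 0,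
    but there the factor \<open>real k\<close> vanishes.\<close>
  also have "\<dots> = real (Suc k) * r ^ (Suc k - 1) * g * nrm n y"
    by (cases k) (simp_all add: algebra_simps)
  finally show ?case .
qed

section \<open>Splitting off the stationary distribution\<close>

context weighted_graph
begin

text \<open>The rank-one part removed in \<open>centered_op\<close>, named because those of the two
  graphs have to be compared.\<close>

definition stationary_op :: "nat \<Rightarrow> nat \<Rightarrow> real" where
  "stationary_op u v = sqrt (d u) * sqrt (d v) / vol"

lemma nrm_sqrt_degree: "nrm n (\<lambda>v. sqrt (d v)) = sqrt vol"
proof (rule power2_eq_imp_eq)
  have "(\<Sum>v<n. (sqrt (d v))\<^sup>2) = (\<Sum>v<n. d v)"
    by (rule sum.cong) (use deg_pos in \<open>simp_all add: less_imp_le\<close>)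
  then show "(nrm n (\<lambda>v. sqrt (d v)))\<^sup>2 = (sqrt vol)\<^sup>2"
    using vol_pos by (simp add: nrm_sq volume_def)
qed (use vol_pos in simp_all)

lemma stationary_op_bound: "op_bound n stationary_op 1"
  unfolding op_bound_def
proof
  fix y
  let ?s = "\<lambda>v. sqrt (d v)"
  have sq: "sqrt vol * sqrt vol = vol" "sqrt vol > 0" using vol_pos by simp_all
  have inner: "\<bar>\<Sum>v<n. ?s v * y v\<bar> \<le> sqrt vol * nrm n y"
    using inner_le_nrm[of ?s y n] inner_le_nrm[of ?s "\<lambda>v. - y v" n] nrm_scale[of n "-1" y]
    by (simp add: nrm_sqrt_degree sum_negf abs_le_iff)
  have "mat_apply n stationary_op y = (\<lambda>u. ((\<Sum>v<n. ?s v * y v) / vol) * ?s u)"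
    by (rule ext) (simp add: mat_apply_def stationary_op_def sum_distrib_left sum_distrib_right sum_divide_distrib mult_ac)
  then have "nrm n (mat_apply n stationary_op y) = \<bar>(\<Sum>v<n. ?s v * y v) / vol\<bar> * sqrt vol"
    by (simp only: nrm_scale nrm_sqrt_degree)
  also have "\<dots> = \<bar>\<Sum>v<n. ?s v * y v\<bar> / vol * sqrt vol"
    using vol_pos by simp
  also have "\<dots> \<le> sqrt vol * nrm n y / vol * sqrt vol"
    using inner vol_pos by (intro mult_right_mono divide_right_mono) auto
  also have "\<dots> = 1 * nrm n y"
    using sq vol_pos by (simp add: field_simps)
  finally show "nrm n (mat_apply n stationary_op y) \<le> 1 * nrm n y" .
qed

text \<open>The identity \<open>W = D^(1/2) B D^(-1/2) + \<pi> 1^T\<close> applied to a vector: the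
  stationary part sees only the total mass.\<close>

lemma mat_apply_walk_op_centered:
  assumes u: "u < n"
  shows "mat_apply n (walk_op n a) y u
    = sqrt (d u) * mat_apply n (centered_op n a) (\<lambda>v. y v / sqrt (d v)) u + d u / vol * (\<Sum>v<n. y v)"
proof -
  have s: "sqrt (d u) * sqrt (d u) = d u" "sqrt (d u) > 0" using deg_pos[OF u] by simp_all
  have "sqrt (d u) * mat_apply n (centered_op n a) (\<lambda>v. y v / sqrt (d v)) u
      = (\<Sum>v<n. walk_op n a u v * y v - d u / vol * y v)"
    unfolding mat_apply_def sum_distrib_left
  proof (rule sum.cong)
    fix v assume "v \<in> {..<n}"
    then have v: "v < n" "sqrt (d v) > 0" using deg_pos[of v] by simp_all
    have alg: "su * ((w * sv / su - su * sv / c) * (z / sv)) = w * z - D / c * z"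
      if "su \<noteq> 0" "sv \<noteq> 0" "D = su * su" for su sv w c z D :: real
      using that by (simp add: field_simps)
    show "sqrt (d u) * (centered_op n a u v * (y v / sqrt (d v))) = walk_op n a u v * y v - d u / vol * y v"
      unfolding centered_op_eq[OF u v(1)] using s v by (intro alg) auto
  qed simp
  then show ?thesis by (simp add: mat_apply_def sum_subtractf sum_distrib_left)
qed

text \<open>Applied to \<open>d\<close>, the stationary term alone already gives \<open>d u\<close>,
  so nothing is left for the centered one.\<close>

lemma mat_apply_centered_op_sqrt_degree:
  assumes u: "u < n"
  shows "mat_apply n (centered_op n a) (\<lambda>v. sqrt (d v)) u = 0"
proof -
  have "mat_apply n (walk_op n a) d u = sqrt (d u) * mat_apply n (centered_op n a) (\<lambda>v. d v / sqrt (d v)) u + d u / vol * vol"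
    unfolding mat_apply_walk_op_centered[OF u] volume_def ..
  moreover have "mat_apply n (walk_op n a) d u = d u"
    using walk_op_stationary[OF u] by (simp add: mat_apply_def)
  moreover have "mat_apply n (centered_op n a) (\<lambda>v. d v / sqrt (d v)) = mat_apply n (centered_op n a) (\<lambda>v. sqrt (d v))"
    by (rule mat_apply_cong) (simp add: real_div_sqrt deg_pos less_imp_le)
  ultimately show ?thesis using vol_pos deg_pos[OF u] by simp
qed

text \<open>Total mass is preserved, so each step adds the same stationary term, while the centered
  operator annihilates the one carried over, which after rescaling is a multiple of the square roots
  of the degrees. The decomposition begins after one step.\<close>

lemma funpow_walk_op_centered:
  assumes x: "(\<Sum>v<n. x v) = 1"
  shows "u < n \<Longrightarrow> (mat_apply n (walk_op n a) ^^ Suc k) x u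
    = d u / vol + sqrt (d u) * (mat_apply n (centered_op n a) ^^ Suc k) (\<lambda>v. x v / sqrt (d v)) u"
proof (induction k arbitrary: u)
  case 0
  then show ?case by (simp add: mat_apply_walk_op_centered x)
next
  case (Suc k)
  let ?y = "(mat_apply n (walk_op n a) ^^ Suc k) x" and ?q = "(mat_apply n (centered_op n a) ^^ Suc k) (\<lambda>v. x v / sqrt (d v))"
  have "(\<Sum>v<n. (mat_apply n (walk_op n a) ^^ j) x v) = 1" for j
    by (induction j) (simp_all add: x walk_op_mat_apply_col_sum)
  then have sum: "(\<Sum>v<n. ?y v) = 1" .
  have "mat_apply n (centered_op n a) (\<lambda>v. ?y v / sqrt (d v)) u
      = mat_apply n (centered_op n a) (\<lambda>v. (1 / vol) * sqrt (d v) + ?q v) u"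
  proof (rule fun_cong[OF mat_apply_cong])
    fix v assume v: "v < n"
    have alg: "(D / c + s * q) / s = (1 / c) * s + q" if "s \<noteq> 0" "D = s * s" for D c s q :: real
      using that by (simp add: add_divide_distrib)
    show "?y v / sqrt (d v) = (1 / vol) * sqrt (d v) + ?q v"
      unfolding Suc.IH[OF v] using deg_pos[OF v] by (intro alg) simp_all
  qed
  also have "\<dots> = mat_apply n (centered_op n a) ?q u"
    unfolding mat_apply_add mat_apply_scale mat_apply_centered_op_sqrt_degree[OF Suc.prems] by simp
  finally show ?case
    using mat_apply_walk_op_centered[OF Suc.prems, of ?y] sum by simp
qed

end

text \<open>The deterministic half: \<open>a\<close> is a realized graph, \<open>p\<close> its mean.
  The bound \<open>\<eta> \<le> 1 / 4\<close> keeps the degree ratios away from 0.\<close>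

locale graph_perturbation = G: weighted_graph n a + H: weighted_graph n p
  for n :: nat and a p :: "nat \<Rightarrow> nat \<Rightarrow> real" +
  fixes \<eta> \<epsilon> lam :: real
  assumes \<eta>: "0 \<le> \<eta>" "\<eta> \<le> 1 / 4"
    and deg_close: "\<And>v. v < n \<Longrightarrow> \<bar>col_sum n a v - col_sum n p v\<bar> \<le> \<eta> * col_sum n p v"
    and vol_close: "\<bar>volume n a - volume n p\<bar> \<le> \<eta> * volume n p"
    and noise: "op_bound n (\<lambda>u v. (a u v - p u v) / (sqrt (col_sum n p u) * sqrt (col_sum n p v))) \<epsilon>"
    and \<epsilon>: "0 \<le> \<epsilon>"
    and gap: "op_bound n (centered_op n p) lam" "0 \<le> lam" "lam \<le> 1"
begin

definition T :: "nat \<Rightarrow> real" where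
  "T v = sqrt (col_sum n a v) / sqrt (col_sum n p v)"

lemma sqrt_degree: "v < n \<Longrightarrow> sqrt (col_sum n a v) = T v * sqrt (col_sum n p v)"
  using H.deg_pos[of v] by (simp add: T_def)

lemma T_bounds:
  assumes v: "v < n"
  shows "\<bar>(T v)\<^sup>2 - 1\<bar> \<le> \<eta>" "3 / 4 \<le> T v" "T v \<le> 5 / 4" "\<bar>T v - 1\<bar> \<le> \<eta>"
proof -
  have pos: "T v > 0" using G.deg_pos[OF v] H.deg_pos[OF v] by (simp add: T_def)
  have "(T v)\<^sup>2 = col_sum n a v / col_sum n p v"
    using G.deg_pos[OF v] H.deg_pos[OF v] by (simp add: T_def power_divide)
  then have "(T v)\<^sup>2 - 1 = (col_sum n a v - col_sum n p v) / col_sum n p v"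
    using H.deg_pos[OF v] by (simp add: diff_divide_distrib)
  then have "\<bar>(T v)\<^sup>2 - 1\<bar> = \<bar>col_sum n a v - col_sum n p v\<bar> / col_sum n p v"
    using H.deg_pos[OF v] by simp
  also have "\<dots> \<le> \<eta>" using deg_close[OF v] H.deg_pos[OF v] by (simp add: pos_divide_le_eq)
  finally show sq: "\<bar>(T v)\<^sup>2 - 1\<bar> \<le> \<eta>" .
  have "(3 / 4)\<^sup>2 \<le> (T v)\<^sup>2" using sq \<eta> by (simp add: power_divide abs_le_iff)
  then show "3 / 4 \<le> T v" by (rule power2_le_imp_le) (use pos in simp)
  have "(T v)\<^sup>2 \<le> (5 / 4)\<^sup>2" using sq \<eta> by (simp add: power_divide abs_le_iff)
  then show "T v \<le> 5 / 4" by (rule power2_le_imp_le) simp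
  \<comment> \<open>The factor \<open>T v + 1 \<ge> 1\<close> passes the bound from the square to
    \<open>T v\<close> without loss.\<close>
  have "\<bar>T v - 1\<bar> * 1 \<le> \<bar>T v - 1\<bar> * (T v + 1)" using pos by (intro mult_left_mono) auto
  also have "\<dots> = \<bar>(T v)\<^sup>2 - 1\<bar>"
  proof -
    have "(T v)\<^sup>2 - 1 = (T v - 1) * (T v + 1)" by (simp add: power2_eq_square algebra_simps)
    then have "\<bar>(T v)\<^sup>2 - 1\<bar> = \<bar>T v - 1\<bar> * \<bar>T v + 1\<bar>" by (simp only: abs_mult)
    then show ?thesis using pos by simp
  qed
  finally show "\<bar>T v - 1\<bar> \<le> \<eta>" using sq by simp
qed

lemma T_inverse_bounds:
  assumes v: "v < n"
  shows "0 < T v" "\<bar>1 / T v\<bar> \<le> 2" "\<bar>1 / T v - T v\<bar> \<le> 2 * \<eta>" "\<bar>1 / T v\<bar> \<le> 1 + 2 * \<eta>"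
    "\<bar>T v * volume n p / volume n a - 1 / T v\<bar> \<le> 4 * \<eta>"
proof -
  note T = T_bounds[OF v]
  show pos: "0 < T v" using T(2) by linarith
  show "\<bar>1 / T v\<bar> \<le> 2" using pos T(2) by (simp add: pos_divide_le_eq)
  have "1 / T v - T v = - (((T v)\<^sup>2 - 1) / T v)"
    using pos by (simp add: field_simps power2_eq_square)
  then have "\<bar>1 / T v - T v\<bar> = \<bar>(T v)\<^sup>2 - 1\<bar> / T v"
    using pos by (simp only: abs_minus_cancel abs_divide abs_of_pos)
  also have "\<dots> \<le> \<eta> / (1 / 2)" using T \<eta> pos by (intro frac_le) auto
  finally show "\<bar>1 / T v - T v\<bar> \<le> 2 * \<eta>" by simp
  \<comment> \<open>The product is \<open>1 + \<eta> - 2 * \<eta>^2\<close>.\<close>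
  have "1 \<le> (1 + 2 * \<eta>) * (1 - \<eta>)"
    using \<eta> mult_mono[of \<eta> "1 / 4" \<eta> \<eta>] by (simp add: algebra_simps)
  also have "\<dots> \<le> (1 + 2 * \<eta>) * T v" using T(4) \<eta> by (intro mult_left_mono) auto
  finally show "\<bar>1 / T v\<bar> \<le> 1 + 2 * \<eta>" using pos by (simp add: pos_divide_le_eq)
  have volp: "volume n p > 0" and vola: "volume n a > 0" by (rule H.vol_pos G.vol_pos)+
  have "3 / 4 * volume n p \<le> (1 - \<eta>) * volume n p" using \<eta> volp by (intro mult_right_mono) auto
  also have "\<dots> \<le> volume n a" using vol_close by (simp add: algebra_simps abs_le_iff)
  finally have vol34: "3 / 4 * volume n p \<le> volume n a" .
  have num: "\<bar>(T v)\<^sup>2 * volume n p - volume n a\<bar> \<le> 2 * \<eta> * volume n p"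
  proof -
    have "(T v)\<^sup>2 * volume n p - volume n a = ((T v)\<^sup>2 - 1) * volume n p - (volume n a - volume n p)"
      by (simp add: algebra_simps)
    also have "\<bar>\<dots>\<bar> \<le> \<bar>((T v)\<^sup>2 - 1) * volume n p\<bar> + \<bar>volume n a - volume n p\<bar>" by (rule abs_triangle_ineq4)
    also have "\<dots> \<le> \<eta> * volume n p + \<eta> * volume n p"
      using T(1) volp vol_close by (intro add_mono) (auto simp: abs_mult intro: mult_right_mono)
    finally show ?thesis by simp
  qed
  have "T v * volume n p / volume n a - 1 / T v = ((T v)\<^sup>2 * volume n p - volume n a) / (volume n a * T v)"
    using pos vola by (simp add: field_simps power2_eq_square)
  then have "\<bar>T v * volume n p / volume n a - 1 / T v\<bar> = \<bar>(T v)\<^sup>2 * volume n p - volume n a\<bar> / (volume n a * T v)"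
    using pos vola by (simp add: abs_mult)
  also have "\<dots> \<le> (2 * \<eta> * volume n p) / (volume n p * (1 / 2))"
  proof (intro frac_le num)
    have "volume n p * (9 / 16) = (3 / 4 * volume n p) * (3 / 4)" by simp
    also have "\<dots> \<le> volume n a * T v"
      using vol34 T(2) volp vola by (intro mult_mono) auto
    finally show "volume n p * (1 / 2) \<le> volume n a * T v" using volp by linarith
  qed (use \<eta> volp in auto)
  also have "\<dots> = 4 * \<eta>" using volp by simp
  finally show "\<bar>T v * volume n p / volume n a - 1 / T v\<bar> \<le> 4 * \<eta>" .
qed

text \<open>Three discrepancies add up: the noise, the normalizing degrees and the stationary
  projections. Entrywise they become the row-scaled noise, \<open>normalized_op\<close> times the
  diagonal \<open>1 / T - T\<close>, and a row-scaled \<open>stationary_op\<close>, contributing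
  \<open>2 * \<epsilon>\<close>, \<open>2 * \<eta>\<close> and \<open>4 * \<eta>\<close>.\<close>

lemma intertwining_defect:
  "nrm n (\<lambda>u. mat_apply n (centered_op n a) (\<lambda>v. (1 / T v) * y v) u - (1 / T u) * mat_apply n (centered_op n p) y u)
    \<le> (2 * \<epsilon> + 6 * \<eta>) * nrm n y"
proof -
  let ?X = "\<lambda>u v. (a u v - p u v) / (sqrt (col_sum n p u) * sqrt (col_sum n p v))"
  let ?c = "\<lambda>u. T u * volume n p / volume n a - 1 / T u"
  have entry: "centered_op n a u v * (1 / T v) - (1 / T u) * centered_op n p u v
      = (1 / T u) * ?X u v + normalized_op n a u v * (1 / T v - T v) - ?c u * H.stationary_op u v"
    if u: "u < n" and v: "v < n" for u v
  proof -
    have alg: "(A / ((tu * su) * (tv * sv)) - (tu * su) * (tv * sv) / V) * (1 / tv)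
          - (1 / tu) * (P / (su * sv) - su * sv / U)
        = (1 / tu) * ((A - P) / (su * sv)) + A / ((tu * su) * (tv * sv)) * (1 / tv - tv)
          - (tu * U / V - 1 / tu) * (su * sv / U)"
      if "tu \<noteq> 0" "tv \<noteq> 0" "su \<noteq> 0" "sv \<noteq> 0" "U \<noteq> 0" "V \<noteq> 0" for A P tu tv su sv U V :: real
      using that by (simp add: field_simps)
    show ?thesis
      unfolding centered_op_def normalized_op_def H.stationary_op_def sqrt_degree[OF u] sqrt_degree[OF v]
      using T_inverse_bounds(1)[OF u] T_inverse_bounds(1)[OF v] H.deg_pos[OF u] H.deg_pos[OF v] G.vol_pos H.vol_pos
      by (intro alg) auto
  qed
  have "nrm n (\<lambda>u. mat_apply n (centered_op n a) (\<lambda>v. (1 / T v) * y v) u - (1 / T u) * mat_apply n (centered_op n p) y u)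
      = nrm n (\<lambda>u. ((1 / T u) * mat_apply n ?X y u + mat_apply n (normalized_op n a) (\<lambda>v. (1 / T v - T v) * y v) u)
          - ?c u * mat_apply n H.stationary_op y u)"
  proof (rule nrm_cong)
    fix u assume u: "u < n"
    have "mat_apply n (centered_op n a) (\<lambda>v. (1 / T v) * y v) u - (1 / T u) * mat_apply n (centered_op n p) y u
        = (\<Sum>v<n. (centered_op n a u v * (1 / T v) - (1 / T u) * centered_op n p u v) * y v)"
      by (simp only: mat_apply_def sum_distrib_left sum_subtractf left_diff_distrib mult.assoc)
    also have "\<dots> = (\<Sum>v<n. ((1 / T u) * ?X u v + normalized_op n a u v * (1 / T v - T v) - ?c u * H.stationary_op u v) * y v)"
      by (intro sum.cong refl arg_cong2[of _ _ _ _ "(*)"] entry[OF u]) simp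
    also have "\<dots> = (1 / T u) * mat_apply n ?X y u + mat_apply n (normalized_op n a) (\<lambda>v. (1 / T v - T v) * y v) u
          - ?c u * mat_apply n H.stationary_op y u"
      by (simp only: mat_apply_def sum_distrib_left sum_subtractf sum.distrib left_diff_distrib distrib_right mult.assoc)
    finally show "mat_apply n (centered_op n a) (\<lambda>v. (1 / T v) * y v) u - (1 / T u) * mat_apply n (centered_op n p) y u
        = (1 / T u) * mat_apply n ?X y u + mat_apply n (normalized_op n a) (\<lambda>v. (1 / T v - T v) * y v) u
          - ?c u * mat_apply n H.stationary_op y u" .
  qed
  also have "\<dots> \<le> nrm n (\<lambda>u. (1 / T u) * mat_apply n ?X y u + mat_apply n (normalized_op n a) (\<lambda>v. (1 / T v - T v) * y v) u)
      + nrm n (\<lambda>u. ?c u * mat_apply n H.stationary_op y u)"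
    by (rule nrm_diff)
  also have "\<dots> \<le> (nrm n (\<lambda>u. (1 / T u) * mat_apply n ?X y u) + nrm n (mat_apply n (normalized_op n a) (\<lambda>v. (1 / T v - T v) * y v)))
      + nrm n (\<lambda>u. ?c u * mat_apply n H.stationary_op y u)"
    by (intro add_mono nrm_add order_refl)
  also have "\<dots> \<le> (2 * (\<epsilon> * nrm n y) + 2 * \<eta> * nrm n y) + 4 * \<eta> * nrm n y"
  proof (intro add_mono)
    have "nrm n (\<lambda>u. (1 / T u) * mat_apply n ?X y u) \<le> \<bar>2\<bar> * nrm n (mat_apply n ?X y)"
      by (rule nrm_mult_le) (rule T_inverse_bounds(2))
    also have "\<dots> \<le> 2 * (\<epsilon> * nrm n y)" using op_boundD[OF noise] by simp
    finally show "nrm n (\<lambda>u. (1 / T u) * mat_apply n ?X y u) \<le> 2 * (\<epsilon> * nrm n y)" .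
    have "nrm n (mat_apply n (normalized_op n a) (\<lambda>v. (1 / T v - T v) * y v)) \<le> 1 * nrm n (\<lambda>v. (1 / T v - T v) * y v)"
      by (rule op_boundD[OF G.normalized_op_bound])
    also have "\<dots> \<le> \<bar>2 * \<eta>\<bar> * nrm n y"
      unfolding mult_1 by (rule nrm_mult_le) (rule T_inverse_bounds(3))
    finally show "nrm n (mat_apply n (normalized_op n a) (\<lambda>v. (1 / T v - T v) * y v)) \<le> 2 * \<eta> * nrm n y"
      using \<eta> by simp
    have "nrm n (\<lambda>u. ?c u * mat_apply n H.stationary_op y u) \<le> \<bar>4 * \<eta>\<bar> * nrm n (mat_apply n H.stationary_op y)"
      by (rule nrm_mult_le) (rule T_inverse_bounds(5))
    also have "\<dots> \<le> \<bar>4 * \<eta>\<bar> * (1 * nrm n y)"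
      by (intro mult_left_mono op_boundD[OF H.stationary_op_bound]) simp
    finally show "nrm n (\<lambda>u. ?c u * mat_apply n H.stationary_op y u) \<le> 4 * \<eta> * nrm n y"
      using \<eta> by simp
  qed
  also have "\<dots> = (2 * \<epsilon> + 6 * \<eta>) * nrm n y" by (simp add: algebra_simps)
  finally show ?thesis .
qed

text \<open>The bound \<open>1 + \<eta> \<le> 2\<close> on \<open>T\<close> doubles the defect
  \<open>2 * \<epsilon> + 6 * \<eta>\<close>, and the distortion of \<open>lam\<close> by
  \<open>T\<close> on both sides adds \<open>4 * \<eta>\<close>.\<close>

definition rate :: real where
  "rate = lam + 4 * \<epsilon> + 16 * \<eta>"

lemma rate_nonneg: "rate \<ge> 0"
  using gap \<epsilon> \<eta> by (simp add: rate_def)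

text \<open>Writing \<open>y = T^(-1) (T y)\<close> exchanges the random operator for the mean one
  at the price of the defect.\<close>

lemma centered_op_bound_rate: "op_bound n (centered_op n a) rate"
  unfolding op_bound_def
proof
  fix y
  let ?Ty = "\<lambda>v. T v * y v"
  have "nrm n (mat_apply n (centered_op n a) y)
      = nrm n (\<lambda>u. (mat_apply n (centered_op n a) (\<lambda>v. (1 / T v) * ?Ty v) u - (1 / T u) * mat_apply n (centered_op n p) ?Ty u)
        + (1 / T u) * mat_apply n (centered_op n p) ?Ty u)"
  proof (rule nrm_cong)
    fix u assume "u < n"
    have "mat_apply n (centered_op n a) (\<lambda>v. (1 / T v) * ?Ty v) = mat_apply n (centered_op n a) y"
      by (rule mat_apply_cong) (use T_inverse_bounds(1) in \<open>force\<close>)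
    then show "mat_apply n (centered_op n a) y u
      = (mat_apply n (centered_op n a) (\<lambda>v. (1 / T v) * ?Ty v) u - (1 / T u) * mat_apply n (centered_op n p) ?Ty u)
        + (1 / T u) * mat_apply n (centered_op n p) ?Ty u" by simp
  qed
  also have "\<dots> \<le> nrm n (\<lambda>u. mat_apply n (centered_op n a) (\<lambda>v. (1 / T v) * ?Ty v) u - (1 / T u) * mat_apply n (centered_op n p) ?Ty u)
        + nrm n (\<lambda>u. (1 / T u) * mat_apply n (centered_op n p) ?Ty u)"
    by (rule nrm_add)
  also have "\<dots> \<le> (2 * \<epsilon> + 6 * \<eta>) * nrm n ?Ty + (1 + 2 * \<eta>) * (lam * nrm n ?Ty)"
  proof (rule add_mono[OF intertwining_defect])
    have "nrm n (\<lambda>u. (1 / T u) * mat_apply n (centered_op n p) ?Ty u) \<le> \<bar>1 + 2 * \<eta>\<bar> * nrm n (mat_apply n (centered_op n p) ?Ty)"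
      by (rule nrm_mult_le) (rule T_inverse_bounds(4))
    also have "\<dots> \<le> \<bar>1 + 2 * \<eta>\<bar> * (lam * nrm n ?Ty)"
      by (intro mult_left_mono op_boundD[OF gap(1)]) simp
    finally show "nrm n (\<lambda>u. (1 / T u) * mat_apply n (centered_op n p) ?Ty u) \<le> (1 + 2 * \<eta>) * (lam * nrm n ?Ty)"
      using \<eta> by simp
  qed
  also have "\<dots> = ((2 * \<epsilon> + 6 * \<eta>) + (1 + 2 * \<eta>) * lam) * nrm n ?Ty" by (simp add: algebra_simps)
  also have "\<dots> \<le> ((2 * \<epsilon> + 6 * \<eta>) + (1 + 2 * \<eta>) * lam) * ((1 + \<eta>) * nrm n y)"
  proof (rule mult_left_mono)
    have "\<bar>T v\<bar> \<le> 1 + \<eta>" if "v < n" for v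
      using T_bounds(4)[OF that] T_inverse_bounds(1)[OF that] by simp
    then have "nrm n ?Ty \<le> \<bar>1 + \<eta>\<bar> * nrm n y" by (rule nrm_mult_le)
    then show "nrm n ?Ty \<le> (1 + \<eta>) * nrm n y" using \<eta> by simp
  qed (use \<epsilon> \<eta> gap in simp)
  also have "\<dots> = (((2 * \<epsilon> + 6 * \<eta>) + (1 + 2 * \<eta>) * lam) * (1 + \<eta>)) * nrm n y" by simp
  also have "\<dots> \<le> rate * nrm n y"
  proof (rule mult_right_mono)
    have "(2 * \<epsilon> + 6 * \<eta>) * (1 + \<eta>) \<le> (2 * \<epsilon> + 6 * \<eta>) * 2"
      using \<epsilon> \<eta> by (intro mult_left_mono) auto
    moreover have "(1 + 2 * \<eta>) * (1 + \<eta>) \<le> 1 + 4 * \<eta>"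
      using \<eta> mult_mono[of \<eta> "1 / 4" \<eta> \<eta>] by (simp add: algebra_simps)
    then have "(1 + 2 * \<eta>) * (1 + \<eta>) * lam \<le> (1 + 4 * \<eta>) * lam"
      using gap by (intro mult_right_mono)
    moreover have "4 * \<eta> * lam \<le> 4 * \<eta> * 1" using \<eta> gap by (intro mult_left_mono) auto
    ultimately show "((2 * \<epsilon> + 6 * \<eta>) + (1 + 2 * \<eta>) * lam) * (1 + \<eta>) \<le> rate"
      by (simp add: rate_def algebra_simps)
  qed simp
  finally show "nrm n (mat_apply n (centered_op n a) y) \<le> rate * nrm n y" .
qed

text \<open>Each walk is its stationary part plus a conjugated centered power. The outer square root
  of the random graph is \<open>T\<close> times the mean one; factoring it out leaves the
  intertwining difference. The outer factor costs \<open>2 * sqrt dM\<close>, the inner one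
  \<open>1 / sqrt dm\<close>.\<close>

lemma landing_difference:
  assumes x: "(\<Sum>v<n. x v) = 1"
    and dm: "0 < dm" "\<And>v. v < n \<Longrightarrow> dm \<le> col_sum n p v" "\<And>v. v < n \<Longrightarrow> col_sum n p v \<le> dM"
  shows "nrm n (\<lambda>u. (mat_apply n (walk_op n a) ^^ Suc k) x u - (mat_apply n (walk_op n p) ^^ Suc k) x u)
    \<le> nrm n (\<lambda>u. col_sum n a u / volume n a - col_sum n p u / volume n p)
      + 2 * sqrt dM * (real (Suc k) * rate ^ k * (2 * \<epsilon> + 6 * \<eta>) * (nrm n x / sqrt dm))"
proof -
  let ?s = "\<lambda>v. sqrt (col_sum n p v)"
  let ?z = "\<lambda>v. x v / ?s v"
  let ?F = "\<lambda>u. (mat_apply n (centered_op n a) ^^ Suc k) (\<lambda>v. (1 / T v) * ?z v) u - (1 / T u) * (mat_apply n (centered_op n p) ^^ Suc k) ?z u"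
  have s: "?s v > 0" if "v < n" for v using H.deg_pos[OF that] by simp
  have dM: "dM > 0" using dm(1) dm(2)[OF H.n_pos] dm(3)[OF H.n_pos] by linarith
  have start: "(mat_apply n (centered_op n a) ^^ Suc k) (\<lambda>v. x v / sqrt (col_sum n a v))
      = (mat_apply n (centered_op n a) ^^ Suc k) (\<lambda>v. (1 / T v) * ?z v)"
  proof -
    \<comment> \<open>The two start vectors are known to agree only below \<open>n\<close>; after
      one application they yield the same function.\<close>
    have "mat_apply n (centered_op n a) (\<lambda>v. x v / sqrt (col_sum n a v)) = mat_apply n (centered_op n a) (\<lambda>v. (1 / T v) * ?z v)"
      by (rule mat_apply_cong) (simp add: sqrt_degree)
    then show ?thesis unfolding funpow_Suc_right comp_def by simp
  qed
  have "nrm n (\<lambda>u. (mat_apply n (walk_op n a) ^^ Suc k) x u - (mat_apply n (walk_op n p) ^^ Suc k) x u)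
      = nrm n (\<lambda>u. (col_sum n a u / volume n a - col_sum n p u / volume n p) + (?s u * T u) * ?F u)"
  proof (rule nrm_cong)
    fix u assume u: "u < n"
    have T: "T u \<noteq> 0" using T_inverse_bounds(1)[OF u] by simp
    have alg: "(da / va + t * su * A) - (dp / vp + su * B) = (da / va - dp / vp) + su * t * (A - (1 / t) * B)"
      if "t \<noteq> 0" for da va t su A B dp vp :: real
      using that by (simp add: algebra_simps)
    show "(mat_apply n (walk_op n a) ^^ Suc k) x u - (mat_apply n (walk_op n p) ^^ Suc k) x u
        = (col_sum n a u / volume n a - col_sum n p u / volume n p) + (?s u * T u) * ?F u"
      unfolding G.funpow_walk_op_centered[OF x u] H.funpow_walk_op_centered[OF x u] start sqrt_degree[OF u]
      by (rule alg[OF T])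
  qed
  also have "\<dots> \<le> nrm n (\<lambda>u. col_sum n a u / volume n a - col_sum n p u / volume n p) + nrm n (\<lambda>u. (?s u * T u) * ?F u)"
    by (rule nrm_add)
  also have "\<dots> \<le> nrm n (\<lambda>u. col_sum n a u / volume n a - col_sum n p u / volume n p)
      + 2 * sqrt dM * (real (Suc k) * rate ^ k * (2 * \<epsilon> + 6 * \<eta>) * (nrm n x / sqrt dm))"
  proof (rule add_left_mono)
    have "\<bar>?s u * T u\<bar> \<le> sqrt dM * 2" if u: "u < n" for u
      unfolding abs_mult using dm(3)[OF u] dM s[OF u] T_bounds(3)[OF u] T_inverse_bounds(1)[OF u]
      by (intro mult_mono) auto
    then have "nrm n (\<lambda>u. (?s u * T u) * ?F u) \<le> \<bar>sqrt dM * 2\<bar> * nrm n ?F" by (rule nrm_mult_le)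
    also have "\<dots> \<le> \<bar>sqrt dM * 2\<bar> * (real (Suc k) * rate ^ (Suc k - 1) * (2 * \<epsilon> + 6 * \<eta>) * nrm n ?z)"
    proof (intro mult_left_mono nrm_funpow_intertwine_le centered_op_bound_rate rate_nonneg intertwining_defect)
      show "op_bound n (centered_op n p) rate"
        by (rule op_bound_mono[OF gap(1)]) (use \<epsilon> \<eta> in \<open>simp add: rate_def\<close>)
    qed (use \<epsilon> \<eta> in auto)
    also have "\<dots> \<le> \<bar>sqrt dM * 2\<bar> * (real (Suc k) * rate ^ (Suc k - 1) * (2 * \<epsilon> + 6 * \<eta>) * (nrm n x / sqrt dm))"
    proof (intro mult_left_mono)
      have "\<bar>1 / ?s v\<bar> \<le> 1 / sqrt dm" if v: "v < n" for v
        using dm(1) dm(2)[OF v] s[OF v] by (simp add: frac_le)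
      then have "nrm n (\<lambda>v. (1 / ?s v) * x v) \<le> \<bar>1 / sqrt dm\<bar> * nrm n x" by (rule nrm_mult_le)
      then show "nrm n ?z \<le> nrm n x / sqrt dm" using dm(1) by simp
    qed (use \<epsilon> \<eta> rate_nonneg in auto)
    finally show "nrm n (\<lambda>u. (?s u * T u) * ?F u)
        \<le> 2 * sqrt dM * (real (Suc k) * rate ^ k * (2 * \<epsilon> + 6 * \<eta>) * (nrm n x / sqrt dm))"
      using dM by (simp add: mult.commute[of "sqrt dM" 2])
  qed
  finally show ?thesis .
qed

end

section \<open>The random walk and PageRank\<close>

lemma nrm_le_sum: "(\<And>v. v < n \<Longrightarrow> y v \<ge> 0) \<Longrightarrow> nrm n y \<le> (\<Sum>v<n. y v)"
  unfolding nrm_def by (rule L2_set_le_sum) simp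

text \<open>Degree errors proportional to \<open>sqrt (col_sum n p v)\<close> have squares summing
  to a multiple of the volume. This average over vertices produces the \<open>n\<close> under the
  first root of the theorem. A second term corrects the normalization by the random volume.\<close>

lemma stationary_difference:
  assumes G: "weighted_graph n a" and H: "weighted_graph n p" and L: "L \<ge> 0"
    and deg: "\<And>v. v < n \<Longrightarrow> \<bar>col_sum n a v - col_sum n p v\<bar> \<le> 6 * sqrt (col_sum n p v * L)"
    and vol: "\<bar>volume n a - volume n p\<bar> \<le> 6 * sqrt (volume n p * L)"
  shows "nrm n (\<lambda>u. col_sum n a u / volume n a - col_sum n p u / volume n p) \<le> 12 * sqrt (L / volume n p)"
proof -
  interpret G: weighted_graph n a by fact
  interpret H: weighted_graph n p by fact
  let ?V = "volume n p"
  note pos = G.vol_pos H.vol_pos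
  have sq: "sqrt (?V * L) / ?V = sqrt (L / ?V)"
  proof -
    have "sqrt (?V * L) / ?V = sqrt (?V * L) / sqrt (?V\<^sup>2)" using pos by simp
    also have "\<dots> = sqrt (?V * L / ?V\<^sup>2)" by (rule real_sqrt_divide[symmetric])
    also have "?V * L / ?V\<^sup>2 = L / ?V" using pos by (simp add: power2_eq_square)
    finally show ?thesis .
  qed
  have "nrm n (\<lambda>u. col_sum n a u / volume n a - col_sum n p u / ?V)
      = nrm n (\<lambda>u. (1 / ?V) * (col_sum n a u - col_sum n p u) + ((?V - volume n a) / ?V) * (col_sum n a u / volume n a))"
    using pos by (intro nrm_cong) (simp add: field_simps)
  also have "\<dots> \<le> nrm n (\<lambda>u. (1 / ?V) * (col_sum n a u - col_sum n p u))
      + nrm n (\<lambda>u. ((?V - volume n a) / ?V) * (col_sum n a u / volume n a))"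
    by (rule nrm_add)
  also have "\<dots> \<le> 6 * sqrt (L / ?V) + 6 * sqrt (L / ?V)"
  proof (rule add_mono)
    have "nrm n (\<lambda>u. col_sum n a u - col_sum n p u) \<le> nrm n (\<lambda>u. (6 * sqrt L) * sqrt (col_sum n p u))"
      by (rule nrm_mono) (use deg L H.deg_pos in \<open>force simp: real_sqrt_mult abs_mult less_imp_le mult_ac\<close>)
    also have "\<dots> = 6 * sqrt (?V * L)"
      using L by (simp add: nrm_scale H.nrm_sqrt_degree real_sqrt_mult mult_ac)
    finally have "nrm n (\<lambda>u. (1 / ?V) * (col_sum n a u - col_sum n p u)) \<le> (1 / ?V) * (6 * sqrt (?V * L))"
      unfolding nrm_scale using pos by (simp add: divide_right_mono)
    then show "nrm n (\<lambda>u. (1 / ?V) * (col_sum n a u - col_sum n p u)) \<le> 6 * sqrt (L / ?V)"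
      unfolding sq[symmetric] by simp
    have "nrm n (\<lambda>u. col_sum n a u / volume n a) \<le> (\<Sum>u<n. col_sum n a u / volume n a)"
      by (rule nrm_le_sum) (use G.deg_pos pos in \<open>simp add: less_imp_le\<close>)
    also have "\<dots> = 1" using pos by (simp add: sum_divide_distrib[symmetric] flip: volume_def)
    finally have one: "nrm n (\<lambda>u. col_sum n a u / volume n a) \<le> 1" .
    have "nrm n (\<lambda>u. ((?V - volume n a) / ?V) * (col_sum n a u / volume n a))
        = \<bar>(?V - volume n a) / ?V\<bar> * nrm n (\<lambda>u. col_sum n a u / volume n a)"
      by (rule nrm_scale)
    also have "\<dots> \<le> (6 * sqrt (?V * L) / ?V) * 1"
    proof (rule mult_mono)
      show "\<bar>(?V - volume n a) / ?V\<bar> \<le> 6 * sqrt (?V * L) / ?V"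
        using vol pos by (simp add: abs_divide divide_right_mono abs_minus_commute)
    qed (use one pos L in auto)
    finally show "nrm n (\<lambda>u. ((?V - volume n a) / ?V) * (col_sum n a u / volume n a)) \<le> 6 * sqrt (L / ?V)"
      unfolding sq[symmetric] by simp
  qed
  finally show ?thesis by simp
qed

section \<open>From matrices and vectors to functions\<close>

lemma landing_prob_carrier:
  assumes "A \<in> carrier_mat n n" "x \<in> carrier_vec n"
  shows "landing_prob A x k \<in> carrier_vec n"
  unfolding landing_prob_def using assms by (intro mult_mat_vec_carrier[of _ n n]) auto

lemma landing_prob_index:
  assumes A: "A \<in> carrier_mat n n" and entries: "\<And>u v. u < n \<Longrightarrow> v < n \<Longrightarrow> A $$ (u, v) = B u v"
  shows "x \<in> carrier_vec n \<Longrightarrow> u < n \<Longrightarrow> vec_index (landing_prob A x k) u = (mat_apply n B ^^ k) (vec_index x) u"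
proof (induction k arbitrary: x u)
  case 0
  then show ?case using A by (simp add: landing_prob_def)
next
  case (Suc k)
  have Ax: "A *\<^sub>v x \<in> carrier_vec n" using A Suc.prems by (intro mult_mat_vec_carrier) auto
  have idx: "vec_index (A *\<^sub>v x) v = mat_apply n B (vec_index x) v" if "v < n" for v
    using that A Suc.prems by (auto simp: scalar_prod_def mat_apply_def lessThan_atLeast0 entries intro!: sum.cong)
  \<comment> \<open>The matrix power peels its factor on the right, the iterate on the left; hence
    the generalized start vector and the detour through \<open>mpow\<close>.\<close>
  have "landing_prob A x (Suc k) = landing_prob A (A *\<^sub>v x) k"
    unfolding landing_prob_def pow_mat.simps
    using A Suc.prems by (intro assoc_mult_mat_vec[of _ n n _ n]) auto
  then have "vec_index (landing_prob A x (Suc k)) u = (mat_apply n B ^^ k) (vec_index (A *\<^sub>v x)) u"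
    using Suc.IH[OF Ax Suc.prems(2)] by simp
  also have "\<dots> = mat_apply n (mpow n B k) (vec_index (A *\<^sub>v x)) u"
    by (rule mat_apply_funpow) fact
  also have "\<dots> = mat_apply n (mpow n B k) (mat_apply n B (vec_index x)) u"
    by (rule fun_cong[OF mat_apply_cong]) (rule idx)
  also have "\<dots> = (mat_apply n B ^^ k) (mat_apply n B (vec_index x)) u"
    by (rule mat_apply_funpow[symmetric]) fact
  also have "\<dots> = (mat_apply n B ^^ Suc k) (vec_index x) u"
    unfolding funpow_Suc_right by simp
  finally show ?case .
qed

lemma l2_norm_nrm: "x \<in> carrier_vec n \<Longrightarrow> l2_norm x = nrm n (vec_index x)"
  by (simp add: l2_norm_def nrm_def)

lemma l2_norm_landing_difference:
  assumes x: "x \<in> carrier_vec n"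
  shows "l2_norm (landing_prob (walk_mat (Matrix.mat n n (\<lambda>(u, v). a u v))) x k
      - landing_prob (walk_mat (Matrix.mat n n (\<lambda>(u, v). p u v))) x k)
    = nrm n (\<lambda>u. (mat_apply n (walk_op n a) ^^ k) (vec_index x) u - (mat_apply n (walk_op n p) ^^ k) (vec_index x) u)"
proof -
  let ?A = "walk_mat (Matrix.mat n n (\<lambda>(u, v). a u v))" and ?P = "walk_mat (Matrix.mat n n (\<lambda>(u, v). p u v))"
  note carr = landing_prob_carrier[OF walk_mat_carrier x]
  have "l2_norm (landing_prob ?A x k - landing_prob ?P x k)
      = nrm n (vec_index (landing_prob ?A x k - landing_prob ?P x k))"
    by (rule l2_norm_nrm) (use carr in auto)
  also have "\<dots> = nrm n (\<lambda>u. (mat_apply n (walk_op n a) ^^ k) (vec_index x) u - (mat_apply n (walk_op n p) ^^ k) (vec_index x) u)"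
  proof (rule nrm_cong)
    fix u assume u: "u < n"
    have "vec_index (landing_prob ?A x k - landing_prob ?P x k) u
        = vec_index (landing_prob ?A x k) u - vec_index (landing_prob ?P x k) u"
      using u carr[of p k] by (intro index_minus_vec) auto
    then show "vec_index (landing_prob ?A x k - landing_prob ?P x k) u
        = (mat_apply n (walk_op n a) ^^ k) (vec_index x) u - (mat_apply n (walk_op n p) ^^ k) (vec_index x) u"
      using landing_prob_index[OF walk_mat_carrier walk_mat_index x u] by simp
  qed
  finally show ?thesis .
qed

lemma l2_norm_pagerank_difference:
  assumes x: "x \<in> carrier_vec n"
  shows "l2_norm (pagerank \<gamma> (walk_mat (Matrix.mat n n (\<lambda>(u, v). a u v))) x
      - pagerank \<gamma> (walk_mat (Matrix.mat n n (\<lambda>(u, v). p u v))) x)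
    = nrm n (\<lambda>u. (\<Sum>k. \<gamma> k * (mat_apply n (walk_op n a) ^^ k) (vec_index x) u)
        - (\<Sum>k. \<gamma> k * (mat_apply n (walk_op n p) ^^ k) (vec_index x) u))"
proof -
  let ?A = "walk_mat (Matrix.mat n n (\<lambda>(u, v). a u v))" and ?P = "walk_mat (Matrix.mat n n (\<lambda>(u, v). p u v))"
  have carr: "pagerank \<gamma> B x \<in> carrier_vec n" for B using x by (simp add: pagerank_def)
  have "l2_norm (pagerank \<gamma> ?A x - pagerank \<gamma> ?P x) = nrm n (vec_index (pagerank \<gamma> ?A x - pagerank \<gamma> ?P x))"
    by (rule l2_norm_nrm) (use carr in auto)
  also have "\<dots> = nrm n (\<lambda>u. (\<Sum>k. \<gamma> k * (mat_apply n (walk_op n a) ^^ k) (vec_index x) u)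
        - (\<Sum>k. \<gamma> k * (mat_apply n (walk_op n p) ^^ k) (vec_index x) u))"
  proof (rule nrm_cong)
    fix u assume u: "u < n"
    have "vec_index (pagerank \<gamma> ?A x - pagerank \<gamma> ?P x) u
        = vec_index (pagerank \<gamma> ?A x) u - vec_index (pagerank \<gamma> ?P x) u"
      using u carr[of ?P] by (intro index_minus_vec) auto
    then show "vec_index (pagerank \<gamma> ?A x - pagerank \<gamma> ?P x) u
        = (\<Sum>k. \<gamma> k * (mat_apply n (walk_op n a) ^^ k) (vec_index x) u)
        - (\<Sum>k. \<gamma> k * (mat_apply n (walk_op n p) ^^ k) (vec_index x) u)"
      using u x landing_prob_index[OF walk_mat_carrier walk_mat_index x u]
      by (simp add: pagerank_def)
  qed
  finally show ?thesis .
qed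

text \<open>The walk preserves nonnegativity and total mass 1. The resulting bound makes the
  PageRank series converge for summable weights.\<close>

lemma (in weighted_graph) walk_distribution:
  assumes "\<And>v. v < n \<Longrightarrow> x v \<ge> 0" "(\<Sum>v<n. x v) = 1" "u < n"
  shows "(mat_apply n (walk_op n a) ^^ k) x u \<in> {0..1}"
proof -
  let ?y = "(mat_apply n (walk_op n a) ^^ k) x"
  have nn: "(mat_apply n (walk_op n a) ^^ k) x v \<ge> 0" if "v < n" for v k
    using that by (induction k arbitrary: v) (auto simp: assms mat_apply_def intro!: sum_nonneg mult_nonneg_nonneg walk_op_nonneg)
  have "(\<Sum>v<n. (mat_apply n (walk_op n a) ^^ k) x v) = 1" for k
    by (induction k) (simp_all add: assms walk_op_mat_apply_col_sum)
  moreover have "?y u \<le> (\<Sum>v<n. ?y v)" using nn assms(3) by (intro member_le_sum) auto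
  ultimately show ?thesis using nn[OF assms(3)] by simp
qed

lemma tendsto_nrm:
  assumes "\<And>v. v < n \<Longrightarrow> (\<lambda>k. f k v) \<longlonglongrightarrow> l v"
  shows "(\<lambda>k. nrm n (f k)) \<longlonglongrightarrow> nrm n l"
  unfolding nrm_def L2_set_def using assms by (auto intro!: tendsto_intros)

text \<open>The triangle inequality is applied to partial sums and passed to the limit. The right
  side lives in \<open>ennreal\<close>, so a divergent \<open>g_series\<close> needs no separate
  case.\<close>

lemma weighted_series_difference_bound:
  fixes X Y :: "nat \<Rightarrow> nat \<Rightarrow> real"
  assumes \<gamma>: "\<And>k. \<gamma> k \<ge> 0" "summable \<gamma>"
    and X: "\<And>k v. v < n \<Longrightarrow> X k v \<in> {0..1}" and Y: "\<And>k v. v < n \<Longrightarrow> Y k v \<in> {0..1}"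
    and N: "N > 0" and nonneg: "b \<ge> 0" "c \<ge> 0" "r \<ge> 0" "q \<ge> 0"
    and le: "\<And>k. nrm n (\<lambda>v. X k v - Y k v) / N \<le> b + c * real k * r ^ (k - 1) * q"
  shows "ennreal (nrm n (\<lambda>v. (\<Sum>k. \<gamma> k * X k v) - (\<Sum>k. \<gamma> k * Y k v)) / N)
    \<le> ennreal (suminf \<gamma> * b) + ennreal c * g_series \<gamma> r * ennreal q"
proof (rule LIMSEQ_le_const2)
  have sm: "summable (\<lambda>k. \<gamma> k * Z k v)" if "\<And>k. Z k v \<in> {0..1}" for Z :: "nat \<Rightarrow> nat \<Rightarrow> real" and v
    by (rule summable_comparison_test'[OF \<gamma>(2), of 0])
       (use that \<gamma> in \<open>auto simp: abs_mult mult_left_le\<close>)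
  \<comment> \<open>\<open>Suc K\<close> terms: once the vanishing term \<open>k = 0\<close> is
    dropped, exactly \<open>K\<close> terms of the shifted \<open>g_series\<close> remain.\<close>
  let ?Z = "\<lambda>K v. \<Sum>k<Suc K. \<gamma> k * (X k v - Y k v)"
  have "(\<lambda>K. nrm n (?Z K) / N) \<longlonglongrightarrow> nrm n (\<lambda>v. (\<Sum>k. \<gamma> k * X k v) - (\<Sum>k. \<gamma> k * Y k v)) / N"
  proof (rule tendsto_divide[OF tendsto_nrm tendsto_const])
    fix v assume v: "v < n"
    have "(\<lambda>K. \<Sum>k<K. \<gamma> k * X k v - \<gamma> k * Y k v) \<longlonglongrightarrow> (\<Sum>k. \<gamma> k * X k v) - (\<Sum>k. \<gamma> k * Y k v)"
      using sums_diff[OF summable_sums[OF sm] summable_sums[OF sm], of X v Y v] X[OF v] Y[OF v]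
      by (simp add: sums_def)
    from LIMSEQ_Suc[OF this]
    show "(\<lambda>K. ?Z K v) \<longlonglongrightarrow> (\<Sum>k. \<gamma> k * X k v) - (\<Sum>k. \<gamma> k * Y k v)"
      by (simp add: right_diff_distrib)
  qed (use N in simp)
  then show "(\<lambda>K. ennreal (nrm n (?Z K) / N))
      \<longlonglongrightarrow> ennreal (nrm n (\<lambda>v. (\<Sum>k. \<gamma> k * X k v) - (\<Sum>k. \<gamma> k * Y k v)) / N)"
    by (rule tendsto_ennrealI)
  show "\<exists>K0. \<forall>K\<ge>K0. ennreal (nrm n (?Z K) / N) \<le> ennreal (suminf \<gamma> * b) + ennreal c * g_series \<gamma> r * ennreal q"
  proof (intro exI[of _ 0] allI impI)
    fix K :: nat
    let ?t = "\<lambda>k. \<gamma> (Suc k) * real (Suc k) * r ^ k"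
    have t0: "?t k \<ge> 0" for k using \<gamma>(1)[of "Suc k"] nonneg by simp
    have "nrm n (?Z K) \<le> (\<Sum>k<Suc K. nrm n (\<lambda>v. \<gamma> k * (X k v - Y k v)))"
      by (rule nrm_sum)
    also have "\<dots> = (\<Sum>k<Suc K. \<gamma> k * nrm n (\<lambda>v. X k v - Y k v))"
      unfolding nrm_scale using \<gamma> by simp
    finally have "nrm n (?Z K) / N \<le> (\<Sum>k<Suc K. \<gamma> k * nrm n (\<lambda>v. X k v - Y k v)) / N"
      using N by (intro divide_right_mono) auto
    also have "\<dots> = (\<Sum>k<Suc K. \<gamma> k * (nrm n (\<lambda>v. X k v - Y k v) / N))"
      by (simp only: sum_divide_distrib times_divide_eq_right)
    also have "\<dots> \<le> (\<Sum>k<Suc K. \<gamma> k * (b + c * real k * r ^ (k - 1) * q))"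
      by (intro sum_mono mult_left_mono le \<gamma>)
    also have "\<dots> = (\<Sum>k<Suc K. \<gamma> k) * b + c * (\<Sum>k<Suc K. \<gamma> k * real k * r ^ (k - 1)) * q"
      by (simp only: distrib_left sum.distrib sum_distrib_left sum_distrib_right mult_ac)
    also have "(\<Sum>k<Suc K. \<gamma> k * real k * r ^ (k - 1)) = (\<Sum>k<K. ?t k)"
      unfolding sum.lessThan_Suc_shift by simp
    also have "(\<Sum>k<Suc K. \<gamma> k) * b + c * (\<Sum>k<K. ?t k) * q \<le> suminf \<gamma> * b + c * (\<Sum>k<K. ?t k) * q"
      using \<gamma> nonneg by (intro add_right_mono mult_right_mono sum_le_suminf) auto
    finally have "ennreal (nrm n (?Z K) / N) \<le> ennreal (suminf \<gamma> * b + c * (\<Sum>k<K. ?t k) * q)"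
      by (rule ennreal_leI)
    also have "\<dots> = ennreal (suminf \<gamma> * b) + ennreal c * ennreal (\<Sum>k<K. ?t k) * ennreal q"
      using nonneg t0 \<gamma> by (simp add: ennreal_plus ennreal_mult sum_nonneg suminf_nonneg)
    also have "ennreal (\<Sum>k<K. ?t k) = (\<Sum>k<K. ennreal (?t k))"
      by (rule sum_ennreal[symmetric]) (rule t0)
    also have "ennreal (suminf \<gamma> * b) + ennreal c * (\<Sum>k<K. ennreal (?t k)) * ennreal q
        \<le> ennreal (suminf \<gamma> * b) + ennreal c * g_series \<gamma> r * ennreal q"
      unfolding g_series_def
      by (intro add_left_mono mult_right_mono mult_left_mono sum_le_suminf summableI) auto
    finally show "ennreal (nrm n (?Z K) / N) \<le> ennreal (suminf \<gamma> * b) + ennreal c * g_series \<gamma> r * ennreal q" .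
  qed
qed

text \<open>Its square \<open>16 * exp 3\<close> makes the base of the moment bound at most
  \<open>exp (- 3)\<close> when the exponent \<open>m\<close> is at most
  \<open>2 * L\<close>.\<close>

definition noise_const :: real where
  "noise_const = 4 * exp (3 / 2)"

lemma noise_const: "noise_const > 0" "noise_const\<^sup>2 = 16 * exp 3"
  by (simp_all add: noise_const_def power_mult_distrib exp_of_nat_mult[symmetric])

text \<open>This is \<open>4 * \<epsilon> + 16 * \<eta>\<close>, and the next constant is
  \<open>2 * (2 * \<epsilon> + 6 * \<eta>)\<close>, in units of \<open>\<delta>\<close>, for
  \<open>\<epsilon> = noise_const * \<delta>\<close> and
  \<open>\<eta> = 6 * \<delta>\<close>.\<close>

definition rate_const :: real where
  "rate_const = 4 * noise_const + 96"

definition mixing_const :: real where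
  "mixing_const = 4 * noise_const + 72"

lemma mean_degree_bounds:
  assumes "n \<ge> 1"
  shows "v < n \<Longrightarrow> min_degree (mean_adjacency_mat n p) \<le> col_sum n p v"
    and "v < n \<Longrightarrow> col_sum n p v \<le> max_degree (mean_adjacency_mat n p)"
    and "\<exists>v<n. min_degree (mean_adjacency_mat n p) = col_sum n p v"
proof -
  have deg: "degree_of (mean_adjacency_mat n p) v = col_sum n p v" if "v < n" for v
    using that by (simp add: degree_of_def mean_adjacency_mat_def col_sum_def)
  then have img: "degree_of (mean_adjacency_mat n p) ` {..<dim_col (mean_adjacency_mat n p)} = col_sum n p ` {..<n}"
    by (simp add: mean_adjacency_mat_def)
  show "v < n \<Longrightarrow> min_degree (mean_adjacency_mat n p) \<le> col_sum n p v"
    unfolding min_degree_def img by (rule Min_le) auto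
  show "v < n \<Longrightarrow> col_sum n p v \<le> max_degree (mean_adjacency_mat n p)"
    unfolding max_degree_def img by (rule Max_ge) auto
  have "min_degree (mean_adjacency_mat n p) \<in> col_sum n p ` {..<n}"
    unfolding min_degree_def img using assms by (intro Min_in) (auto simp: lessThan_empty_iff)
  then show "\<exists>v<n. min_degree (mean_adjacency_mat n p) = col_sum n p v" by auto
qed

text \<open>\<open>576 = 24^2\<close> gives \<open>\<delta> \<le> 1 / 24\<close>, hence
  \<open>6 * \<delta> \<le> 1 / 4\<close> as the perturbation argument requires;
  \<open>n \<ge> 5\<close> gives \<open>L \<ge> 1\<close> and closes the union bound.\<close>

locale dense_edge_independent_graph = edge_independent_graph M n p E
  for M :: "'a measure" and n p E +
  fixes dm dM L \<delta> :: real
  defines "dm \<equiv> min_degree (mean_adjacency_mat n p)"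
    and "dM \<equiv> max_degree (mean_adjacency_mat n p)"
    and "L \<equiv> ln (real n)"
    and "\<delta> \<equiv> sqrt (L / dm)"
  assumes n: "n \<ge> 5" and dense: "576 * L \<le> dm"
begin

definition adj :: "'a \<Rightarrow> nat \<Rightarrow> nat \<Rightarrow> real" where
  "adj w u v = of_bool (E w u v)"

text \<open>At least \<open>L\<close>, so that \<open>exp (- 3)\<close> to this power is at most
  \<open>1 / n^3\<close>; at most \<open>2 * L\<close>, since \<open>L \<ge> 1\<close>.\<close>

definition half_power :: nat where
  "half_power = nat \<lceil>L\<rceil>"

lemma L_ge_1: "1 \<le> L"
proof -
  have "exp 1 \<le> (3 :: real)" by (rule exp_le)
  also have "3 \<le> real n" using n by simp
  finally show ?thesis using n by (simp add: L_def ln_ge_iff)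
qed

lemma dm_pos: "dm > 0"
  using dense L_ge_1 by linarith

lemma degree_bounds: "v < n \<Longrightarrow> dm \<le> col_sum n p v" "v < n \<Longrightarrow> col_sum n p v \<le> dM"
  using mean_degree_bounds(1,2)[of n v p] n by (simp_all add: dm_def dM_def)

lemma dM_pos: "dM > 0"
  using degree_bounds[of 0] dm_pos n by simp

sublocale mean: weighted_graph n p
proof
  show "p u v \<ge> 0" if "u < n" "v < n" for u v using p_range[OF that] by simp
  show "col_sum n p v > 0" if "v < n" for v using degree_bounds(1)[OF that] dm_pos by linarith
qed (use p_sym n in auto)

lemma half_power: "half_power \<ge> 1" "L \<le> real half_power" "real half_power \<le> 2 * L"
  using L_ge_1 unfolding half_power_def by linarith+

lemma \<delta>_bounds: "\<delta> > 0" "\<delta> \<le> 1 / 24"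
proof -
  show "\<delta> > 0" using L_ge_1 dm_pos by (simp add: \<delta>_def)
  have "\<delta> \<le> sqrt ((1 / 24)\<^sup>2)"
    unfolding \<delta>_def using dense dm_pos by (intro real_sqrt_le_mono) (simp add: pos_divide_le_eq power2_eq_square)
  then show "\<delta> \<le> 1 / 24" by simp
qed

lemma \<delta>_sq: "\<delta>\<^sup>2 = L / dm"
  using L_ge_1 dm_pos by (simp add: \<delta>_def)

text \<open>Turns the absolute deviation of a degree or of the volume into a relative one of order
  \<open>\<delta>\<close>.\<close>

lemma sqrt_mult_L_le:
  assumes "dm \<le> S"
  shows "sqrt (S * L) \<le> \<delta> * S"
proof -
  have S: "S > 0" using assms dm_pos by linarith
  have "S * L = (L / S) * S\<^sup>2" using S by (simp add: power2_eq_square)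
  also have "\<dots> \<le> (L / dm) * S\<^sup>2"
    using assms dm_pos L_ge_1 by (intro mult_right_mono divide_left_mono) auto
  also have "\<dots> = (\<delta> * S)\<^sup>2" by (simp add: power_mult_distrib \<delta>_sq)
  finally have "sqrt (S * L) \<le> sqrt ((\<delta> * S)\<^sup>2)" by (rule real_sqrt_le_mono)
  then show ?thesis using \<delta>_bounds S by simp
qed

lemma volume_ge: "real n * dm \<le> volume n p"
  unfolding volume_def using sum_bounded_below[of "{..<n}" dm "col_sum n p"] degree_bounds(1) by simp

lemma dm_le_volume: "dm \<le> volume n p"
proof -
  have "1 * dm \<le> real n * dm" using n dm_pos by (intro mult_right_mono) auto
  then show ?thesis using volume_ge by simp
qed

section \<open>The exceptional event and its probability\<close>

definition degree_deviates :: "nat \<Rightarrow> 'a set" where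
  "degree_deviates v = {w \<in> space M. \<bar>col_sum n (adj w) v - col_sum n p v\<bar> \<ge> 6 * sqrt (col_sum n p v * L)}"

definition volume_deviates :: "'a set" where
  "volume_deviates = {w \<in> space M. \<bar>volume n (adj w) - volume n p\<bar> \<ge> 6 * sqrt (volume n p * L)}"

definition noise_large :: "'a set" where
  "noise_large = {w \<in> space M. (noise_const * \<delta>) ^ (2 * half_power)
    \<le> (\<Sum>u<n. mpow n (normalized_noise (col_sum n p) w) (2 * half_power) u u)}"

definition bad :: "'a set" where
  "bad = (\<Union>v<n. degree_deviates v) \<union> volume_deviates \<union> noise_large"

lemma adj_edge_set: "u < n \<Longrightarrow> v < n \<Longrightarrow> adj w u v = of_bool ((u, v) \<in> edge_set w)"
  by (simp add: adj_def edge_set_def)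

text \<open>\<open>adj w\<close> has entries beyond \<open>n\<close> that \<open>edge_set\<close>
  does not record, so \<open>Q\<close> has to respect agreement below \<open>n\<close>.\<close>

lemma events_adj:
  assumes "\<And>a b. (\<And>u v. u < n \<Longrightarrow> v < n \<Longrightarrow> a u v = b u v) \<Longrightarrow> Q a \<Longrightarrow> Q b"
  shows "{w \<in> space M. Q (adj w)} \<in> events"
proof (rule events_edge_set)
  fix w
  show "Q (adj w) \<longleftrightarrow> Q (\<lambda>u v. of_bool ((u, v) \<in> edge_set w))"
  proof
    show "Q (\<lambda>u v. of_bool ((u, v) \<in> edge_set w))" if "Q (adj w)"
      by (rule assms[OF _ that]) (rule adj_edge_set)
    show "Q (adj w)" if "Q (\<lambda>u v. of_bool ((u, v) \<in> edge_set w))"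
      by (rule assms[OF _ that]) (rule adj_edge_set[symmetric])
  qed
qed

lemma degree_deviates_events:
  assumes v: "v < n"
  shows "degree_deviates v \<in> events"
  unfolding degree_deviates_def
proof (rule events_adj[where Q = "\<lambda>a. 6 * sqrt (col_sum n p v * L) \<le> \<bar>col_sum n a v - col_sum n p v\<bar>"])
  fix a b :: "nat \<Rightarrow> nat \<Rightarrow> real"
  assume "\<And>u v. u < n \<Longrightarrow> v < n \<Longrightarrow> a u v = b u v"
  then have "col_sum n a v = col_sum n b v" using v by (rule col_sum_cong)
  moreover assume "6 * sqrt (col_sum n p v * L) \<le> \<bar>col_sum n a v - col_sum n p v\<bar>"
  ultimately show "6 * sqrt (col_sum n p v * L) \<le> \<bar>col_sum n b v - col_sum n p v\<bar>" by simp
qed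

lemma volume_deviates_events: "volume_deviates \<in> events"
  unfolding volume_deviates_def
proof (rule events_adj[where Q = "\<lambda>a. 6 * sqrt (volume n p * L) \<le> \<bar>volume n a - volume n p\<bar>"])
  fix a b :: "nat \<Rightarrow> nat \<Rightarrow> real"
  assume "\<And>u v. u < n \<Longrightarrow> v < n \<Longrightarrow> a u v = b u v"
  then have "volume n a = volume n b" by (rule volume_cong)
  moreover assume "6 * sqrt (volume n p * L) \<le> \<bar>volume n a - volume n p\<bar>"
  ultimately show "6 * sqrt (volume n p * L) \<le> \<bar>volume n b - volume n p\<bar>" by simp
qed

lemma noise_large_events: "noise_large \<in> events"
  unfolding noise_large_def
  by (rule borel_measurable_le) (auto intro: borel_measurable_integrable integrable_trace_noise)

lemma degrees_deviate_events: "(\<Union>v<n. degree_deviates v) \<in> events"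
  by (intro sets.finite_UN degree_deviates_events) auto

lemmas bad_events = degrees_deviate_events volume_deviates_events noise_large_events

lemma prob_degree_deviates:
  assumes "v < n"
  shows "prob (degree_deviates v) \<le> 2 * exp (- 3 * L)"
proof -
  have h: "(\<Sum>u<n. \<Sum>v'<n. of_bool (v' = v) * f u v') = col_sum n f v" for f :: "nat \<Rightarrow> nat \<Rightarrow> real"
    using assms by (simp add: col_sum_def of_bool_def if_distrib[of "\<lambda>z. z * _"] cong: if_cong)
  have "2 * L \<le> col_sum n p v" "L \<ge> 0"
    using degree_bounds(1)[OF assms] dense L_ge_1 by linarith+
  then show ?thesis
    using chernoff_weighted_degree_sum[of "\<lambda>u v'. of_bool (v' = v)" L] mean.deg_pos[OF assms]
    unfolding h degree_deviates_def adj_def[abs_def] by simp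
qed

lemma prob_volume_deviates: "prob volume_deviates \<le> 2 * exp (- 3 * L)"
proof -
  have h: "(\<Sum>u<n. \<Sum>v<n. 1 * f u v) = volume n f" for f :: "nat \<Rightarrow> nat \<Rightarrow> real"
    unfolding volume_def col_sum_def mult_1 by (rule sum.swap)
  have "2 * L \<le> volume n p" "L \<ge> 0"
    using dm_le_volume dense L_ge_1 by linarith+
  then show ?thesis
    using chernoff_weighted_degree_sum[of "\<lambda>u v. 1" L] mean.vol_pos
    unfolding h volume_deviates_def adj_def[abs_def] by simp
qed

lemma prob_noise_large: "prob noise_large \<le> real n * exp (- 3 * L)"
proof -
  have "prob noise_large \<le> real n * (8 * real half_power / (dm * (noise_const * \<delta>)\<^sup>2)) ^ half_power"
    unfolding noise_large_def
  proof (rule noise_norm_tail)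
    show "2 * real half_power \<le> dm" using half_power dense L_ge_1 by linarith
  qed (use half_power dm_pos degree_bounds \<delta>_bounds noise_const in \<open>simp_all add: col_sum_def\<close>)
  also have "\<dots> \<le> real n * exp (- 3) ^ half_power"
  proof (intro mult_left_mono power_mono)
    have q: "dm * (noise_const * \<delta>)\<^sup>2 = 16 * exp 3 * L"
      using dm_pos by (simp add: power_mult_distrib \<delta>_sq noise_const(2))
    have pos: "0 < 16 * exp 3 * L" using L_ge_1 by simp
    have "8 * real half_power / (dm * (noise_const * \<delta>)\<^sup>2) \<le> 8 * (2 * L) / (16 * exp 3 * L)"
      unfolding q using half_power(3) pos by (intro divide_right_mono mult_left_mono) simp_all
    also have "\<dots> = inverse (exp 3)"
      using L_ge_1 by (simp add: inverse_eq_divide)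
    also have "\<dots> = exp (- 3)" by (rule exp_minus[symmetric])
    finally show "8 * real half_power / (dm * (noise_const * \<delta>)\<^sup>2) \<le> exp (- 3)" .
  qed (use dm_pos in auto)
  also have "exp (- 3) ^ half_power = exp (- 3 * real half_power)"
    by (simp add: exp_of_nat_mult[symmetric] mult.commute)
  also have "real n * \<dots> \<le> real n * exp (- 3 * L)"
    using half_power by (intro mult_left_mono) auto
  finally show ?thesis .
qed

lemma bad_in_events: "bad \<in> events"
  unfolding bad_def by (intro sets.Un bad_events)

lemma prob_bad: "prob bad \<le> 1 / real n"
proof -
  have n0: "real n > 0" "real n \<ge> 5" using n by simp_all
  have "exp (- 3 * L) = 1 / real n ^ 3"
    using n0 exp_of_nat_mult[of 3 L] by (simp add: L_def exp_minus divide_inverse)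
  then have e: "exp (- 3 * L) = (1 / real n) * (1 / real n) * (1 / real n)"
    by (simp add: power3_eq_cube)
  have "prob (\<Union>v<n. degree_deviates v) \<le> (\<Sum>v<n. prob (degree_deviates v))"
    by (rule finite_measure_subadditive_finite) (auto intro: degree_deviates_events)
  also have "\<dots> \<le> (\<Sum>v<n. 2 * exp (- 3 * L))"
    by (intro sum_mono prob_degree_deviates) simp
  finally have deg: "prob (\<Union>v<n. degree_deviates v) \<le> real n * (2 * exp (- 3 * L))" by simp
  have "prob bad \<le> prob ((\<Union>v<n. degree_deviates v) \<union> volume_deviates) + prob noise_large"
    unfolding bad_def by (intro measure_Un_le sets.Un bad_events)
  also have "\<dots> \<le> (prob (\<Union>v<n. degree_deviates v) + prob volume_deviates) + prob noise_large"
    by (intro add_right_mono measure_Un_le bad_events)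
  also have "\<dots> \<le> (real n * (2 * exp (- 3 * L)) + 2 * exp (- 3 * L)) + real n * exp (- 3 * L)"
    by (intro add_mono deg prob_volume_deviates prob_noise_large)
  also have "\<dots> = (3 * real n + 2) * exp (- 3 * L)" by (simp add: algebra_simps)
  \<comment> \<open>Each copy of the tail equals \<open>1 / n^3\<close>; the
    \<open>3 * n + 2\<close> copies fit into \<open>n * n\<close>.\<close>
  also have "\<dots> \<le> (real n * real n) * exp (- 3 * L)"
  proof (rule mult_right_mono)
    have "5 * real n \<le> real n * real n" using n0 by (intro mult_right_mono) auto
    then show "3 * real n + 2 \<le> real n * real n" using n0 by linarith
  qed simp
  also have "\<dots> = 1 / real n" unfolding e using n0 by simp
  finally show ?thesis .
qed

lemma adjacency_mat_adj: "adjacency_mat n (E w) = Matrix.mat n n (\<lambda>(u, v). adj w u v)"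
  by (simp add: adjacency_mat_def adj_def)

lemma distributionD:
  assumes "initial_distribution n x"
  shows "x \<in> carrier_vec n" "\<And>v. v < n \<Longrightarrow> vec_index x v \<ge> 0" "(\<Sum>v<n. vec_index x v) = 1"
    "nrm n (vec_index x) > 0"
proof -
  show *: "x \<in> carrier_vec n" "\<And>v. v < n \<Longrightarrow> vec_index x v \<ge> 0" "(\<Sum>v<n. vec_index x v) = 1"
    using assms by (auto simp: initial_distribution_def)
  \<comment> \<open>Cauchy-Schwarz against the constant 1: a vector of total mass 1 is not
    zero.\<close>
  have "1 \<le> nrm n (\<lambda>_. 1) * nrm n (vec_index x)"
    using inner_le_nrm[of "\<lambda>_. 1" "vec_index x" n] *(3) by simp
  then have "nrm n (vec_index x) \<noteq> 0" by auto
  then show "nrm n (vec_index x) > 0" using nrm_nonneg[of n "vec_index x"] by linarith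
qed

section \<open>Deterministic bounds off the exceptional event\<close>

context
  fixes w
  assumes w: "w \<in> space M" "w \<notin> bad"
begin

lemma degree_close:
  assumes "v < n"
  shows "\<bar>col_sum n (adj w) v - col_sum n p v\<bar> \<le> 6 * sqrt (col_sum n p v * L)"
    "\<bar>col_sum n (adj w) v - col_sum n p v\<bar> \<le> (6 * \<delta>) * col_sum n p v"
proof -
  have "w \<notin> degree_deviates v" using w assms by (auto simp: bad_def)
  then show le: "\<bar>col_sum n (adj w) v - col_sum n p v\<bar> \<le> 6 * sqrt (col_sum n p v * L)"
    using w by (simp add: degree_deviates_def)
  then show "\<bar>col_sum n (adj w) v - col_sum n p v\<bar> \<le> (6 * \<delta>) * col_sum n p v"
    using sqrt_mult_L_le[OF degree_bounds(1)[OF assms]] by linarith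
qed

lemma volume_close:
  "\<bar>volume n (adj w) - volume n p\<bar> \<le> 6 * sqrt (volume n p * L)"
  "\<bar>volume n (adj w) - volume n p\<bar> \<le> (6 * \<delta>) * volume n p"
proof -
  have "w \<notin> volume_deviates" using w by (auto simp: bad_def)
  then show le: "\<bar>volume n (adj w) - volume n p\<bar> \<le> 6 * sqrt (volume n p * L)"
    using w by (simp add: volume_deviates_def)
  then show "\<bar>volume n (adj w) - volume n p\<bar> \<le> (6 * \<delta>) * volume n p"
    using sqrt_mult_L_le[OF dm_le_volume] by linarith
qed

lemma noise_bound:
  "op_bound n (\<lambda>u v. (adj w u v - p u v) / (sqrt (col_sum n p u) * sqrt (col_sum n p v))) (noise_const * \<delta>)"
  unfolding op_bound_def
proof
  fix y
  let ?X = "normalized_noise (col_sum n p) w" and ?c = "noise_const * \<delta>"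
  have c: "?c \<ge> 0" using noise_const \<delta>_bounds by simp
  have X: "(\<lambda>u v. (adj w u v - p u v) / (sqrt (col_sum n p u) * sqrt (col_sum n p v))) = ?X"
    by (intro ext) (simp add: normalized_noise_def adj_def)
  have "w \<notin> noise_large" using w by (auto simp: bad_def)
  then have tr: "(\<Sum>u<n. mpow n ?X (2 * half_power) u u) \<le> ?c ^ (2 * half_power)"
    using w by (simp add: noise_large_def)
  have "nrm n (mat_apply n ?X y) ^ (2 * half_power)
      \<le> (\<Sum>u<n. mpow n ?X (2 * half_power) u u) * nrm n y ^ (2 * half_power)"
    by (rule nrm_mat_apply_power_le_trace[OF normalized_noise_sym[OF w(1)] half_power(1)])
  also have "\<dots> \<le> ?c ^ (2 * half_power) * nrm n y ^ (2 * half_power)"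
    by (intro mult_right_mono tr) simp
  also have "\<dots> = (?c * nrm n y) ^ (2 * half_power)"
    by (rule power_mult_distrib[symmetric])
  finally show "nrm n (mat_apply n (\<lambda>u v. (adj w u v - p u v) / (sqrt (col_sum n p u) * sqrt (col_sum n p v))) y) \<le> ?c * nrm n y"
    unfolding X using c half_power(1) by (subst (asm) power_mono_iff) auto
qed

text \<open>A relative degree error of at most 1/4 rules out isolated vertices.\<close>

lemma random_weighted_graph: "weighted_graph n (adj w)"
proof
  show "adj w u v \<ge> 0" for u v by (simp add: adj_def)
  show "adj w u v = adj w v u" if "u < n" "v < n" for u v
    using E_sym[OF w(1) that] by (simp add: adj_def)
  show "col_sum n (adj w) v > 0" if "v < n" for v
  proof -
    have "(6 * \<delta>) * col_sum n p v \<le> (1 / 4) * col_sum n p v"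
      using \<delta>_bounds mean.deg_pos[OF that] by (intro mult_right_mono) auto
    then show ?thesis using degree_close(2)[OF that] mean.deg_pos[OF that] by linarith
  qed
qed (use n in simp)

lemma perturbation: "graph_perturbation n (adj w) p (6 * \<delta>) (noise_const * \<delta>) (second_eigenvalue mean.W)"
proof (intro graph_perturbation.intro random_weighted_graph graph_perturbation_axioms.intro)
  show "weighted_graph n p" by (rule mean.weighted_graph_axioms)
  show "op_bound n (centered_op n p) (second_eigenvalue mean.W)" using n by (intro mean.centered_op_bound) simp
  show "second_eigenvalue mean.W \<le> 1" using n by (intro mean.second_eigenvalue_le_1) simp
qed (use \<delta>_bounds noise_const degree_close(2) volume_close(2) noise_bound second_eigenvalue_nonneg in auto)

lemma landing_bound:
  assumes x: "initial_distribution n x"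
  shows "l2_norm (landing_prob (walk_mat (adjacency_mat n (E w))) x k
      - landing_prob (walk_mat (mean_adjacency_mat n p)) x k) / l2_norm x
    \<le> 12 * sqrt (L / (real n * dm)) * (1 / l2_norm x)
      + mixing_const * real k * (second_eigenvalue (walk_mat (mean_adjacency_mat n p)) + rate_const * \<delta>) ^ (k - 1)
        * sqrt (dM * L / dm\<^sup>2)"
proof -
  interpret P: graph_perturbation n "adj w" p "6 * \<delta>" "noise_const * \<delta>" "second_eigenvalue mean.W"
    by (rule perturbation)
  note x = distributionD[OF x]
  let ?N = "nrm n (vec_index x)" and ?lam = "second_eigenvalue mean.W"
  let ?q = "sqrt (dM * L / dm\<^sup>2)" and ?b = "12 * sqrt (L / (real n * dm))"
  let ?D = "\<lambda>k. nrm n (\<lambda>u. (mat_apply n (walk_op n (adj w)) ^^ k) (vec_index x) u - (mat_apply n (walk_op n p) ^^ k) (vec_index x) u)"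
  have rate: "P.rate = ?lam + rate_const * \<delta>"
    unfolding P.rate_def rate_const_def by (simp add: algebra_simps)
  have rate0: "?lam + rate_const * \<delta> \<ge> 0"
    using P.rate_nonneg by (simp add: rate)
  have mix: "mixing_const > 0" using noise_const by (simp add: mixing_const_def)
  \<comment> \<open>Matches the last factor of the theorem with \<open>sqrt dM\<close>,
    \<open>\<delta>\<close> and \<open>1 / sqrt dm\<close> from
    \<open>landing_difference\<close>.\<close>
  have q: "?q = sqrt dM * \<delta> / sqrt dm"
  proof -
    have "dM * L / dm\<^sup>2 = dM * (L / dm) / dm" by (simp add: power2_eq_square)
    then have "?q = sqrt (dM * (L / dm) / dm)" by simp
    also have "\<dots> = sqrt dM * \<delta> / sqrt dm" unfolding \<delta>_def real_sqrt_divide real_sqrt_mult ..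
    finally show ?thesis .
  qed
  have b: "?b \<ge> 0" using L_ge_1 dm_pos by simp
  have D: "?D k \<le> ?b + mixing_const * real k * (?lam + rate_const * \<delta>) ^ (k - 1) * ?q * ?N"
  \<comment> \<open>At \<open>k = 0\<close> both walks are still at \<open>x\<close> and the left
    side is 0; the stationary decomposition covers \<open>k \<ge> 1\<close>.\<close>
  proof (cases k)
    case 0
    have "?D 0 = 0" by (simp add: nrm_def L2_set_def)
    then show ?thesis using 0 b by simp
  next
    case (Suc j)
    have "?D (Suc j) \<le> nrm n (\<lambda>u. col_sum n (adj w) u / volume n (adj w) - col_sum n p u / volume n p)
      + 2 * sqrt dM * (real (Suc j) * P.rate ^ j * (2 * (noise_const * \<delta>) + 6 * (6 * \<delta>)) * (?N / sqrt dm))"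
      by (rule P.landing_difference[OF x(3) dm_pos degree_bounds])
    also have "\<dots> \<le> ?b + 2 * sqrt dM * (real (Suc j) * P.rate ^ j * (2 * (noise_const * \<delta>) + 6 * (6 * \<delta>)) * (?N / sqrt dm))"
    proof (rule add_right_mono)
      have "nrm n (\<lambda>u. col_sum n (adj w) u / volume n (adj w) - col_sum n p u / volume n p)
          \<le> 12 * sqrt (L / volume n p)"
        using L_ge_1 degree_close(1) volume_close(1)
        by (intro stationary_difference random_weighted_graph mean.weighted_graph_axioms) auto
      also have "\<dots> \<le> ?b"
      proof (intro mult_left_mono real_sqrt_le_mono divide_left_mono volume_ge)
        show "0 < volume n p * (real n * dm)" using mean.vol_pos dm_pos n by simp
      qed (use L_ge_1 in simp_all)
      finally show "nrm n (\<lambda>u. col_sum n (adj w) u / volume n (adj w) - col_sum n p u / volume n p) \<le> ?b" .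
    qed
    also have "2 * sqrt dM * (real (Suc j) * P.rate ^ j * (2 * (noise_const * \<delta>) + 6 * (6 * \<delta>)) * (?N / sqrt dm))
        = mixing_const * real (Suc j) * P.rate ^ j * ?q * ?N"
    proof -
      have "2 * s * (m * R * (2 * (c * t) + 6 * (6 * t)) * (N / e)) = (4 * c + 72) * m * R * (s * t / e) * N"
        for s m R c t N e :: real
        by (simp add: algebra_simps add_divide_distrib)
      then show ?thesis unfolding q mixing_const_def .
    qed
    finally show ?thesis using Suc by (simp add: rate)
  qed
  have "l2_norm (landing_prob (walk_mat (adjacency_mat n (E w))) x k
      - landing_prob (walk_mat (mean_adjacency_mat n p)) x k) = ?D k"
    unfolding adjacency_mat_adj mean_adjacency_mat_def by (rule l2_norm_landing_difference[OF x(1)])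
  then have "l2_norm (landing_prob (walk_mat (adjacency_mat n (E w))) x k
      - landing_prob (walk_mat (mean_adjacency_mat n p)) x k) / l2_norm x
    \<le> (?b + mixing_const * real k * (?lam + rate_const * \<delta>) ^ (k - 1) * ?q * ?N) / ?N"
    using D x(4) by (simp add: l2_norm_nrm[OF x(1)] divide_right_mono)
  also have "\<dots> = ?b * (1 / l2_norm x) + mixing_const * real k * (?lam + rate_const * \<delta>) ^ (k - 1) * ?q"
    using x(4) by (simp add: l2_norm_nrm[OF x(1)] add_divide_distrib)
  finally show ?thesis by (simp add: mean_adjacency_mat_def)
qed

lemma pagerank_bound:
  assumes x: "initial_distribution n x" and \<gamma>: "\<And>k. \<gamma> k \<ge> 0" "summable \<gamma>"
  shows "ennreal (l2_norm (pagerank \<gamma> (walk_mat (adjacency_mat n (E w))) x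
      - pagerank \<gamma> (walk_mat (mean_adjacency_mat n p)) x) / l2_norm x)
    \<le> ennreal (12 * (suminf \<gamma> + 1) * sqrt (L / (real n * dm)) * (1 / l2_norm x))
      + ennreal mixing_const * g_series \<gamma> (second_eigenvalue (walk_mat (mean_adjacency_mat n p)) + rate_const * \<delta>)
        * ennreal (sqrt (dM * L / dm\<^sup>2))"
proof -
  interpret R: weighted_graph n "adj w" by (rule random_weighted_graph)
  note xD = distributionD[OF x]
  let ?lam = "second_eigenvalue (walk_mat (mean_adjacency_mat n p))"
  let ?q = "sqrt (dM * L / dm\<^sup>2)" and ?b = "12 * sqrt (L / (real n * dm)) * (1 / l2_norm x)"
  have N: "l2_norm x > 0" using xD by (simp add: l2_norm_nrm)
  have b: "?b \<ge> 0" using L_ge_1 dm_pos N by simp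
  have const_pos: "mixing_const \<ge> 0" "rate_const \<ge> 0"
    using noise_const by (simp_all add: mixing_const_def rate_const_def)
  have "ennreal (l2_norm (pagerank \<gamma> (walk_mat (adjacency_mat n (E w))) x
      - pagerank \<gamma> (walk_mat (mean_adjacency_mat n p)) x) / l2_norm x)
    \<le> ennreal (suminf \<gamma> * ?b) + ennreal mixing_const * g_series \<gamma> (?lam + rate_const * \<delta>) * ennreal ?q"
    unfolding adjacency_mat_adj mean_adjacency_mat_def l2_norm_pagerank_difference[OF xD(1)]
  proof (rule weighted_series_difference_bound[OF \<gamma>])
    show "(mat_apply n (walk_op n (adj w)) ^^ k) (vec_index x) v \<in> {0..1}" if "v < n" for k v
      using xD that by (intro R.walk_distribution) auto
    show "(mat_apply n (walk_op n p) ^^ k) (vec_index x) v \<in> {0..1}" if "v < n" for k v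
      using xD that by (intro mean.walk_distribution) auto
    show "nrm n (\<lambda>v. (mat_apply n (walk_op n (adj w)) ^^ k) (vec_index x) v - (mat_apply n (walk_op n p) ^^ k) (vec_index x) v) / l2_norm x
        \<le> ?b + mixing_const * real k * (second_eigenvalue mean.W + rate_const * \<delta>) ^ (k - 1) * ?q" for k
      using landing_bound[OF x, of k]
      unfolding adjacency_mat_adj mean_adjacency_mat_def l2_norm_landing_difference[OF xD(1)] .
    show "0 \<le> second_eigenvalue mean.W + rate_const * \<delta>"
      using second_eigenvalue_nonneg[of mean.W] const_pos \<delta>_bounds by simp
    show "0 \<le> ?q" using dM_pos L_ge_1 by simp
  qed (use N b const_pos in auto)
  also have "\<dots> \<le> ennreal (12 * (suminf \<gamma> + 1) * sqrt (L / (real n * dm)) * (1 / l2_norm x))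
      + ennreal mixing_const * g_series \<gamma> (?lam + rate_const * \<delta>) * ennreal ?q"
  proof (intro add_right_mono ennreal_leI)
    \<comment> \<open>The added 1 keeps the constant positive even if all weights vanish.\<close>
    have "suminf \<gamma> * ?b \<le> (suminf \<gamma> + 1) * ?b" using b by (intro mult_right_mono) auto
    then show "suminf \<gamma> * ?b \<le> 12 * (suminf \<gamma> + 1) * sqrt (L / (real n * dm)) * (1 / l2_norm x)"
      by (simp only: mult_ac)
  qed
  finally show ?thesis .
qed

end

text \<open>\<open>Q\<close> is arbitrary: the graph takes finitely many values, so a statement
  about all \<open>k\<close> or about an infinite series still defines an event.\<close>

lemma prob_ge_of_good:
  assumes good: "\<And>w. w \<in> space M \<Longrightarrow> w \<notin> bad \<Longrightarrow> Q (adjacency_mat n (E w))"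
  shows "prob {w \<in> space M. Q (adjacency_mat n (E w))} \<ge> 1 - real n powr (- 1)"
proof -
  have "adjacency_mat n (E w) = adjacency_mat n (\<lambda>u v. (u, v) \<in> edge_set w)" for w
    by (rule eq_matI) (auto simp: adjacency_mat_def E_iff_edge_set)
  then have ev: "{w \<in> space M. Q (adjacency_mat n (E w))} \<in> events"
    by (intro events_edge_set[where Q = "\<lambda>S. Q (adjacency_mat n (\<lambda>u v. (u, v) \<in> S))"]) simp
  have "1 - real n powr (- 1) = 1 - 1 / real n"
    using n by (simp add: powr_minus divide_inverse)
  also have "\<dots> \<le> 1 - prob bad" using prob_bad by simp
  also have "\<dots> = prob (space M - bad)" by (rule prob_compl[symmetric]) (rule bad_in_events)
  also have "\<dots> \<le> prob {w \<in> space M. Q (adjacency_mat n (E w))}"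
    using good by (intro finite_measure_mono ev) auto
  finally show ?thesis .
qed

end

theorem lemma3p2:
  fixes M :: "nat \<Rightarrow> 'a measure"
    and p :: "nat \<Rightarrow> nat \<Rightarrow> nat \<Rightarrow> real"
    and E :: "nat \<Rightarrow> 'a \<Rightarrow> nat \<Rightarrow> nat \<Rightarrow> bool"
    and x0 :: "nat \<Rightarrow> real Matrix.vec"
    and W :: "nat \<Rightarrow> 'a \<Rightarrow> real mat"
    and Abar Wbar :: "nat \<Rightarrow> real mat"
    and dmin dmax lam :: "nat \<Rightarrow> real"
  defines "W \<equiv> \<lambda>n w. walk_mat (adjacency_mat n (E n w))"
    and "Abar \<equiv> \<lambda>n. mean_adjacency_mat n (p n)"
    and "Wbar \<equiv> \<lambda>n. walk_mat (Abar n)"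
    and "dmin \<equiv> \<lambda>n. min_degree (Abar n)"
    and "dmax \<equiv> \<lambda>n. max_degree (Abar n)"
    and "lam \<equiv> \<lambda>n. second_eigenvalue (Wbar n)"
  assumes graph: "\<And>n. n \<ge> 1 \<Longrightarrow> edge_independent_graph (M n) n (p n) (E n)"
    and init: "\<And>n. n \<ge> 1 \<Longrightarrow> initial_distribution n (x0 n)"
    and dmin: "dmin \<in> \<omega>(\<lambda>n. ln (real n))"
  shows "\<exists>C1 C2 C3. C1 > 0 \<and> C2 > 0 \<and> C3 > 0 \<and>
    whp M (\<lambda>n w. \<forall>k.
      l2_norm (landing_prob (W n w) (x0 n) k - landing_prob (Wbar n) (x0 n) k) / l2_norm (x0 n)
      \<le> C1 * sqrt (ln (real n) / (real n * dmin n)) * (1 / l2_norm (x0 n))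
        + C2 * real k * (lam n + C3 * sqrt (ln (real n) / dmin n)) ^ (k - 1)
             * sqrt (dmax n * ln (real n) / (dmin n)\<^sup>2)) \<and>
    (\<forall>\<gamma>. (\<forall>k. \<gamma> k \<ge> 0) \<and> summable \<gamma> \<longrightarrow>
      (\<exists>C1'>0. whp M (\<lambda>n w.
        ennreal (l2_norm (pagerank \<gamma> (W n w) (x0 n) - pagerank \<gamma> (Wbar n) (x0 n)) / l2_norm (x0 n))
        \<le> ennreal (C1' * sqrt (ln (real n) / (real n * dmin n)) * (1 / l2_norm (x0 n)))
          + ennreal C2 * g_series \<gamma> (lam n + C3 * sqrt (ln (real n) / dmin n))
            * ennreal (sqrt (dmax n * ln (real n) / (dmin n)\<^sup>2)))))"
proof -
  have graphs: "\<forall>\<^sub>F n in sequentially. dense_edge_independent_graph (M n) n (p n) (E n)"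
  proof -
    \<comment> \<open>Little-omega beats every constant; 576 is the one that the dense regime asks
      for.\<close>
    have "\<forall>\<^sub>F n in sequentially. 576 * norm (ln (real n)) \<le> norm (dmin n)"
      by (rule landau_omega.smallD[OF dmin]) simp
    then show ?thesis
      using eventually_ge_at_top[of 5]
    proof eventually_elim
      case (elim n)
      interpret edge_independent_graph "M n" n "p n" "E n" using elim by (intro graph) simp
      obtain v where v: "v < n" "dmin n = col_sum n (p n) v"
        using mean_degree_bounds(3)[of n "p n"] elim unfolding dmin_def Abar_def by auto
      have "dmin n \<ge> 0"
        unfolding v(2) col_sum_def by (rule sum_nonneg) (use p_range v(1) in force)
      moreover have "ln (real n) \<ge> 0" using elim by simp
      ultimately have "576 * ln (real n) \<le> min_degree (mean_adjacency_mat n (p n))"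
        using elim by (simp add: dmin_def Abar_def)
      then show ?case using elim by unfold_locales simp_all
    qed
  qed
  \<comment> \<open>The exceptional event has probability at most \<open>1 / n\<close>, so the
    exponent \<open>c = 1\<close> serves for every \<open>Q\<close>.\<close>
  have whpI: "whp M (\<lambda>n w. Q n (adjacency_mat n (E n w)))"
    if "\<And>n w. dense_edge_independent_graph (M n) n (p n) (E n) \<Longrightarrow> n \<ge> 1 \<Longrightarrow> w \<in> space (M n)
      \<Longrightarrow> w \<notin> dense_edge_independent_graph.bad (M n) n (p n) (E n) \<Longrightarrow> Q n (adjacency_mat n (E n w))" for Q
    unfolding whp_def
  proof (intro exI[of _ 1] conjI)
    show "\<forall>\<^sub>F n in sequentially. 1 - real n powr (- 1)
        \<le> measure (M n) {w \<in> space (M n). Q n (adjacency_mat n (E n w))}"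
      using graphs eventually_ge_at_top[of 1]
    proof eventually_elim
      case (elim n)
      interpret dense_edge_independent_graph "M n" n "p n" "E n"
        "min_degree (mean_adjacency_mat n (p n))" "max_degree (mean_adjacency_mat n (p n))"
        "ln (real n)" "sqrt (ln (real n) / min_degree (mean_adjacency_mat n (p n)))"
        by (fact | rule reflexive)+
      show ?case using that elim by (intro prob_ge_of_good) auto
    qed
  qed simp
  have const_pos: "mixing_const > 0" "rate_const > 0"
    using noise_const by (simp_all add: mixing_const_def rate_const_def)
  have landing: "whp M (\<lambda>n w. \<forall>k.
      l2_norm (landing_prob (W n w) (x0 n) k - landing_prob (Wbar n) (x0 n) k) / l2_norm (x0 n)
      \<le> 12 * sqrt (ln (real n) / (real n * dmin n)) * (1 / l2_norm (x0 n))
        + mixing_const * real k * (lam n + rate_const * sqrt (ln (real n) / dmin n)) ^ (k - 1)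
             * sqrt (dmax n * ln (real n) / (dmin n)\<^sup>2))"
    unfolding W_def Wbar_def lam_def dmin_def dmax_def Abar_def
  proof (rule whpI)
    fix n w
    assume graph_n: "dense_edge_independent_graph (M n) n (p n) (E n)" and n1: "n \<ge> 1" and good: "w \<in> space (M n)"
      "w \<notin> dense_edge_independent_graph.bad (M n) n (p n) (E n)"
    interpret dense_edge_independent_graph "M n" n "p n" "E n"
        "min_degree (mean_adjacency_mat n (p n))" "max_degree (mean_adjacency_mat n (p n))"
        "ln (real n)" "sqrt (ln (real n) / min_degree (mean_adjacency_mat n (p n)))"
        by (rule graph_n reflexive)+
    show "\<forall>k. l2_norm (landing_prob (walk_mat (adjacency_mat n (E n w))) (x0 n) k
          - landing_prob (walk_mat (mean_adjacency_mat n (p n))) (x0 n) k) / l2_norm (x0 n)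
      \<le> 12 * sqrt (ln (real n) / (real n * min_degree (mean_adjacency_mat n (p n)))) * (1 / l2_norm (x0 n))
        + mixing_const * real k * (second_eigenvalue (walk_mat (mean_adjacency_mat n (p n)))
            + rate_const * sqrt (ln (real n) / min_degree (mean_adjacency_mat n (p n)))) ^ (k - 1)
          * sqrt (max_degree (mean_adjacency_mat n (p n)) * ln (real n) / (min_degree (mean_adjacency_mat n (p n)))\<^sup>2)"
      using landing_bound[OF good init[OF n1]] by blast
  qed
  have pagerank: "whp M (\<lambda>n w.
        ennreal (l2_norm (pagerank \<gamma> (W n w) (x0 n) - pagerank \<gamma> (Wbar n) (x0 n)) / l2_norm (x0 n))
        \<le> ennreal (12 * (suminf \<gamma> + 1) * sqrt (ln (real n) / (real n * dmin n)) * (1 / l2_norm (x0 n)))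
          + ennreal mixing_const * g_series \<gamma> (lam n + rate_const * sqrt (ln (real n) / dmin n))
            * ennreal (sqrt (dmax n * ln (real n) / (dmin n)\<^sup>2)))"
    if \<gamma>: "\<And>k. \<gamma> k \<ge> 0" "summable \<gamma>" for \<gamma>
    unfolding W_def Wbar_def lam_def dmin_def dmax_def Abar_def
  proof (rule whpI)
    fix n w
    assume graph_n: "dense_edge_independent_graph (M n) n (p n) (E n)" and n1: "n \<ge> 1" and good: "w \<in> space (M n)"
      "w \<notin> dense_edge_independent_graph.bad (M n) n (p n) (E n)"
    interpret dense_edge_independent_graph "M n" n "p n" "E n"
        "min_degree (mean_adjacency_mat n (p n))" "max_degree (mean_adjacency_mat n (p n))"
        "ln (real n)" "sqrt (ln (real n) / min_degree (mean_adjacency_mat n (p n)))"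
        by (rule graph_n reflexive)+
    show "ennreal (l2_norm (pagerank \<gamma> (walk_mat (adjacency_mat n (E n w))) (x0 n)
          - pagerank \<gamma> (walk_mat (mean_adjacency_mat n (p n))) (x0 n)) / l2_norm (x0 n))
      \<le> ennreal (12 * (suminf \<gamma> + 1) * sqrt (ln (real n) / (real n * min_degree (mean_adjacency_mat n (p n)))) * (1 / l2_norm (x0 n)))
        + ennreal mixing_const * g_series \<gamma> (second_eigenvalue (walk_mat (mean_adjacency_mat n (p n)))
            + rate_const * sqrt (ln (real n) / min_degree (mean_adjacency_mat n (p n))))
          * ennreal (sqrt (max_degree (mean_adjacency_mat n (p n)) * ln (real n) / (min_degree (mean_adjacency_mat n (p n)))\<^sup>2))"
      by (rule pagerank_bound[OF good init[OF n1] \<gamma>])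
  qed
  show ?thesis
  \<comment> \<open>\<open>mixing_const\<close> and \<open>rate_const\<close> serve the landing
    bound and every weight sequence at once; 12 becomes \<open>12 * (suminf \<gamma> + 1)\<close>
    for PageRank.\<close>
  proof (rule exI[of _ 12], rule exI[of _ mixing_const], rule exI[of _ rate_const],
      intro conjI allI impI landing const_pos)
    fix \<gamma> :: "nat \<Rightarrow> real"
    assume \<gamma>: "(\<forall>k. \<gamma> k \<ge> 0) \<and> summable \<gamma>"
    then have "suminf \<gamma> \<ge> 0" by (simp add: suminf_nonneg)
    then have "12 * (suminf \<gamma> + 1) > 0" by simp
    with pagerank[of \<gamma>] \<gamma> show "\<exists>C1'>0. whp M (\<lambda>n w.
        ennreal (l2_norm (pagerank \<gamma> (W n w) (x0 n) - pagerank \<gamma> (Wbar n) (x0 n)) / l2_norm (x0 n))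
        \<le> ennreal (C1' * sqrt (ln (real n) / (real n * dmin n)) * (1 / l2_norm (x0 n)))
          + ennreal mixing_const * g_series \<gamma> (lam n + rate_const * sqrt (ln (real n) / dmin n))
            * ennreal (sqrt (dmax n * ln (real n) / (dmin n)\<^sup>2)))"
      by blast
  qed simp
qed

end
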